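(* Let $(\varepsilon_u)_{u\in\mathbb Z}$ be an i.i.d. sequence of real random variables, let $f\colon\mathbb R^{\mathbb Z}\to\mathbb R$ be measurable, and let $h\colon\mathbb R^2\to\mathbb R$ be measurable and symmetric. Let $X_j=f((\varepsilon_{j-k})_{k\in\mathbb Z})$ and $U_n=\sum_{1\le i<j\le n}h(X_i,X_j)$. Suppose that $$\sum_{\ell\ge 0}\ell^{1/2}\theta_{\ell,2}<+\infty,\qquad \sum_{\ell\ge 0}\ell^{2}\theta_{\ell,1}<+\infty,$$ and that $$\sum_{k\in\mathbb Z}\bigl|\operatorname{Cov}(Y_0,Y_k)\bigr|<+\infty,$$ where the random variable $Y_k$ is defined by the following $\mathbb L^2$-convergence: $$Y_k=\lim_{\ell\to+\infty}\Bigl(\mathbb E\bigl[h(f_\ell(V_{k,\ell}),f_\ell(V'_{0,\ell}))\mid V_{k,\ell}\bigr]-\mathbb E\bigl[h(f_\ell(V_{k,\ell}),f_\ell(V'_{0,\ell}))\bigr]\Bigr).$$ Then $$\frac{1}{n^{3/2}}\bigl(U_n-\mathbb E[U_n]\bigr)\to N(0,\sigma^2)\quad\text{in distribution},\qquad \sigma^2:=\sum_{k\in\mathbb Z}\operatorname{Cov}(Y_0,Y_k).$$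
   Context: Notation: $(\varepsilon'_u)_{u\in\mathbb Z}$ is an independent copy of $(\varepsilon_u)_{u\in\mathbb Z}$; $V_{j,\ell}:=(\varepsilon_u)_{u=j-\ell}^{j+\ell}$ and $V'_{j,\ell}:=(\varepsilon'_u)_{u=j-\ell}^{j+\ell}$ for $j\in\mathbb Z$, $\ell\ge0$. $X_0$ is integrable and the measurable function $f_\ell\colon\mathbb R^{2\ell+1}\to\mathbb R$ is such that $\mathbb E[X_j\mid V_{j,\ell}]=f_\ell(V_{j,\ell})$ a.s. (by stationarity it can be chosen independent of $j$). Symmetric means $h(x,y)=h(y,x)$ for all $x,y$. The dependence coefficients are, for $\ell\ge1$ and $p\ge 1$, $$\theta_{\ell,p}:=\sup_{j\ge 0}\bigl\|h(f_\ell(V_{0,\ell}),f_\ell(V_{j,\ell}))-h(f_{\ell-1}(V_{0,\ell-1}),f_{\ell-1}(V_{j,\ell-1}))\bigr\|_p,$$ and $\theta_{0,p}:=\sup_{j\ge0}\|h(f_0(V_{0,0}),f_0(V_{j,0}))\|_p$, where $\|Y\|_p=(\mathbb E|Y|^p)^{1/p}$. $N(0,\sigma^2)$ is the centered normal law with variance $\sigma^2$ (the case $\sigma^2=0$ is possible).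
   Formalization: The formal theorem additionally assumes that for every j ≥ 1, h(f_ℓ(V_{0,ℓ}), f_ℓ(V_{j,ℓ})) → h(X_0, X_j) almost surely as ℓ → ∞ (without this the claim fails for discontinuous h), and that θ_{0,2} is finite. *)

theory Defs
  imports "HOL-Probability.Probability"
begin

(* ||Y||_p as an extended real: it is infinite, rather than a default value,
   when |Y|^p is not integrable. *)
definition Lp_norm :: "'a measure \<Rightarrow> real \<Rightarrow> ('a \<Rightarrow> real) \<Rightarrow> ennreal" where
  "Lp_norm M p Y =
     (let I = (\<integral>\<^sup>+\<omega>. ennreal (\<bar>Y \<omega>\<bar> powr p) \<partial>M)
      in if I = \<top> then \<top> else ennreal (enn2real I powr (1 / p)))"

definition L2_limit :: "'a measure \<Rightarrow> (nat \<Rightarrow> 'a \<Rightarrow> real) \<Rightarrow> ('a \<Rightarrow> real) \<Rightarrow> bool" where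
  "L2_limit M Z Y \<longleftrightarrow>
     Y \<in> borel_measurable M \<and> Lp_norm M 2 Y < \<top> \<and>
     (\<lambda>l. Lp_norm M 2 (\<lambda>\<omega>. Z l \<omega> - Y \<omega>)) \<longlonglongrightarrow> 0"

definition covar :: "'a measure \<Rightarrow> ('a \<Rightarrow> real) \<Rightarrow> ('a \<Rightarrow> real) \<Rightarrow> real" where
  "covar M Y Z = (\<integral>\<omega>. (Y \<omega> - (\<integral>x. Y x \<partial>M)) * (Z \<omega> - (\<integral>x. Z x \<partial>M)) \<partial>M)"

(* N(0, v), where v is the variance and v = 0 gives the Dirac mass at 0. *)
definition centered_normal :: "real \<Rightarrow> real measure" where
  "centered_normal v =
     (if v = 0 then return borel 0
      else density lborel (\<lambda>x. ennreal (normal_density 0 (sqrt v) x)))"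

definition iid_sequence :: "'a measure \<Rightarrow> (int \<Rightarrow> 'a \<Rightarrow> real) \<Rightarrow> bool" where
  "iid_sequence M e \<longleftrightarrow>
     prob_space.indep_vars M (\<lambda>_. borel) e UNIV \<and>
     (\<forall>u. distr M borel (e u) = distr M borel (e 0))"

definition independent_copy ::
  "'a measure \<Rightarrow> (int \<Rightarrow> 'a \<Rightarrow> real) \<Rightarrow> (int \<Rightarrow> 'a \<Rightarrow> real) \<Rightarrow> bool" where
  "independent_copy M e e' \<longleftrightarrow>
     (let S = Pi\<^sub>M UNIV (\<lambda>_::int. borel :: real measure)
      in prob_space.indep_var M S (\<lambda>\<omega> u. e u \<omega>) S (\<lambda>\<omega> u. e' u \<omega>) \<and>
         distr M S (\<lambda>\<omega> u. e' u \<omega>) = distr M S (\<lambda>\<omega> u. e u \<omega>))"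

definition shift_process ::
  "((int \<Rightarrow> real) \<Rightarrow> real) \<Rightarrow> (int \<Rightarrow> 'a \<Rightarrow> real) \<Rightarrow> int \<Rightarrow> 'a \<Rightarrow> real" where
  "shift_process f e j \<omega> = f (\<lambda>k. e (j - k) \<omega>)"

(* R^(2l+1), with coordinates indexed by the offsets -l, ..., l.  Using offsets makes
   the windows V_{j,l} take values in one space for all centres j. *)
definition window_space :: "nat \<Rightarrow> (int \<Rightarrow> real) measure" where
  "window_space l = Pi\<^sub>M {- int l..int l} (\<lambda>_. borel)"

(* V_{j,l} = (e_u), u = j-l, ..., j+l *)
definition window :: "(int \<Rightarrow> 'a \<Rightarrow> real) \<Rightarrow> int \<Rightarrow> nat \<Rightarrow> 'a \<Rightarrow> (int \<Rightarrow> real)" where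
  "window e j l \<omega> = (\<lambda>i\<in>{- int l..int l}. e (j + i) \<omega>)"

definition cond_exp_window ::
  "'a measure \<Rightarrow> (int \<Rightarrow> 'a \<Rightarrow> real) \<Rightarrow> int \<Rightarrow> nat \<Rightarrow> ('a \<Rightarrow> real) \<Rightarrow> 'a \<Rightarrow> real" where
  "cond_exp_window M e j l =
     real_cond_exp M (vimage_algebra (space M) (window e j l) (window_space l))"

(* F l is the function f_l, with E[X_j | V_{j,l}] = f_l(V_{j,l}) a.s. for every j. *)
definition window_regression ::
  "'a measure \<Rightarrow> (int \<Rightarrow> 'a \<Rightarrow> real) \<Rightarrow> (int \<Rightarrow> 'a \<Rightarrow> real) \<Rightarrow>
     (nat \<Rightarrow> (int \<Rightarrow> real) \<Rightarrow> real) \<Rightarrow> bool" where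
  "window_regression M e X F \<longleftrightarrow>
     (\<forall>l. F l \<in> borel_measurable (window_space l) \<and>
        (\<forall>j. AE \<omega> in M. cond_exp_window M e j l (X j) \<omega> = F l (window e j l \<omega>)))"

(* h(f_l(V_{0,l}), f_l(V_{j,l})) *)
definition kernel_approx ::
  "(int \<Rightarrow> 'a \<Rightarrow> real) \<Rightarrow> (real \<Rightarrow> real \<Rightarrow> real) \<Rightarrow> (nat \<Rightarrow> (int \<Rightarrow> real) \<Rightarrow> real) \<Rightarrow>
     int \<Rightarrow> nat \<Rightarrow> 'a \<Rightarrow> real" where
  "kernel_approx e h F j l \<omega> = h (F l (window e 0 l \<omega>)) (F l (window e j l \<omega>))"

definition dep_coeff ::
  "'a measure \<Rightarrow> (int \<Rightarrow> 'a \<Rightarrow> real) \<Rightarrow> (real \<Rightarrow> real \<Rightarrow> real) \<Rightarrow>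
     (nat \<Rightarrow> (int \<Rightarrow> real) \<Rightarrow> real) \<Rightarrow> nat \<Rightarrow> real \<Rightarrow> ennreal" where
  "dep_coeff M e h F l p =
     (if l = 0 then (SUP j::nat. Lp_norm M p (kernel_approx e h F (int j) 0))
      else (SUP j::nat. Lp_norm M p (\<lambda>\<omega>.
              kernel_approx e h F (int j) l \<omega> - kernel_approx e h F (int j) (l - 1) \<omega>)))"

(* E[h(f_l(V_{k,l}), f_l(V'_{0,l})) | V_{k,l}] - E[h(f_l(V_{k,l}), f_l(V'_{0,l}))] *)
definition projection_approx ::
  "'a measure \<Rightarrow> (int \<Rightarrow> 'a \<Rightarrow> real) \<Rightarrow> (int \<Rightarrow> 'a \<Rightarrow> real) \<Rightarrow> (real \<Rightarrow> real \<Rightarrow> real) \<Rightarrow>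
     (nat \<Rightarrow> (int \<Rightarrow> real) \<Rightarrow> real) \<Rightarrow> int \<Rightarrow> nat \<Rightarrow> 'a \<Rightarrow> real" where
  "projection_approx M e e' h F k l \<omega> =
     (let H = (\<lambda>x. h (F l (window e k l x)) (F l (window e' 0 l x)))
      in cond_exp_window M e k l H \<omega> - (\<integral>x. H x \<partial>M))"

definition U_stat ::
  "(real \<Rightarrow> real \<Rightarrow> real) \<Rightarrow> (int \<Rightarrow> 'a \<Rightarrow> real) \<Rightarrow> nat \<Rightarrow> 'a \<Rightarrow> real" where
  "U_stat h X n \<omega> =
     (\<Sum>(i, j)\<in>{(i, j). 1 \<le> i \<and> i < j \<and> j \<le> n}. h (X (int i) \<omega>) (X (int j) \<omega>))"

end

(* Write k_l(i,j) = h(f_l(V_{i,l}), f_l(V_{j,l})) and let U_n^l be the U-statistic with this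
   kernel.  Summands of U_n^l - U_n^{l-1} are uncorrelated unless two of their indices are at
   distance at most 2l, so n^{-3/2} times the centred difference has L2 norm at most
   5 l^{1/2} theta_{l,2}; hence U_n may be replaced by U_n^l up to an error that is small
   uniformly in n.  For fixed l, the Hoeffding decomposition splits the centred U_n^l into
   (n-1) times a sum of the 2l-dependent projections Y_i^l and a degenerate part of L2 norm O(n):
   E[R(i,j) R(i',j')] vanishes as soon as one index is far from the other three.  The projections
   satisfy the CLT by Bernstein blocks.  The same covariance count, applied to Y^l - Y^{l-1},
   gives convergence of the variances through
   Var(n^{-1/2} sum_{i<=n} Y_i) --> sum_k Cov(Y_0, Y_k). *)
theory Submission
  imports Defs
begin

section \<open>Square-integrable random variables\<close>

text \<open>Errors are measured in the L2 norm throughout: characteristic functions at t differ by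
  at most |t| times that norm, so the same estimates control the limit law and the variances. The
  obstacle is the order of limits: n can tend to infinity only with l fixed, so the errors in l must
  be uniform in n. The count behind l^{1/2}: a pair has O(l n) correlated partners among O(n^2)
  pairs, which gives exactly the scale n^{3/2}. For fixed l, degeneracy leaves a far pair only
  O(l^2) partners, which gains the missing factor n^{1/2}. Since h is merely measurable, convergence
  of f_l(V_{j,l}) to X_j would not give convergence of the kernels; \<open>kernel_conv\<close> links
  the windows to h(X_0, X_j). The coefficients bound only pairs taken from one sequence. Moments of
  h(f_l(V), f_l(V')) with an independent copy are read off pairs at distance 2l + 1, whose windows
  are disjoint and hence independent.\<close>

definition L2 :: "'a measure \<Rightarrow> ('a \<Rightarrow> real) set" where
  "L2 M = {Y \<in> borel_measurable M. integrable M (\<lambda>x. (Y x)\<^sup>2)}"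

text \<open>Built on the Bochner integral, this is 0 by default outside \<open>L2\<close>, so a
  bound on it has content only together with membership in \<open>L2\<close>.\<close>

definition l2norm :: "'a measure \<Rightarrow> ('a \<Rightarrow> real) \<Rightarrow> real" where
  "l2norm M Y = sqrt (\<integral>x. (Y x)\<^sup>2 \<partial>M)"

lemma L2I: "Y \<in> borel_measurable M \<Longrightarrow> integrable M (\<lambda>x. (Y x)\<^sup>2) \<Longrightarrow> Y \<in> L2 M"
  by (simp add: L2_def)

lemma L2_measurable: "Y \<in> L2 M \<Longrightarrow> Y \<in> borel_measurable M"
  by (simp add: L2_def)

lemma L2_square: "Y \<in> L2 M \<Longrightarrow> integrable M (\<lambda>x. (Y x)\<^sup>2)"
  by (simp add: L2_def)

lemma l2norm_nonneg [simp]: "0 \<le> l2norm M Y"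
  by (simp add: l2norm_def)

lemma l2norm_squared: "(l2norm M Y)\<^sup>2 = (\<integral>x. (Y x)\<^sup>2 \<partial>M)"
  by (simp add: l2norm_def)

lemma l2norm_minus_commute: "l2norm M (\<lambda>x. Y x - Z x) = l2norm M (\<lambda>x. Z x - Y x)"
  by (simp add: l2norm_def power2_commute)

lemma L2_mult_integrable:
  assumes "Y \<in> L2 M" "Z \<in> L2 M"
  shows "integrable M (\<lambda>x. Y x * Z x)"
proof (rule Bochner_Integration.integrable_bound)
  show "integrable M (\<lambda>x. (Y x)\<^sup>2 + (Z x)\<^sup>2)"
    using assms by (intro Bochner_Integration.integrable_add L2_square)
  show "(\<lambda>x. Y x * Z x) \<in> borel_measurable M"
    using assms by (intro borel_measurable_times L2_measurable)
  have "\<bar>a * b\<bar> \<le> a\<^sup>2 + b\<^sup>2" for a b :: real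
    using sum_squares_bound[of "\<bar>a\<bar>" "\<bar>b\<bar>"] mult_nonneg_nonneg[of "\<bar>a\<bar>" "\<bar>b\<bar>"]
    unfolding abs_mult power2_abs by linarith
  then show "AE x in M. norm (Y x * Z x) \<le> norm ((Y x)\<^sup>2 + (Z x)\<^sup>2)"
    by simp
qed

lemma L2_cmult:
  assumes "Y \<in> L2 M"
  shows "(\<lambda>x. c * Y x) \<in> L2 M"
  using assms by (auto simp: L2_def power_mult_distrib)

lemma L2_add:
  assumes "Y \<in> L2 M" "Z \<in> L2 M"
  shows "(\<lambda>x. Y x + Z x) \<in> L2 M"
proof (rule L2I)
  show "(\<lambda>x. Y x + Z x) \<in> borel_measurable M"
    using assms by (intro borel_measurable_add L2_measurable)
  have "integrable M (\<lambda>x. (Y x)\<^sup>2 + (Z x)\<^sup>2 + 2 * (Y x * Z x))"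
    using assms by (intro Bochner_Integration.integrable_add L2_square integrable_mult_right
        L2_mult_integrable)
  then show "integrable M (\<lambda>x. (Y x + Z x)\<^sup>2)"
    by (simp add: power2_sum mult.assoc)
qed

lemma L2_diff:
  assumes "Y \<in> L2 M" "Z \<in> L2 M"
  shows "(\<lambda>x. Y x - Z x) \<in> L2 M"
  using L2_add[OF assms(1) L2_cmult[OF assms(2), of "-1"]] by simp

lemma L2_divide: "Y \<in> L2 M \<Longrightarrow> (\<lambda>x. Y x / c) \<in> L2 M"
  using L2_cmult[of Y M "1 / c"] by simp

lemma L2_zero: "(\<lambda>x. 0) \<in> L2 M"
  by (simp add: L2_def)

lemma L2_sum: "(\<And>i. i \<in> I \<Longrightarrow> Y i \<in> L2 M) \<Longrightarrow> (\<lambda>x. \<Sum>i\<in>I. Y i x) \<in> L2 M"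
  by (induction I rule: infinite_finite_induct) (auto intro!: L2_add L2_zero)

lemma (in finite_measure) L2_const: "(\<lambda>x. c) \<in> L2 M"
  by (simp add: L2_def)

lemma (in finite_measure) L2_integrable: "Y \<in> L2 M \<Longrightarrow> integrable M Y"
  by (rule square_integrable_imp_integrable[OF L2_measurable L2_square])

text \<open>The quadratic t -> ||Y - t Z||^2 is nonnegative, so its discriminant is not
  positive.\<close>

lemma l2norm_Cauchy_Schwarz:
  assumes Y: "Y \<in> L2 M" and Z: "Z \<in> L2 M"
  shows "\<bar>\<integral>x. Y x * Z x \<partial>M\<bar> \<le> l2norm M Y * l2norm M Z"
proof -
  define A B C where "A = (\<integral>x. (Y x)\<^sup>2 \<partial>M)" and "B = (\<integral>x. (Z x)\<^sup>2 \<partial>M)"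
    and "C = (\<integral>x. Y x * Z x \<partial>M)"
  have quad: "0 \<le> A - 2 * t * C + t\<^sup>2 * B" for t
  proof -
    have "0 \<le> (\<integral>x. (Y x - t * Z x)\<^sup>2 \<partial>M)"
      by simp
    also have "\<dots> = (\<integral>x. (Y x)\<^sup>2 - 2 * t * (Y x * Z x) + t\<^sup>2 * (Z x)\<^sup>2 \<partial>M)"
      by (intro Bochner_Integration.integral_cong) (simp_all add: power2_diff power_mult_distrib)
    also have "\<dots> = A - 2 * t * C + t\<^sup>2 * B"
      unfolding A_def B_def C_def using Y Z
      by (simp add: L2_square L2_mult_integrable)
    finally show ?thesis .
  qed
  have AB: "0 \<le> A" "0 \<le> B"
    by (simp_all add: A_def B_def)
  have "C\<^sup>2 \<le> A * B"
  proof (cases "B = 0")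
    case True
    have "C = 0"
    proof (rule ccontr)
      assume "C \<noteq> 0"
      \<comment> \<open>With \<open>B = 0\<close> the quadratic degenerates to A - 2tC; this t makes
        it -1.\<close>
      then show False
        using quad[of "(A + 1) / (2 * C)"] True by (simp add: field_simps)
    qed
    then show ?thesis
      using True by simp
  next
    case False
    then have "B > 0"
      using AB by simp
    then have "0 \<le> A - C\<^sup>2 / B"
      using quad[of "C / B"] by (simp add: power2_eq_square field_simps)
    then show ?thesis
      using \<open>B > 0\<close> by (simp add: field_simps)
  qed
  then have "sqrt (C\<^sup>2) \<le> sqrt (A * B)"
    by (rule real_sqrt_le_mono)
  then show ?thesis
    by (simp add: l2norm_def A_def B_def C_def real_sqrt_mult)
qed

lemma l2norm_add:
  assumes Y: "Y \<in> L2 M" and Z: "Z \<in> L2 M"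
  shows "l2norm M (\<lambda>x. Y x + Z x) \<le> l2norm M Y + l2norm M Z"
proof (rule power2_le_imp_le)
  have "(l2norm M (\<lambda>x. Y x + Z x))\<^sup>2 = (\<integral>x. (Y x)\<^sup>2 + (Z x)\<^sup>2 + 2 * (Y x * Z x) \<partial>M)"
    by (simp add: l2norm_squared power2_sum mult.assoc)
  also have "\<dots> = (l2norm M Y)\<^sup>2 + (l2norm M Z)\<^sup>2 + 2 * (\<integral>x. Y x * Z x \<partial>M)"
    using Y Z by (simp add: l2norm_squared L2_square L2_mult_integrable)
  also have "\<dots> \<le> (l2norm M Y + l2norm M Z)\<^sup>2"
    using l2norm_Cauchy_Schwarz[OF Y Z] by (simp add: power2_sum)
  finally show "(l2norm M (\<lambda>x. Y x + Z x))\<^sup>2 \<le> (l2norm M Y + l2norm M Z)\<^sup>2" .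
qed simp

lemma l2norm_cmult: "l2norm M (\<lambda>x. c * Y x) = \<bar>c\<bar> * l2norm M Y"
  by (simp add: l2norm_def power_mult_distrib real_sqrt_mult)

lemma l2norm_divide: "l2norm M (\<lambda>x. Y x / c) = l2norm M Y / \<bar>c\<bar>"
  using l2norm_cmult[of M "1 / c" Y] by simp

lemma l2norm_zero [simp]: "l2norm M (\<lambda>x. 0) = 0"
  by (simp add: l2norm_def)

lemma l2norm_diff:
  assumes "Y \<in> L2 M" "Z \<in> L2 M"
  shows "l2norm M (\<lambda>x. Y x - Z x) \<le> l2norm M Y + l2norm M Z"
  using l2norm_add[OF assms(1) L2_cmult[OF assms(2), of "-1"]] l2norm_cmult[of M "-1" Z] by simp

lemma l2norm_triangle_sub:
  assumes "Y \<in> L2 M" "Z \<in> L2 M"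
  shows "\<bar>l2norm M Y - l2norm M Z\<bar> \<le> l2norm M (\<lambda>x. Y x - Z x)"
proof -
  have "l2norm M Y \<le> l2norm M (\<lambda>x. Y x - Z x) + l2norm M Z"
    using l2norm_add[OF L2_diff[OF assms] assms(2)] by simp
  moreover have "l2norm M Z \<le> l2norm M (\<lambda>x. Y x - Z x) + l2norm M Y"
    using l2norm_add[OF L2_diff[OF assms(2,1)] assms(1)]
    unfolding l2norm_minus_commute[of M Z Y] by simp
  ultimately show ?thesis
    by linarith
qed

lemma l2norm_sum:
  "(\<And>i. i \<in> I \<Longrightarrow> Y i \<in> L2 M) \<Longrightarrow> l2norm M (\<lambda>x. \<Sum>i\<in>I. Y i x) \<le> (\<Sum>i\<in>I. l2norm M (Y i))"
proof (induction I rule: infinite_finite_induct)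
  case (insert i I)
  then have "l2norm M (\<lambda>x. Y i x + (\<Sum>i\<in>I. Y i x)) \<le> l2norm M (Y i) + l2norm M (\<lambda>x. \<Sum>i\<in>I. Y i x)"
    by (intro l2norm_add L2_sum) auto
  also have "\<dots> \<le> l2norm M (Y i) + (\<Sum>i\<in>I. l2norm M (Y i))"
    using insert by simp
  finally show ?case
    using insert by simp
qed auto

lemma l2norm_AE_cong:
  assumes "AE x in M. Y x = Z x" "Y \<in> borel_measurable M" "Z \<in> borel_measurable M"
  shows "l2norm M Y = l2norm M Z"
  unfolding l2norm_def using assms by (intro arg_cong[where f=sqrt] integral_cong_AE) auto

section \<open>Limits of sequences with summable L2 increments\<close>

lemma nn_integral_l2norm:
  assumes "Y \<in> L2 M"
  shows "(\<integral>\<^sup>+x. ennreal ((Y x)\<^sup>2) \<partial>M) = ennreal ((l2norm M Y)\<^sup>2)"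
  unfolding l2norm_squared using L2_square[OF assms] by (intro nn_integral_eq_integral) auto

lemma L2_nn_integral_bound:
  assumes "Y \<in> borel_measurable M" "(\<integral>\<^sup>+x. ennreal ((Y x)\<^sup>2) \<partial>M) \<le> ennreal (c\<^sup>2)" "0 \<le> c"
  shows "Y \<in> L2 M" "l2norm M Y \<le> c"
proof -
  have "(\<integral>\<^sup>+x. ennreal ((Y x)\<^sup>2) \<partial>M) < \<infinity>"
    using assms(2) by (rule order.strict_trans1) simp
  then show *: "Y \<in> L2 M"
    using assms(1) by (intro L2I integrableI_nonneg) auto
  show "l2norm M Y \<le> c"
    using assms(2,3) unfolding nn_integral_l2norm[OF *] by (simp add: abs_le_square_iff)
qed

text \<open>Fatou for the squares, as extended integrals, so that square integrability of the limit
  is a conclusion and not a premise.\<close>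

lemma L2_limit_Fatou:
  fixes Z :: "nat \<Rightarrow> 'a \<Rightarrow> real"
  assumes Z: "\<And>n. Z n \<in> L2 M" "\<forall>\<^sub>F n in sequentially. l2norm M (Z n) \<le> c"
    and Y: "Y \<in> borel_measurable M" "AE x in M. (\<lambda>n. Z n x) \<longlonglongrightarrow> Y x" and c: "0 \<le> c"
  shows "Y \<in> L2 M" "l2norm M Y \<le> c"
proof -
  have [measurable]: "Z n \<in> borel_measurable M" for n
    using Z(1) by (rule L2_measurable)
  have "(\<integral>\<^sup>+x. ennreal ((Y x)\<^sup>2) \<partial>M) = (\<integral>\<^sup>+x. liminf (\<lambda>n. ennreal ((Z n x)\<^sup>2)) \<partial>M)"
  proof (rule nn_integral_cong_AE)
    show "AE x in M. ennreal ((Y x)\<^sup>2) = liminf (\<lambda>n. ennreal ((Z n x)\<^sup>2))"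
      using Y(2)
    proof eventually_elim
      case (elim x)
      then have "(\<lambda>n. ennreal ((Z n x)\<^sup>2)) \<longlonglongrightarrow> ennreal ((Y x)\<^sup>2)"
        by (intro tendsto_ennrealI tendsto_intros)
      then show ?case
        by (intro lim_imp_Liminf[symmetric]) auto
    qed
  qed
  also have "\<dots> \<le> liminf (\<lambda>n. \<integral>\<^sup>+x. ennreal ((Z n x)\<^sup>2) \<partial>M)"
    by (rule nn_integral_liminf) simp
  also have "\<dots> \<le> ennreal (c\<^sup>2)"
  proof (rule order_trans[OF Liminf_le_Limsup Limsup_bounded])
    show "\<forall>\<^sub>F n in sequentially. (\<integral>\<^sup>+x. ennreal ((Z n x)\<^sup>2) \<partial>M) \<le> ennreal (c\<^sup>2)"
      using Z(2) by eventually_elim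
        (simp add: nn_integral_l2norm[OF Z(1)] power_mono ennreal_leI)
  qed simp
  finally show "Y \<in> L2 M" "l2norm M Y \<le> c"
    using L2_nn_integral_bound[OF Y(1) _ c] by auto
qed

lemma L2_cauchy_steps:
  fixes Z :: "nat \<Rightarrow> 'a \<Rightarrow> real"
  assumes Z: "\<And>n. Z n \<in> L2 M"
    and c: "\<And>n. l2norm M (\<lambda>x. Z (Suc n) x - Z n x) \<le> c n"
  shows "l2norm M (\<lambda>x. Z (n + k) x - Z n x) \<le> (\<Sum>i<k. c (i + n))"
proof (induction k)
  case (Suc k)
  have "l2norm M (\<lambda>x. Z (n + Suc k) x - Z n x)
      = l2norm M (\<lambda>x. (Z (Suc (n + k)) x - Z (n + k) x) + (Z (n + k) x - Z n x))"
    by simp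
  also have "\<dots> \<le> c (n + k) + (\<Sum>i<k. c (i + n))"
    using l2norm_add[OF L2_diff[OF Z Z] L2_diff[OF Z Z], of "Suc (n + k)" "n + k" "n + k" n]
      Suc c[of "n + k"] by linarith
  finally show ?case
    by (simp add: add.commute)
qed simp

text \<open>For fixed n all later terms stay within the tail of \<open>c\<close> of
  \<open>Z n\<close>; Fatou along the later index hands this to the limit. An almost everywhere
  limit is thus identified as the L2 limit, with a rate.\<close>

lemma L2_limit_steps:
  fixes Z :: "nat \<Rightarrow> 'a \<Rightarrow> real"
  assumes Z: "\<And>n. Z n \<in> L2 M"
    and c: "\<And>n. l2norm M (\<lambda>x. Z (Suc n) x - Z n x) \<le> c n" "summable c"
    and Y: "Y \<in> borel_measurable M" "AE x in M. (\<lambda>n. Z n x) \<longlonglongrightarrow> Y x"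
  shows "Y \<in> L2 M" "l2norm M (\<lambda>x. Z n x - Y x) \<le> (\<Sum>i. c (i + n))"
proof -
  have c0: "0 \<le> c n" for n
    using c(1)[of n] l2norm_nonneg order_trans by blast
  have *: "(\<lambda>x. Y x - Z n x) \<in> L2 M \<and> l2norm M (\<lambda>x. Y x - Z n x) \<le> (\<Sum>i. c (i + n))" for n
  proof -
    note [measurable] = Y(1) L2_measurable[OF Z]
    have s: "summable (\<lambda>i. c (i + n))"
      using c(2) by (subst summable_iff_shift)
    have "\<forall>\<^sub>F m in sequentially. l2norm M (\<lambda>x. Z m x - Z n x) \<le> (\<Sum>i. c (i + n))"
    proof (rule eventually_sequentiallyI[of n])
      fix m assume "n \<le> m"
      then obtain k where m: "m = n + k"
        using le_Suc_ex by blast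
      have "l2norm M (\<lambda>x. Z m x - Z n x) \<le> (\<Sum>i<k. c (i + n))"
        unfolding m by (rule L2_cauchy_steps[where Z=Z and c=c, OF Z c(1)])
      also have "\<dots> \<le> (\<Sum>i. c (i + n))"
        using s c0 by (intro sum_le_suminf) auto
      finally show "l2norm M (\<lambda>x. Z m x - Z n x) \<le> (\<Sum>i. c (i + n))" .
    qed
    moreover have "AE x in M. (\<lambda>m. Z m x - Z n x) \<longlonglongrightarrow> Y x - Z n x"
      using Y(2) by eventually_elim (intro tendsto_intros)
    moreover have "0 \<le> (\<Sum>i. c (i + n))"
      using s c0 by (intro suminf_nonneg) auto
    ultimately show ?thesis
      using L2_limit_Fatou[of "\<lambda>m x. Z m x - Z n x" M "\<Sum>i. c (i + n)" "\<lambda>x. Y x - Z n x"]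
      by (auto intro: L2_diff Z)
  qed
  show "Y \<in> L2 M"
    using L2_add[OF *[of 0, THEN conjunct1] Z[of 0]] by simp
  show "l2norm M (\<lambda>x. Z n x - Y x) \<le> (\<Sum>i. c (i + n))"
    using *[of n] unfolding l2norm_minus_commute[of M Y "Z n"] by (rule conjunct2)
qed

text \<open>Convergence without a rate is upgraded to the tail bound of the increments. This is the
  source of uniformity in n: for each n, convergence in l is known termwise with constants depending
  on n, while the bounds on the increments do not depend on n.\<close>

lemma L2_norm_limit_steps:
  fixes Z :: "nat \<Rightarrow> 'a \<Rightarrow> real"
  assumes Z: "\<And>n. Z n \<in> L2 M" and Y: "Y \<in> L2 M"
    and c: "\<And>n. l2norm M (\<lambda>x. Z (Suc n) x - Z n x) \<le> c n" "summable c"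
    and lim: "(\<lambda>n. l2norm M (\<lambda>x. Z n x - Y x)) \<longlonglongrightarrow> 0"
  shows "l2norm M (\<lambda>x. Z n x - Y x) \<le> (\<Sum>i. c (i + n))"
proof -
  have c0: "0 \<le> c n" for n
    using c(1)[of n] l2norm_nonneg order_trans by blast
  have s: "summable (\<lambda>i. c (i + n))"
    using c(2) by (subst summable_iff_shift)
  have bd: "l2norm M (\<lambda>x. Z n x - Y x) \<le> (\<Sum>i. c (i + n)) + l2norm M (\<lambda>x. Z (n + k) x - Y x)" for k
  proof -
    have "l2norm M (\<lambda>x. Z n x - Y x)
        \<le> l2norm M (\<lambda>x. Z n x - Z (n + k) x) + l2norm M (\<lambda>x. Z (n + k) x - Y x)"
      using l2norm_add[OF L2_diff[OF Z Z] L2_diff[OF Z Y], of n "n + k" "n + k"] by simp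
    also have "l2norm M (\<lambda>x. Z n x - Z (n + k) x) \<le> (\<Sum>i<k. c (i + n))"
      unfolding l2norm_minus_commute[of M "Z n"] by (rule L2_cauchy_steps[where Z=Z and c=c, OF Z c(1)])
    also have "\<dots> \<le> (\<Sum>i. c (i + n))"
      using s c0 by (intro sum_le_suminf) auto
    finally show ?thesis
      by simp
  qed
  have "(\<lambda>k. l2norm M (\<lambda>x. Z (n + k) x - Y x)) \<longlonglongrightarrow> 0"
    using LIMSEQ_ignore_initial_segment[OF lim, of n] by (simp add: add.commute)
  then have "(\<lambda>k. (\<Sum>i. c (i + n)) + l2norm M (\<lambda>x. Z (n + k) x - Y x)) \<longlonglongrightarrow> (\<Sum>i. c (i + n)) + 0"
    by (intro tendsto_intros)
  then have "(\<lambda>k. (\<Sum>i. c (i + n)) + l2norm M (\<lambda>x. Z (n + k) x - Y x)) \<longlonglongrightarrow> (\<Sum>i. c (i + n))"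
    by simp
  from LIMSEQ_le_const[OF this] bd show ?thesis
    by blast
qed

lemma (in prob_space) expectation_abs_le_l2norm:
  assumes "Y \<in> L2 M"
  shows "expectation (\<lambda>x. \<bar>Y x\<bar>) \<le> l2norm M Y"
proof -
  have "(\<lambda>x. \<bar>Y x\<bar>) \<in> L2 M"
    using assms by (auto simp: L2_def)
  from l2norm_Cauchy_Schwarz[OF this L2_const[of 1]] show ?thesis
    by (simp add: l2norm_def prob_space)
qed

lemma (in prob_space) abs_expectation_le_l2norm:
  assumes "Y \<in> L2 M"
  shows "\<bar>expectation Y\<bar> \<le> l2norm M Y"
  using expectation_abs_le_l2norm[OF assms] integral_abs_bound[of M Y] by linarith

lemma (in prob_space) L2_center:
  "Y \<in> L2 M \<Longrightarrow> (\<lambda>x. Y x - expectation Y) \<in> L2 M"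
  by (intro L2_diff L2_const)

lemma (in prob_space) l2norm_center:
  assumes "Y \<in> L2 M"
  shows "l2norm M (\<lambda>x. Y x - expectation Y) \<le> l2norm M Y"
proof -
  have "expectation (\<lambda>x. (Y x - expectation Y)\<^sup>2) = expectation (\<lambda>x. (Y x)\<^sup>2) - (expectation Y)\<^sup>2"
    using variance_eq[OF L2_integrable[OF assms] L2_square[OF assms]] .
  then show ?thesis
    by (simp add: l2norm_def)
qed

text \<open>Riesz-Fischer: on a probability space the L1 norm is at most the L2 norm, so the
  absolute increments have a finite expected sum and the sequence converges almost surely.\<close>

lemma (in prob_space) L2_complete:
  fixes Z :: "nat \<Rightarrow> 'a \<Rightarrow> real"
  assumes Z: "\<And>n. Z n \<in> L2 M"
    and c: "\<And>n. l2norm M (\<lambda>x. Z (Suc n) x - Z n x) \<le> c n" "summable c"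
  obtains Y where "Y \<in> L2 M" "\<And>n. l2norm M (\<lambda>x. Z n x - Y x) \<le> (\<Sum>i. c (i + n))"
proof -
  note [measurable] = L2_measurable[OF Z]
  define Y where "Y x = lim (\<lambda>n. Z n x)" for x
  have Y: "Y \<in> borel_measurable M"
    unfolding Y_def by measurable
  have int: "integrable M (\<lambda>x. \<bar>Z (Suc n) x - Z n x\<bar>)" for n
    using L2_integrable[OF L2_diff[OF Z Z]] by simp
  have bd: "(\<integral>\<^sup>+x. ennreal \<bar>Z (Suc n) x - Z n x\<bar> \<partial>M) \<le> ennreal (c n)" for n
    using expectation_abs_le_l2norm[OF L2_diff[OF Z Z], of "Suc n" n] c(1)[of n] int[of n]
    by (subst nn_integral_eq_integral) (auto intro!: ennreal_leI)
  have c0: "0 \<le> c n" for n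
    using c(1)[of n] l2norm_nonneg order_trans by blast
  have "(\<integral>\<^sup>+x. (\<Sum>n. ennreal \<bar>Z (Suc n) x - Z n x\<bar>) \<partial>M)
      = (\<Sum>n. \<integral>\<^sup>+x. ennreal \<bar>Z (Suc n) x - Z n x\<bar> \<partial>M)"
    by (rule nn_integral_suminf) simp
  also have "\<dots> \<le> (\<Sum>n. ennreal (c n))"
    by (intro suminf_le bd) auto
  also have "\<dots> < \<infinity>"
    using c(2) c0 by (simp add: suminf_ennreal2)
  finally have "AE x in M. (\<Sum>n. ennreal \<bar>Z (Suc n) x - Z n x\<bar>) \<noteq> \<infinity>"
    by (intro nn_integral_PInf_AE) auto
  then have "AE x in M. (\<lambda>n. Z n x) \<longlonglongrightarrow> Y x"
  proof eventually_elim
    case (elim x)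
    then have "summable (\<lambda>n. \<bar>Z (Suc n) x - Z n x\<bar>)"
      by (intro summable_suminf_not_top) auto
    then have "summable (\<lambda>n. Z (Suc n) x - Z n x)"
      by (rule summable_rabs_cancel)
    then obtain s where "(\<lambda>n. \<Sum>i<n. Z (Suc i) x - Z i x) \<longlonglongrightarrow> s"
      by (auto simp: summable_def sums_def)
    then have "(\<lambda>n. Z n x - Z 0 x) \<longlonglongrightarrow> s"
      using sum_lessThan_telescope[of "\<lambda>n. Z n x"] by simp
    from tendsto_add[OF this tendsto_const[of "Z 0 x"]] have "convergent (\<lambda>n. Z n x)"
      by (auto simp: convergent_def)
    then show ?case
      unfolding Y_def by (rule convergent_LIMSEQ_iff[THEN iffD1])
  qed
  from L2_limit_steps[OF Z c Y this] that show ?thesis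
    by blast
qed

lemma tendsto_expectation_mult_L2:
  fixes Z W :: "nat \<Rightarrow> 'a \<Rightarrow> real"
  assumes Z: "\<And>n. Z n \<in> L2 M" "Y \<in> L2 M" "(\<lambda>n. l2norm M (\<lambda>x. Z n x - Y x)) \<longlonglongrightarrow> 0"
    and W: "\<And>n. W n \<in> L2 M" "V \<in> L2 M" "(\<lambda>n. l2norm M (\<lambda>x. W n x - V x)) \<longlonglongrightarrow> 0"
  shows "(\<lambda>n. \<integral>x. Z n x * W n x \<partial>M) \<longlonglongrightarrow> (\<integral>x. Y x * V x \<partial>M)"
proof -
  define dz dw where "dz n = l2norm M (\<lambda>x. Z n x - Y x)" and "dw n = l2norm M (\<lambda>x. W n x - V x)" for n
  have "norm ((\<integral>x. Z n x * W n x \<partial>M) - (\<integral>x. Y x * V x \<partial>M))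
      \<le> dz n * (dw n + l2norm M V) + l2norm M Y * dw n" for n
  proof -
    have "(\<integral>x. Z n x * W n x \<partial>M) - (\<integral>x. Y x * V x \<partial>M)
        = (\<integral>x. (Z n x - Y x) * W n x \<partial>M) + (\<integral>x. Y x * (W n x - V x) \<partial>M)"
      using Z W by (simp add: left_diff_distrib right_diff_distrib L2_mult_integrable)
    moreover have "\<bar>\<integral>x. (Z n x - Y x) * W n x \<partial>M\<bar> \<le> dz n * l2norm M (W n)"
      unfolding dz_def using Z W by (intro l2norm_Cauchy_Schwarz L2_diff)
    moreover have "\<dots> \<le> dz n * (dw n + l2norm M V)"
      using l2norm_add[OF L2_diff[OF W(1)[of n] W(2)] W(2)]
      by (intro mult_left_mono) (auto simp: dz_def dw_def)
    moreover have "\<bar>\<integral>x. Y x * (W n x - V x) \<partial>M\<bar> \<le> l2norm M Y * dw n"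
      unfolding dw_def using Z W by (intro l2norm_Cauchy_Schwarz L2_diff)
    ultimately show ?thesis
      by simp
  qed
  then have bd: "\<forall>\<^sub>F n in sequentially. norm ((\<integral>x. Z n x * W n x \<partial>M) - (\<integral>x. Y x * V x \<partial>M))
      \<le> dz n * (dw n + l2norm M V) + l2norm M Y * dw n"
    by (rule always_eventually[OF allI])
  have "(\<lambda>n. dz n * (dw n + l2norm M V) + l2norm M Y * dw n)
      \<longlonglongrightarrow> 0 * (0 + l2norm M V) + l2norm M Y * 0"
    using Z(3) W(3) unfolding dz_def dw_def by (intro tendsto_intros)
  then have "(\<lambda>n. dz n * (dw n + l2norm M V) + l2norm M Y * dw n) \<longlonglongrightarrow> 0"
    by simp
  from LIM_zero_cancel[OF Lim_null_comparison[OF bd this]] show ?thesis .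
qed

text \<open>Expanding the square gives a matrix of cross moments with at most \<open>d\<close>
  nonzero entries per row, the diagonal included, each at most c^2 by Cauchy-Schwarz. The index type
  is free because the bound serves single indices as well as pairs.\<close>

lemma l2norm_sum_sparse:
  fixes Z :: "'i \<Rightarrow> 'a \<Rightarrow> real"
  assumes A: "finite A" and Z: "\<And>a. a \<in> A \<Longrightarrow> Z a \<in> L2 M"
    and c: "\<And>a. a \<in> A \<Longrightarrow> l2norm M (Z a) \<le> c"
    and d: "\<And>a. a \<in> A \<Longrightarrow> card {b \<in> A. (\<integral>x. Z a x * Z b x \<partial>M) \<noteq> 0} \<le> d"
  shows "(l2norm M (\<lambda>x. \<Sum>a\<in>A. Z a x))\<^sup>2 \<le> c\<^sup>2 * real d * real (card A)"
proof -
  have "(l2norm M (\<lambda>x. \<Sum>a\<in>A. Z a x))\<^sup>2 = (\<integral>x. (\<Sum>a\<in>A. \<Sum>b\<in>A. Z a x * Z b x) \<partial>M)"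
    unfolding l2norm_squared unfolding power2_eq_square sum_product ..
  also have "\<dots> = (\<Sum>a\<in>A. \<Sum>b\<in>A. \<integral>x. Z a x * Z b x \<partial>M)"
  proof -
    have "(\<integral>x. (\<Sum>a\<in>A. \<Sum>b\<in>A. Z a x * Z b x) \<partial>M) = (\<Sum>a\<in>A. \<integral>x. (\<Sum>b\<in>A. Z a x * Z b x) \<partial>M)"
      by (intro Bochner_Integration.integral_sum Bochner_Integration.integrable_sum
          L2_mult_integrable Z)
    also have "\<dots> = (\<Sum>a\<in>A. \<Sum>b\<in>A. \<integral>x. Z a x * Z b x \<partial>M)"
      by (intro sum.cong refl Bochner_Integration.integral_sum L2_mult_integrable Z)
    finally show ?thesis .
  qed
  also have "\<dots> \<le> (\<Sum>a\<in>A. c\<^sup>2 * real d)"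
  proof (rule sum_mono)
    fix a assume a: "a \<in> A"
    define B where "B = {b \<in> A. (\<integral>x. Z a x * Z b x \<partial>M) \<noteq> 0}"
    have "(\<Sum>b\<in>A. \<integral>x. Z a x * Z b x \<partial>M) = (\<Sum>b\<in>B. \<integral>x. Z a x * Z b x \<partial>M)"
      using A by (intro sum.mono_neutral_right) (auto simp: B_def)
    also have "\<dots> \<le> (\<Sum>b\<in>B. c\<^sup>2)"
    proof (rule sum_mono)
      fix b assume "b \<in> B"
      then have b: "b \<in> A"
        by (simp add: B_def)
      have "(\<integral>x. Z a x * Z b x \<partial>M) \<le> l2norm M (Z a) * l2norm M (Z b)"
        using l2norm_Cauchy_Schwarz[OF Z[OF a] Z[OF b]] by simp
      also have "\<dots> \<le> c * c"
        using c[OF a] c[OF b] order_trans[OF l2norm_nonneg c[OF a]] by (intro mult_mono) auto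
      finally show "(\<integral>x. Z a x * Z b x \<partial>M) \<le> c\<^sup>2"
        by (simp add: power2_eq_square)
    qed
    also have "\<dots> = real (card B) * c\<^sup>2"
      by simp
    also have "\<dots> \<le> real d * c\<^sup>2"
      using d[OF a] by (intro mult_right_mono) (auto simp: B_def)
    finally show "(\<Sum>b\<in>A. \<integral>x. Z a x * Z b x \<partial>M) \<le> c\<^sup>2 * real d"
      by (simp add: mult.commute)
  qed
  finally show ?thesis
    by (simp add: mult_ac)
qed

section \<open>Convergence of characteristic functions to a normal one\<close>

text \<open>Convergence in law to N(0, s) through characteristic functions: L2 estimates transfer
  directly and s = 0 is no special case. Weak convergence is recovered by Levy's continuity theorem
  in \<open>clt_weak_conv\<close>.\<close>

definition clt :: "'a measure \<Rightarrow> (nat \<Rightarrow> 'a \<Rightarrow> real) \<Rightarrow> real \<Rightarrow> bool" where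
  "clt M A s \<longleftrightarrow>
     (\<forall>t. (\<lambda>n. char (distr M borel (A n)) t) \<longlonglongrightarrow> complex_of_real (exp (- s * t\<^sup>2 / 2)))"

lemma norm_iexp_diff_le: "norm (iexp a - iexp b) \<le> \<bar>a - b\<bar>"
proof -
  have "iexp a - iexp b = iexp b * (iexp (a - b) - 1)"
    by (simp add: right_diff_distrib flip: exp_add)
  then have "norm (iexp a - iexp b) = norm (iexp (a - b) - 1)"
    by (simp add: norm_mult)
  also have "\<dots> \<le> \<bar>a - b\<bar>"
    using iexp_approx1[of "a - b" 0] by simp
  finally show ?thesis .
qed

context prob_space
begin

text \<open>The map a -> exp(i a) is 1-Lipschitz, and the L1 norm is at most the L2 norm.\<close>

lemma char_diff_le_l2norm:
  assumes A: "A \<in> L2 M" and B: "B \<in> L2 M"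
  shows "norm (char (distr M borel A) t - char (distr M borel B) t)
    \<le> \<bar>t\<bar> * l2norm M (\<lambda>x. A x - B x)"
proof -
  note [measurable] = L2_measurable[OF A] L2_measurable[OF B]
  have int: "integrable M (\<lambda>x. iexp (t * A x))" "integrable M (\<lambda>x. iexp (t * B x))"
    by (intro integrable_const_bound[where B=1]; simp)+
  have D: "integrable M (\<lambda>x. \<bar>A x - B x\<bar>)"
    using L2_integrable[OF L2_diff[OF A B]] by simp
  have "char (distr M borel A) t - char (distr M borel B) t
      = (CLINT x|M. iexp (t * A x)) - (CLINT x|M. iexp (t * B x))"
    unfolding char_def by (simp add: integral_distr)
  also have "\<dots> = (CLINT x|M. iexp (t * A x) - iexp (t * B x))"
    by (rule Bochner_Integration.integral_diff[symmetric]) (rule int)+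
  finally have "norm (char (distr M borel A) t - char (distr M borel B) t)
      \<le> (LINT x|M. norm (iexp (t * A x) - iexp (t * B x)))"
    using integral_norm_bound by metis
  also have "\<dots> \<le> (LINT x|M. \<bar>t\<bar> * \<bar>A x - B x\<bar>)"
  proof (rule integral_mono)
    show "integrable M (\<lambda>x. norm (iexp (t * A x) - iexp (t * B x)))"
      by (intro integrable_norm Bochner_Integration.integrable_diff int)
    show "integrable M (\<lambda>x. \<bar>t\<bar> * \<bar>A x - B x\<bar>)"
      using D by simp
    show "norm (iexp (t * A x) - iexp (t * B x)) \<le> \<bar>t\<bar> * \<bar>A x - B x\<bar>" for x
      using norm_iexp_diff_le[of "t * A x" "t * B x"]
      by (simp add: abs_mult flip: right_diff_distrib)
  qed
  also have "\<dots> \<le> \<bar>t\<bar> * l2norm M (\<lambda>x. A x - B x)"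
    using expectation_abs_le_l2norm[OF L2_diff[OF A B]] by (simp add: mult_left_mono)
  finally show ?thesis .
qed

text \<open>A three-epsilon argument: k is fixed before n, so closeness is demanded only for large n
  at each k, with a bound \<open>\<delta> k\<close> free of n. Its two main uses take k as block
  length and as window radius.\<close>

lemma clt_approx:
  fixes A :: "nat \<Rightarrow> 'a \<Rightarrow> real" and B :: "nat \<Rightarrow> nat \<Rightarrow> 'a \<Rightarrow> real"
  assumes A: "\<And>n. A n \<in> L2 M" and B: "\<And>k n. B k n \<in> L2 M"
    and close: "\<And>k. \<forall>\<^sub>F n in sequentially. l2norm M (\<lambda>x. A n x - B k n x) \<le> \<delta> k"
    and \<delta>: "\<delta> \<longlonglongrightarrow> 0" and clt: "\<And>k. clt M (B k) (s k)" and s: "s \<longlonglongrightarrow> \<sigma>"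
  shows "clt M A \<sigma>"
  unfolding clt_def
proof
  fix t
  let ?\<phi> = "\<lambda>A. char (distr M borel A) t"
  let ?g = "\<lambda>s. complex_of_real (exp (- s * t\<^sup>2 / 2))"
  show "(\<lambda>n. ?\<phi> (A n)) \<longlonglongrightarrow> ?g \<sigma>"
  proof (rule tendstoI)
    fix e :: real assume e: "0 < e"
    have "(\<lambda>k. \<bar>t\<bar> * \<delta> k) \<longlonglongrightarrow> \<bar>t\<bar> * 0"
      by (intro tendsto_intros \<delta>)
    then have "\<forall>\<^sub>F k in sequentially. \<bar>t\<bar> * \<delta> k < e / 3"
      using e by (intro order_tendstoD) auto
    moreover have "(\<lambda>k. ?g (s k)) \<longlonglongrightarrow> ?g \<sigma>"
      by (intro tendsto_intros s) simp
    then have "\<forall>\<^sub>F k in sequentially. dist (?g (s k)) (?g \<sigma>) < e / 3"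
      using e by (intro tendstoD) auto
    ultimately have "\<forall>\<^sub>F k in sequentially. \<bar>t\<bar> * \<delta> k < e / 3 \<and> dist (?g (s k)) (?g \<sigma>) < e / 3"
      by (rule eventually_conj)
    then obtain k where k: "\<bar>t\<bar> * \<delta> k < e / 3" "dist (?g (s k)) (?g \<sigma>) < e / 3"
      using eventually_happens'[OF sequentially_bot] by blast
    have "\<forall>\<^sub>F n in sequentially. dist (?\<phi> (B k n)) (?g (s k)) < e / 3"
      using clt[of k] e unfolding clt_def by (intro tendstoD) auto
    then show "\<forall>\<^sub>F n in sequentially. dist (?\<phi> (A n)) (?g \<sigma>) < e"
      using close[of k]
    proof eventually_elim
      case (elim n)
      have "dist (?\<phi> (A n)) (?\<phi> (B k n)) \<le> \<bar>t\<bar> * l2norm M (\<lambda>x. A n x - B k n x)"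
        unfolding dist_norm by (rule char_diff_le_l2norm[OF A B])
      also have "\<dots> \<le> \<bar>t\<bar> * \<delta> k"
        using elim by (intro mult_left_mono) auto
      finally have "dist (?\<phi> (A n)) (?\<phi> (B k n)) < e / 3"
        using k(1) by linarith
      then show ?case
        using elim(1) k(2) dist_triangle[of "?\<phi> (A n)" "?g \<sigma>" "?\<phi> (B k n)"]
          dist_triangle[of "?\<phi> (B k n)" "?g \<sigma>" "?g (s k)"] by linarith
    qed
  qed
qed

lemma clt_close:
  assumes A: "\<And>n. A n \<in> L2 M" and B: "\<And>n. B n \<in> L2 M"
    and close: "(\<lambda>n. l2norm M (\<lambda>x. A n x - B n x)) \<longlonglongrightarrow> 0" and clt: "clt M B s"
  shows "clt M A s"
proof (rule clt_approx[where B="\<lambda>k. B" and \<delta>="\<lambda>k. inverse (real (Suc k))" and s="\<lambda>k. s"])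
  show "\<forall>\<^sub>F n in sequentially. l2norm M (\<lambda>x. A n x - B n x) \<le> inverse (real (Suc k))" for k
    using order_tendstoD(2)[OF close, of "inverse (real (Suc k))"]
    by (auto elim: eventually_mono)
qed (use A B clt LIMSEQ_inverse_real_of_nat in auto)

lemma clt_zero: "clt M (\<lambda>n x. 0) 0"
proof -
  have "char (distr M borel (\<lambda>x. 0)) t = 1" for t
    unfolding char_def by (subst integral_distr) (auto simp: prob_space)
  then show ?thesis
    unfolding clt_def by simp
qed

text \<open>The classical theorem divides by \<sigma>, so \<sigma> = 0 is split off: there all
  summands have norm 0 and the normalised sums are compared with the constant 0.\<close>

lemma clt_iid:
  fixes W :: "nat \<Rightarrow> 'a \<Rightarrow> real"
  assumes indep: "indep_vars (\<lambda>_. borel) W UNIV" and L2: "\<And>i. W i \<in> L2 M"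
    and mean: "\<And>i. expectation (W i) = 0"
    and distr: "\<And>i. distr M borel (W i) = distr M borel (W 0)"
  shows "clt M (\<lambda>n x. (\<Sum>i<n. W i x) / sqrt (real n)) ((l2norm M (W 0))\<^sup>2)"
proof -
  note [measurable] = L2_measurable[OF L2]
  define \<sigma> where "\<sigma> = l2norm M (W 0)"
  have norm_W: "l2norm M (W i) = \<sigma>" for i
  proof -
    have "(\<integral>x. (W i x)\<^sup>2 \<partial>M) = (\<integral>x. x\<^sup>2 \<partial>distr M borel (W i))"
      by (simp add: integral_distr)
    also have "\<dots> = (\<integral>x. (W 0 x)\<^sup>2 \<partial>M)"
      unfolding distr[of i] by (simp add: integral_distr)
    finally show ?thesis
      by (simp add: \<sigma>_def l2norm_def)
  qed
  have S: "(\<lambda>x. (\<Sum>i<n. W i x) / sqrt (real n)) \<in> L2 M" for n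
    using L2_cmult[OF L2_sum[of "{..<n}" W M], of "1 / sqrt (real n)"] L2 by simp
  show ?thesis
  proof (cases "\<sigma> = 0")
    case True
    have "l2norm M (\<lambda>x. \<Sum>i<n. W i x) \<le> 0" for n
      using l2norm_sum[of "{..<n}" W M] L2 True by (simp add: norm_W)
    then have "l2norm M (\<lambda>x. (\<Sum>i<n. W i x) / sqrt (real n)) = 0" for n
      using l2norm_cmult[of M "1 / sqrt (real n)" "\<lambda>x. \<Sum>i<n. W i x"] by (simp add: order_antisym)
    then have "clt M (\<lambda>n x. (\<Sum>i<n. W i x) / sqrt (real n)) 0"
      by (intro clt_close[OF S L2_zero _ clt_zero]) simp
    then show ?thesis
      using True by (simp add: \<sigma>_def)
  next
    case False
    then have \<sigma>: "\<sigma> > 0"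
      using l2norm_nonneg[of M "W 0"] by (simp add: \<sigma>_def order_less_le)
    have "weak_conv_m (\<lambda>n. distr M borel (\<lambda>x. (\<Sum>i<n. W i x) / sqrt (real n * \<sigma>\<^sup>2)))
        std_normal_distribution"
    proof (rule central_limit_theorem_zero_mean[OF indep mean \<sigma> _ _ distr])
      show "integrable M (\<lambda>x. (W n x)\<^sup>2)" for n
        by (rule L2_square[OF L2])
      show "variance (W n) = \<sigma>\<^sup>2" for n
        unfolding mean using l2norm_squared[of M "W n"] by (simp add: norm_W)
    qed
    then have *: "(\<lambda>n. char (distr M borel (\<lambda>x. (\<Sum>i<n. W i x) / sqrt (real n * \<sigma>\<^sup>2))) u)
        \<longlonglongrightarrow> char std_normal_distribution u" for u
      by (intro levy_continuity1 real_dist_normal_dist real_distribution_distr) auto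
    show ?thesis
      unfolding clt_def
    proof
      fix t
      \<comment> \<open>Normalising by sqrt(n) instead of sqrt(n \<sigma>^2) amounts to evaluating
        at \<sigma> t.\<close>
      have "char (distr M borel (\<lambda>x. (\<Sum>i<n. W i x) / sqrt (real n * \<sigma>\<^sup>2))) (\<sigma> * t)
          = char (distr M borel (\<lambda>x. (\<Sum>i<n. W i x) / sqrt (real n))) t" for n
        unfolding char_def using \<sigma> by (simp add: integral_distr real_sqrt_mult)
      moreover have "char std_normal_distribution (\<sigma> * t) = complex_of_real (exp (- \<sigma>\<^sup>2 * t\<^sup>2 / 2))"
        by (simp add: char_std_normal_distribution power_mult_distrib)
      ultimately show "(\<lambda>n. char (distr M borel (\<lambda>x. (\<Sum>i<n. W i x) / sqrt (real n))) t)
          \<longlonglongrightarrow> complex_of_real (exp (- (l2norm M (W 0))\<^sup>2 * t\<^sup>2 / 2))"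
        using *[of "\<sigma> * t"] by (simp add: \<sigma>_def)
    qed
  qed
qed

end

lemma clt_subseq:
  assumes "clt M A s" "filterlim q at_top sequentially"
  shows "clt M (\<lambda>n. A (q n)) s"
  using assms unfolding clt_def by (auto intro: filterlim_compose)

text \<open>Multiplication by c0 is a change of t in the characteristic function; replacing
  \<open>c n\<close> by c0 costs at most |c n - c0| C, which is why the norms are bounded
  uniformly.\<close>

lemma (in prob_space) clt_scale:
  assumes A: "\<And>n. A n \<in> L2 M" "\<And>n. l2norm M (A n) \<le> C" and c: "c \<longlonglongrightarrow> c0" and clt: "clt M A s"
  shows "clt M (\<lambda>n x. c n * A n x) (c0\<^sup>2 * s)"
proof (rule clt_close)
  show "(\<lambda>x. c n * A n x) \<in> L2 M" "(\<lambda>x. c0 * A n x) \<in> L2 M" for n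
    by (intro L2_cmult A)+
  have [measurable]: "A n \<in> borel_measurable M" for n
    using A(1) by (rule L2_measurable)
  have "char (distr M borel (\<lambda>x. c0 * A n x)) t = char (distr M borel (A n)) (c0 * t)" for n t
    unfolding char_def by (simp add: integral_distr mult_ac)
  moreover have "exp (- (c0\<^sup>2 * s) * t\<^sup>2 / 2) = exp (- s * (c0 * t)\<^sup>2 / 2)" for t
    by (simp add: power_mult_distrib mult_ac)
  ultimately show "clt M (\<lambda>n x. c0 * A n x) (c0\<^sup>2 * s)"
    using clt unfolding clt_def by (simp only: simp_thms)
  have "l2norm M (\<lambda>x. c n * A n x - c0 * A n x) \<le> \<bar>c n - c0\<bar> * C" for n
    using A(2)[of n] l2norm_cmult[of M "c n - c0" "A n"] by (simp add: left_diff_distrib mult_left_mono)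
  then have "\<forall>\<^sub>F n in sequentially.
      norm (l2norm M (\<lambda>x. c n * A n x - c0 * A n x)) \<le> \<bar>c n - c0\<bar> * C"
    by simp
  moreover have "(\<lambda>n. \<bar>c n - c0\<bar> * C) \<longlonglongrightarrow> 0"
    using tendsto_mult_right[OF tendsto_rabs_zero[OF LIM_zero[OF c]], of C] by simp
  ultimately show "(\<lambda>n. l2norm M (\<lambda>x. c n * A n x - c0 * A n x)) \<longlonglongrightarrow> 0"
    by (rule Lim_null_comparison)
qed

lemma centered_normal_eq_distr:
  assumes "0 < v"
  shows "centered_normal v = distr std_normal_distribution borel (\<lambda>x. sqrt v * x)"
proof -
  interpret prob_space std_normal_distribution
    by (rule prob_space_normal_density) simp
  have "distributed std_normal_distribution lborel (\<lambda>x. x) std_normal_density"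
    by (auto simp: distributed_def distr_id2)
  from normal_density_affine[OF this, of "sqrt v" 0]
  have "distributed std_normal_distribution lborel (\<lambda>x. sqrt v * x) (normal_density 0 (sqrt v))"
    using assms by simp
  from distributed_distr_eq_density[OF this] show ?thesis
    using assms unfolding centered_normal_def by (simp cong: distr_cong)
qed

lemma real_distribution_centered_normal: "0 \<le> v \<Longrightarrow> real_distribution (centered_normal v)"
  and char_centered_normal:
    "0 \<le> v \<Longrightarrow> char (centered_normal v) t = complex_of_real (exp (- v * t\<^sup>2 / 2))"
proof -
  assume v: "0 \<le> v"
  interpret N: prob_space std_normal_distribution
    by (rule prob_space_normal_density) simp
  have *: "real_distribution (centered_normal v)
      \<and> char (centered_normal v) t = complex_of_real (exp (- v * t\<^sup>2 / 2))"
  proof (cases "v = 0")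
    case True
    have "prob_space (return borel (0::real))"
      by (rule prob_space_return) simp
    then show ?thesis
      using True by (simp add: centered_normal_def char_def integral_return real_distribution_def
          real_distribution_axioms_def)
  next
    case False
    then have "0 < v"
      using v by simp
    have "char (centered_normal v) t = char std_normal_distribution (sqrt v * t)"
      unfolding centered_normal_eq_distr[OF \<open>0 < v\<close>] char_def
      by (simp add: integral_distr mult_ac)
    then show ?thesis
      using v unfolding char_std_normal_distribution
      by (auto simp: centered_normal_eq_distr[OF \<open>0 < v\<close>] power_mult_distrib
          intro!: N.real_distribution_distr)
  qed
  then show "real_distribution (centered_normal v)"
    "char (centered_normal v) t = complex_of_real (exp (- v * t\<^sup>2 / 2))"
    by auto
qed

lemma (in prob_space) clt_weak_conv:
  assumes "clt M A s" "0 \<le> s" "\<And>n. A n \<in> borel_measurable M"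
  shows "weak_conv_m (\<lambda>n. distr M borel (A n)) (centered_normal s)"
proof (rule levy_continuity)
  show "(\<lambda>n. char (distr M borel (A n)) t) \<longlonglongrightarrow> char (centered_normal s) t" for t
    using assms(1,2) by (simp add: clt_def char_centered_normal)
qed (use assms in \<open>auto intro!: real_distribution_distr real_distribution_centered_normal\<close>)

section \<open>Independence and stationarity of i.i.d. sequences\<close>

context prob_space
begin

text \<open>Unlike \<^const>\<open>indep_var\<close>, this allows variables with values in different types.\<close>
definition indep_pair :: "'b measure \<Rightarrow> ('a \<Rightarrow> 'b) \<Rightarrow> 'c measure \<Rightarrow> ('a \<Rightarrow> 'c) \<Rightarrow> bool" where
  "indep_pair N1 Y N2 Z \<longleftrightarrow> Y \<in> measurable M N1 \<and> Z \<in> measurable M N2 \<and>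
     distr M N1 Y \<Otimes>\<^sub>M distr M N2 Z = distr M (N1 \<Otimes>\<^sub>M N2) (\<lambda>x. (Y x, Z x))"

lemma indep_var_imp_indep_pair: "indep_var N1 Y N2 Z \<Longrightarrow> indep_pair N1 Y N2 Z"
  unfolding indep_var_distribution_eq indep_pair_def .

lemma indep_pair_compose:
  assumes ind: "indep_pair N1 Y N2 Z" and u: "u \<in> measurable N1 K1" and v: "v \<in> measurable N2 K2"
  shows "indep_pair K1 (\<lambda>x. u (Y x)) K2 (\<lambda>x. v (Z x))"
proof -
  have Y: "Y \<in> measurable M N1" and Z: "Z \<in> measurable M N2"
    and eq: "distr M N1 Y \<Otimes>\<^sub>M distr M N2 Z = distr M (N1 \<Otimes>\<^sub>M N2) (\<lambda>x. (Y x, Z x))"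
    using ind unfolding indep_pair_def by auto
  note [measurable] = Y Z u v
  have comp: "distr M K1 (\<lambda>x. u (Y x)) = distr (distr M N1 Y) K1 u"
      "distr M K2 (\<lambda>x. v (Z x)) = distr (distr M N2 Z) K2 v"
    by (simp_all add: distr_distr comp_def)
  have "sigma_finite_measure (distr (distr M N2 Z) K2 v)"
    unfolding comp[symmetric] by (intro finite_measure.axioms(1) finite_measure_distr) simp
  then have "distr M K1 (\<lambda>x. u (Y x)) \<Otimes>\<^sub>M distr M K2 (\<lambda>x. v (Z x))
      = distr (distr M N1 Y \<Otimes>\<^sub>M distr M N2 Z) (K1 \<Otimes>\<^sub>M K2) (\<lambda>(x, y). (u x, v y))"
    unfolding comp by (intro pair_measure_distr) auto
  also have "\<dots> = distr M (K1 \<Otimes>\<^sub>M K2) (\<lambda>x. (u (Y x), v (Z x)))"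
    unfolding eq by (subst distr_distr) (auto simp: comp_def)
  finally show ?thesis
    unfolding indep_pair_def by simp
qed

text \<open>Fubini on the product law, pulled back to \<open>M\<close>: the inner integral runs over
  a second, independent point of the same space, so averages over an independent argument need no
  auxiliary space.\<close>

lemma indep_pair_Fubini:
  fixes \<phi> :: "'b \<Rightarrow> 'c \<Rightarrow> real"
  assumes ind: "indep_pair N1 Y N2 Z" and \<phi>: "case_prod \<phi> \<in> borel_measurable (N1 \<Otimes>\<^sub>M N2)"
    and int: "integrable M (\<lambda>x. \<phi> (Y x) (Z x))"
  shows "AE x in M. integrable M (\<lambda>y. \<phi> (Y x) (Z y))"
    and "integrable M (\<lambda>x. \<integral>y. \<phi> (Y x) (Z y) \<partial>M)"
    and "(\<integral>x. \<phi> (Y x) (Z x) \<partial>M) = (\<integral>x. (\<integral>y. \<phi> (Y x) (Z y) \<partial>M) \<partial>M)"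
proof -
  have Y: "Y \<in> measurable M N1" and Z: "Z \<in> measurable M N2"
    and ind_eq: "distr M N1 Y \<Otimes>\<^sub>M distr M N2 Z = distr M (N1 \<Otimes>\<^sub>M N2) (\<lambda>x. (Y x, Z x))"
    using ind unfolding indep_pair_def by auto
  note [measurable] = Y Z \<phi>
  interpret Y: prob_space "distr M N1 Y"
    by (rule prob_space_distr) simp
  interpret Z: prob_space "distr M N2 Z"
    by (rule prob_space_distr) simp
  interpret P: pair_prob_space "distr M N1 Y" "distr M N2 Z" ..
  have pi: "integrable (distr M N1 Y \<Otimes>\<^sub>M distr M N2 Z) (case_prod \<phi>)"
    unfolding ind_eq using int by (subst integrable_distr_eq) auto
  have inner: "(\<integral>z. \<phi> y z \<partial>distr M N2 Z) = (\<integral>w. \<phi> y (Z w) \<partial>M)" if "y \<in> space N1" for y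
    using that by (subst integral_distr) auto
  have "AE y in distr M N1 Y. integrable (distr M N2 Z) (\<phi> y)"
    using P.AE_integrable_fst'[OF pi] by simp
  then have "AE x in M. integrable (distr M N2 Z) (\<phi> (Y x))"
    by (rule AE_distrD[rotated]) simp
  then show "AE x in M. integrable M (\<lambda>y. \<phi> (Y x) (Z y))"
    using AE_space
  proof eventually_elim
    case (elim x)
    then have "Y x \<in> space N1"
      using measurable_space[OF Y] by auto
    with elim show ?case
      by (subst (asm) integrable_distr_eq) auto
  qed
  have "integrable (distr M N1 Y) (\<lambda>y. \<integral>z. \<phi> y z \<partial>distr M N2 Z)"
    using P.integrable_fst'[OF pi] by simp
  then have "integrable M (\<lambda>x. \<integral>z. \<phi> (Y x) z \<partial>distr M N2 Z)"
    by (rule integrable_distr[rotated]) simp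
  then show "integrable M (\<lambda>x. \<integral>y. \<phi> (Y x) (Z y) \<partial>M)"
    by (rule Bochner_Integration.integrable_cong[THEN iffD1, rotated -1])
      (auto intro!: inner measurable_space[OF Y])
  have "(\<integral>x. \<phi> (Y x) (Z x) \<partial>M) = (\<integral>p. case_prod \<phi> p \<partial>(distr M N1 Y \<Otimes>\<^sub>M distr M N2 Z))"
    unfolding ind_eq by (simp add: integral_distr)
  also have "\<dots> = (\<integral>y. (\<integral>z. \<phi> y z \<partial>distr M N2 Z) \<partial>distr M N1 Y)"
    using P.integral_fst'[OF pi] by simp
  also have "\<dots> = (\<integral>x. (\<integral>z. \<phi> (Y x) z \<partial>distr M N2 Z) \<partial>M)"
    by (rule integral_distr) auto
  also have "\<dots> = (\<integral>x. (\<integral>y. \<phi> (Y x) (Z y) \<partial>M) \<partial>M)"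
    by (intro Bochner_Integration.integral_cong refl inner measurable_space[OF Y])
  finally show "(\<integral>x. \<phi> (Y x) (Z x) \<partial>M) = (\<integral>x. (\<integral>y. \<phi> (Y x) (Z y) \<partial>M) \<partial>M)" .
qed

text \<open>Jensen on the inner integral for almost every value of Y, then Fubini. This is the L2
  contraction property of conditional expectation given Y.\<close>

lemma L2_partial_expectation:
  fixes \<phi> :: "'b \<Rightarrow> 'c \<Rightarrow> real"
  assumes ind: "indep_pair N1 Y N2 Z" and \<phi>: "case_prod \<phi> \<in> borel_measurable (N1 \<Otimes>\<^sub>M N2)"
    and L2: "(\<lambda>x. \<phi> (Y x) (Z x)) \<in> L2 M"
  shows "(\<lambda>x. \<integral>y. \<phi> (Y x) (Z y) \<partial>M) \<in> L2 M"
    and "l2norm M (\<lambda>x. \<integral>y. \<phi> (Y x) (Z y) \<partial>M) \<le> l2norm M (\<lambda>x. \<phi> (Y x) (Z x))"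
proof -
  have Y: "Y \<in> measurable M N1" and Z: "Z \<in> measurable M N2"
    using ind unfolding indep_pair_def by auto
  note [measurable] = Y Z \<phi>
  define H where "H x = (\<integral>y. \<phi> (Y x) (Z y) \<partial>M)" for x
  have H: "H \<in> borel_measurable M"
    unfolding H_def by (rule borel_measurable_lebesgue_integral) measurable
  have sq: "case_prod (\<lambda>y z. (\<phi> y z)\<^sup>2) \<in> borel_measurable (N1 \<Otimes>\<^sub>M N2)"
    by measurable
  note Fub = indep_pair_Fubini[OF ind sq L2_square[OF L2]]
  have le: "AE x in M. (H x)\<^sup>2 \<le> (\<integral>y. (\<phi> (Y x) (Z y))\<^sup>2 \<partial>M)"
    using Fub(1) AE_space
  proof eventually_elim
    case (elim x)
    then have "Y x \<in> space N1"
      using measurable_space[OF Y] by auto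
    then have "(\<lambda>y. \<phi> (Y x) (Z y)) \<in> L2 M"
      using elim by (intro L2I) measurable
    from power_mono[OF abs_expectation_le_l2norm[OF this], of 2] show ?case
      by (simp add: H_def l2norm_squared)
  qed
  have int: "integrable M (\<lambda>x. (H x)\<^sup>2)"
    by (rule Bochner_Integration.integrable_bound[OF Fub(2)]) (use H le in auto)
  then show "(\<lambda>x. \<integral>y. \<phi> (Y x) (Z y) \<partial>M) \<in> L2 M"
    using H by (auto simp: L2_def H_def[abs_def])
  have "(\<integral>x. (H x)\<^sup>2 \<partial>M) \<le> (\<integral>x. (\<phi> (Y x) (Z x))\<^sup>2 \<partial>M)"
    unfolding Fub(3) by (rule integral_mono_AE[OF int Fub(2) le])
  then show "l2norm M (\<lambda>x. \<integral>y. \<phi> (Y x) (Z y) \<partial>M) \<le> l2norm M (\<lambda>x. \<phi> (Y x) (Z x))"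
    by (simp add: l2norm_def H_def)
qed

end

section \<open>Stationarity via shifted paths, independence via disjoint coordinates\<close>

abbreviation seq_space :: "(int \<Rightarrow> real) measure" where
  "seq_space \<equiv> Pi\<^sub>M UNIV (\<lambda>_. borel)"

locale iid_process = prob_space M for M :: "'a measure" +
  fixes e :: "int \<Rightarrow> 'a \<Rightarrow> real"
  assumes iid: "iid_sequence M e"
begin

lemma e_measurable [measurable]: "e u \<in> borel_measurable M"
  using iid by (auto simp: iid_sequence_def indep_vars_def)

lemma e_indep: "indep_vars (\<lambda>_. borel) e UNIV"
  using iid by (simp add: iid_sequence_def)

lemma e_distr: "distr M borel (e u) = distr M borel (e 0)"
  using iid by (simp add: iid_sequence_def)

text \<open>The noise path seen from time i. Stationarity statements are reduced to equality in law
  of these paths by writing a variable as \<Phi> (shift i \<omega>) with \<Phi> measurable and free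
  of i.\<close>

definition shift :: "int \<Rightarrow> 'a \<Rightarrow> int \<Rightarrow> real" where
  "shift i \<omega> = (\<lambda>u. e (i + u) \<omega>)"

lemma shift_measurable [measurable]: "shift i \<in> measurable M seq_space"
  unfolding shift_def by (rule measurable_PiM_single') auto

text \<open>The law of the path is the infinite product of one marginal, which is invariant under
  the reindexing u -> i + u.\<close>

lemma distr_shift: "distr M seq_space (shift i) = distr M seq_space (shift 0)"
proof -
  define P where "P = distr M borel (e 0)"
  have distr_eq: "(\<lambda>u. distr M borel (e u)) = (\<lambda>_. P)"
    unfolding P_def by (rule ext) (rule e_distr)
  have "distr M seq_space (\<lambda>x. \<lambda>u\<in>UNIV. e u x) = Pi\<^sub>M UNIV (\<lambda>u. distr M borel (e u))"
    using e_indep by (subst (asm) indep_vars_iff_distr_eq_PiM) auto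
  then have shift0: "distr M seq_space (shift 0) = Pi\<^sub>M UNIV (\<lambda>_. P)"
    unfolding distr_eq by (simp add: shift_def[abs_def] restrict_UNIV)
  have [measurable_cong]: "sets P = sets borel"
    by (simp add: P_def)
  have sets: "sets (Pi\<^sub>M UNIV (\<lambda>_::int. P)) = sets seq_space"
    by (intro sets_PiM_cong refl) (simp add: P_def)
  have "prob_space P"
    unfolding P_def by (rule prob_space_distr) simp
  then have "distr (Pi\<^sub>M UNIV (\<lambda>_. P)) (Pi\<^sub>M UNIV (\<lambda>_. P)) (\<lambda>x. \<lambda>u\<in>UNIV. x (i + u))
      = Pi\<^sub>M UNIV (\<lambda>_. P)"
    using distr_PiM_reindex[of UNIV "\<lambda>_. P" "\<lambda>u. i + u" UNIV] by (simp add: inj_on_def)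
  then have "Pi\<^sub>M UNIV (\<lambda>_. P) = distr (distr M seq_space (shift 0)) seq_space (\<lambda>x u. x (i + u))"
    unfolding shift0 by (simp add: distr_cong[OF refl sets] restrict_UNIV)
  also have "\<dots> = distr M seq_space (shift i)"
    by (subst distr_distr) (auto simp: comp_def shift_def[abs_def] intro!: measurable_PiM_single')
  finally show ?thesis
    by (simp add: shift0)
qed

lemma distr_stationary:
  assumes [measurable]: "\<Phi> \<in> measurable seq_space N"
  shows "distr M N (\<lambda>\<omega>. \<Phi> (shift i \<omega>)) = distr M N (\<lambda>\<omega>. \<Phi> (shift 0 \<omega>))"
proof -
  have "distr M N (\<lambda>\<omega>. \<Phi> (shift i \<omega>)) = distr (distr M seq_space (shift i)) N \<Phi>" for i
    by (subst distr_distr) (auto simp: comp_def)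
  then show ?thesis
    by (simp add: distr_shift[of i])
qed

lemma expectation_stationary:
  assumes [measurable]: "\<Phi> \<in> borel_measurable seq_space"
  shows "expectation (\<lambda>\<omega>. \<Phi> (shift i \<omega>)) = (expectation (\<lambda>\<omega>. \<Phi> (shift 0 \<omega>)) :: real)"
proof -
  have "expectation (\<lambda>\<omega>. \<Phi> (shift i \<omega>)) = (\<integral>x. \<Phi> x \<partial>distr M seq_space (shift i))" for i
    by (simp add: integral_distr)
  then show ?thesis
    by (simp add: distr_shift[of i])
qed

lemma AE_stationary:
  assumes "Measurable.pred seq_space P" "AE \<omega> in M. P (shift 0 \<omega>)"
  shows "AE \<omega> in M. P (shift i \<omega>)"
proof -
  have P: "{x \<in> space seq_space. P x} \<in> sets seq_space"
    using assms(1) by simp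
  have "AE x in distr M seq_space (shift 0). P x"
    using assms(2) P by (subst AE_distr_iff) auto
  then have "AE x in distr M seq_space (shift i). P x"
    unfolding distr_shift[of i] .
  then show ?thesis
    using P by (subst (asm) AE_distr_iff) auto
qed

lemma L2_stationary:
  assumes [measurable]: "\<Phi> \<in> borel_measurable seq_space" and "(\<lambda>\<omega>. \<Phi> (shift 0 \<omega>)) \<in> L2 M"
  shows "(\<lambda>\<omega>. \<Phi> (shift i \<omega>)) \<in> L2 M"
proof -
  have "integrable M (\<lambda>\<omega>. (\<Phi> (shift j \<omega>))\<^sup>2) \<longleftrightarrow> integrable (distr M seq_space (shift j)) (\<lambda>x. (\<Phi> x)\<^sup>2)" for j
    by (subst integrable_distr_eq) auto
  then show ?thesis
    using assms(2) by (simp add: L2_def distr_shift[of i])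
qed

lemma l2norm_stationary:
  assumes [measurable]: "\<Phi> \<in> borel_measurable seq_space"
  shows "l2norm M (\<lambda>\<omega>. \<Phi> (shift i \<omega>)) = l2norm M (\<lambda>\<omega>. \<Phi> (shift 0 \<omega>))"
  unfolding l2norm_def
  by (subst expectation_stationary[of "\<lambda>x. (\<Phi> x)\<^sup>2" i]) auto

text \<open>Dependence on the coordinates in \<open>A\<close> through an explicit measurable factor,
  pointwise and not up to null sets. Composition and pairing act on the factor, and disjoint
  coordinate sets give independence.\<close>

definition determined :: "int set \<Rightarrow> 'b measure \<Rightarrow> ('a \<Rightarrow> 'b) \<Rightarrow> bool" where
  "determined A N Y \<longleftrightarrow>
     (\<exists>u \<in> measurable (Pi\<^sub>M A (\<lambda>_. borel)) N. Y = (\<lambda>\<omega>. u (\<lambda>i\<in>A. e i \<omega>)))"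

lemma determined_measurable: "determined A N Y \<Longrightarrow> Y \<in> measurable M N"
  unfolding determined_def by (auto intro!: measurable_compose[OF measurable_restrict])

lemma determined_compose:
  assumes "determined A N Y" "g \<in> measurable N K"
  shows "determined A K (\<lambda>\<omega>. g (Y \<omega>))"
  using assms unfolding determined_def
  by (auto intro!: bexI[OF _ measurable_compose[OF _ assms(2)]])

lemma determined_Pair:
  assumes "determined A N Y" "determined A K Z"
  shows "determined A (N \<Otimes>\<^sub>M K) (\<lambda>\<omega>. (Y \<omega>, Z \<omega>))"
  using assms unfolding determined_def
  by (auto intro!: bexI[OF _ measurable_Pair])

lemma determined_sum:
  assumes "\<And>i. i \<in> I \<Longrightarrow> determined A borel (Y i)"
  shows "determined A borel (\<lambda>\<omega>. \<Sum>i\<in>I. Y i \<omega> :: real)"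
proof -
  have "\<forall>i\<in>I. \<exists>u. u \<in> borel_measurable (Pi\<^sub>M A (\<lambda>_. borel)) \<and> Y i = (\<lambda>\<omega>. u (\<lambda>i\<in>A. e i \<omega>))"
    using assms unfolding determined_def by blast
  then obtain u where "\<And>i. i \<in> I \<Longrightarrow> u i \<in> borel_measurable (Pi\<^sub>M A (\<lambda>_. borel))"
      "\<And>i. i \<in> I \<Longrightarrow> Y i = (\<lambda>\<omega>. u i (\<lambda>i\<in>A. e i \<omega>))"
    by metis
  then show ?thesis
    unfolding determined_def by (intro bexI[of _ "\<lambda>x. \<Sum>i\<in>I. u i x"]) auto
qed

lemma window_determined:
  assumes "{j - int l..j + int l} \<subseteq> A"
  shows "determined A (window_space l) (window e j l)"
proof -
  define u where "u x = (\<lambda>i\<in>{- int l..int l}. x (j + i))" for x :: "int \<Rightarrow> real"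
  have "u \<in> measurable (Pi\<^sub>M A (\<lambda>_. borel)) (window_space l)"
    unfolding u_def window_space_def using assms
    by (intro measurable_restrict measurable_component_singleton) auto
  moreover have "window e j l = (\<lambda>\<omega>. u (\<lambda>i\<in>A. e i \<omega>))"
    unfolding window_def[abs_def] u_def using assms by (intro ext restrict_ext) (auto simp: subset_iff)
  ultimately show ?thesis
    unfolding determined_def by blast
qed

lemma window_measurable [measurable]: "window e j l \<in> measurable M (window_space l)"
  using window_determined[OF order_refl] by (rule determined_measurable)

lemma determined_indep:
  assumes "determined A N Y" "determined B K Z" "A \<inter> B = {}"
  shows "indep_pair N Y K Z"
proof -
  obtain u v where u: "u \<in> measurable (Pi\<^sub>M A (\<lambda>_. borel)) N" "Y = (\<lambda>\<omega>. u (\<lambda>i\<in>A. e i \<omega>))"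
    and v: "v \<in> measurable (Pi\<^sub>M B (\<lambda>_. borel)) K" "Z = (\<lambda>\<omega>. v (\<lambda>i\<in>B. e i \<omega>))"
    using assms(1,2) unfolding determined_def by blast
  have "indep_var (Pi\<^sub>M A (\<lambda>_. borel)) (\<lambda>\<omega>. \<lambda>i\<in>A. e i \<omega>) (Pi\<^sub>M B (\<lambda>_. borel)) (\<lambda>\<omega>. \<lambda>i\<in>B. e i \<omega>)"
    using assms(3) by (intro indep_var_restrict[OF e_indep]) auto
  from indep_pair_compose[OF indep_var_imp_indep_pair[OF this] u(1) v(1)] show ?thesis
    unfolding u(2) v(2) .
qed

lemma determined_expectation_mult:
  fixes Y Z :: "'a \<Rightarrow> real"
  assumes "determined A borel Y" "determined B borel Z" "A \<inter> B = {}"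
    and "integrable M Y" "integrable M Z"
  shows "expectation (\<lambda>\<omega>. Y \<omega> * Z \<omega>) = expectation Y * expectation Z"
proof -
  have "indep_var borel Y borel Z"
    using determined_indep[OF assms(1-3)] unfolding indep_var_distribution_eq indep_pair_def .
  from indep_var_lebesgue_integral[OF this assms(4,5)] show ?thesis .
qed

lemma determined_indep_vars:
  assumes "\<And>a. a \<in> I \<Longrightarrow> determined (K a) N (W a)" "disjoint_family_on K I"
  shows "indep_vars (\<lambda>_. N) W I"
proof -
  have "\<forall>a\<in>I. \<exists>u. u \<in> measurable (Pi\<^sub>M (K a) (\<lambda>_. borel)) N \<and> W a = (\<lambda>\<omega>. u (\<lambda>i\<in>K a. e i \<omega>))"
    using assms unfolding determined_def by blast
  then obtain u where u: "\<And>a. a \<in> I \<Longrightarrow> u a \<in> measurable (Pi\<^sub>M (K a) (\<lambda>_. borel)) N"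
      "\<And>a. a \<in> I \<Longrightarrow> W a = (\<lambda>\<omega>. u a (\<lambda>i\<in>K a. e i \<omega>))"
    by metis
  have "indep_vars (\<lambda>a. Pi\<^sub>M (K a) (\<lambda>_. borel)) (\<lambda>a \<omega>. \<lambda>i\<in>K a. e i \<omega>) I"
    by (intro indep_vars_restrict[OF e_indep] assms(2)) auto
  from indep_vars_compose2[OF this u(1)] have "indep_vars (\<lambda>_. N) (\<lambda>a \<omega>. u a (\<lambda>i\<in>K a. e i \<omega>)) I"
    by simp
  then show ?thesis
    by (subst indep_vars_cong[OF refl u(2) refl])
qed

lemma windows_indep:
  assumes "2 * int l < \<bar>i - j\<bar>"
  shows "indep_pair (window_space l) (window e i l) (window_space l) (window e j l)"
  using assms
  by (intro determined_indep[OF window_determined[OF order_refl] window_determined[OF order_refl]]) auto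

text \<open>The window read off a path instead of a sample point, so that windows become functions
  of \<open>shift\<close>.\<close>

definition seq_window :: "int \<Rightarrow> nat \<Rightarrow> (int \<Rightarrow> real) \<Rightarrow> int \<Rightarrow> real" where
  "seq_window j l x = (\<lambda>i\<in>{- int l..int l}. x (j + i))"

lemma seq_window_measurable [measurable]: "seq_window j l \<in> measurable seq_space (window_space l)"
  unfolding seq_window_def window_space_def
  by (intro measurable_restrict measurable_component_singleton) auto

lemma window_shift: "window e (i + j) l \<omega> = seq_window j l (shift i \<omega>)"
  by (simp add: window_def seq_window_def shift_def add.assoc)

text \<open>Coordinates are offsets, so one restriction map takes radius l + 1 to radius l for every
  centre. Kernels of consecutive levels thereby become functions of the same windows.\<close>

lemma window_Suc: "window e j l \<omega> = restrict (window e j (Suc l) \<omega>) {- int l..int l}"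
  by (auto simp: window_def restrict_def fun_eq_iff)

lemma restrict_window_measurable [measurable]:
  "(\<lambda>x. restrict x {- int l..int l}) \<in> measurable (window_space (Suc l)) (window_space l)"
  unfolding window_space_def by (rule measurable_restrict_subset) auto

end

section \<open>Finitely dependent stationary sequences\<close>

text \<open>The inner sum over j is the sum of \<gamma> over [1 - i, n - i]. Unless i is within K of
  an end of {1..n}, this interval contains [-K, K] and the sum is close to its limit; the at most 2K
  exceptional i contribute a bounded amount each.\<close>

lemma cesaro_covariance:
  fixes \<gamma> :: "int \<Rightarrow> real"
  assumes abs: "(\<lambda>k. \<bar>\<gamma> k\<bar>) summable_on UNIV"
  shows "(\<lambda>n. (\<Sum>i\<in>{1..n}. \<Sum>j\<in>{1..n}. \<gamma> (int j - int i)) / real n) \<longlonglongrightarrow> (\<Sum>\<^sub>\<infinity>k. \<gamma> k)"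
proof (rule LIMSEQ_I)
  fix r :: real assume "0 < r"
  define S T where "S = (\<Sum>\<^sub>\<infinity>k. \<gamma> k)" and "T = (\<Sum>\<^sub>\<infinity>k. \<bar>\<gamma> k\<bar>)"
  have norm_sum: "(\<lambda>k. norm (\<gamma> k)) summable_on UNIV"
    using abs by simp
  have T: "0 \<le> T" "\<bar>S\<bar> \<le> T"
    using norm_infsum_bound[OF norm_sum] by (auto simp: S_def T_def intro: infsum_nonneg)
  have part: "\<bar>sum \<gamma> A\<bar> \<le> T" if "finite A" for A
  proof -
    have "\<bar>sum \<gamma> A\<bar> \<le> (\<Sum>k\<in>A. \<bar>\<gamma> k\<bar>)"
      by (rule sum_abs)
    also have "\<dots> \<le> T"
      unfolding T_def using that by (intro finite_sum_le_infsum abs) auto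
    finally show ?thesis .
  qed
  have "(\<gamma> has_sum S) UNIV"
    unfolding S_def using abs_summable_summable[OF norm_sum] by (rule has_sum_infsum)
  then have "\<forall>\<^sub>F A in finite_subsets_at_top UNIV. dist (sum \<gamma> A) S < r / 2"
    unfolding has_sum_def using \<open>0 < r\<close> by (intro tendstoD) auto
  then obtain F where F: "finite F" "\<And>A. finite A \<Longrightarrow> F \<subseteq> A \<Longrightarrow> dist (sum \<gamma> A) S < r / 2"
    unfolding eventually_finite_subsets_at_top by auto
  define K where "K = Max (insert 0 ((\<lambda>k. nat \<bar>k\<bar>) ` F))"
  have "nat \<bar>k\<bar> \<le> K" if "k \<in> F" for k
    unfolding K_def using F(1) that by (intro Max_ge) auto
  then have K: "F \<subseteq> {- int K..int K}"
    by (force simp: nat_le_iff)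
  \<comment> \<open>The exceptional indices contribute at most 2K times 2T, and 4KT has to stay
    below n r / 2.\<close>
  obtain N :: nat where N: "8 * real K * T / r < real N"
    using reals_Archimedean2 by blast
  show "\<exists>N. \<forall>n\<ge>N. norm ((\<Sum>i\<in>{1..n}. \<Sum>j\<in>{1..n}. \<gamma> (int j - int i)) / real n - (\<Sum>\<^sub>\<infinity>k. \<gamma> k)) < r"
  proof (intro exI allI impI)
    fix n assume "Suc N \<le> n"
    then have n: "0 < real n" "8 * real K * T / r < real n"
      using N by (auto intro: order_less_trans)
    define E where "E i = (\<Sum>j\<in>{1..n}. \<gamma> (int j - int i)) - S" for i :: nat
    define Bad where "Bad = {1..K} \<union> {n - K<..n}"
    have E_eq: "E i = sum \<gamma> {1 - int i..int n - int i} - S" for i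
    proof -
      have "(\<Sum>j\<in>{1..n}. \<gamma> (int j - int i)) = sum \<gamma> {1 - int i..int n - int i}"
        by (rule sum.reindex_bij_witness[of _ "\<lambda>k. nat (k + int i)" "\<lambda>j. int j - int i"]) auto
      then show ?thesis
        by (simp add: E_def)
    qed
    have E_bad: "\<bar>E i\<bar> \<le> 2 * T" for i
      unfolding E_eq using part[of "{1 - int i..int n - int i}"] T by simp
    have E_good: "\<bar>E i\<bar> \<le> r / 2" if "i \<in> {1..n} - Bad" for i
    proof -
      have "F \<subseteq> {1 - int i..int n - int i}"
        using that K by (force simp: Bad_def)
      then show ?thesis
        using F(2)[of "{1 - int i..int n - int i}"] unfolding E_eq dist_real_def by simp
    qed
    have "card Bad \<le> K + K"
      unfolding Bad_def by (rule order_trans[OF card_Un_le]) auto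
    then have card_Bad: "real (card Bad) \<le> 2 * real K"
      by simp
    have "\<bar>\<Sum>i\<in>{1..n}. E i\<bar> \<le> (\<Sum>i\<in>{1..n}. \<bar>E i\<bar>)"
      by (rule sum_abs)
    also have "\<dots> = (\<Sum>i\<in>{1..n} - Bad. \<bar>E i\<bar>) + (\<Sum>i\<in>{1..n} \<inter> Bad. \<bar>E i\<bar>)"
      by (subst sum.union_disjoint[symmetric]) (auto intro!: sum.cong)
    also have "\<dots> \<le> (\<Sum>i\<in>{1..n} - Bad. r / 2) + (\<Sum>i\<in>{1..n} \<inter> Bad. 2 * T)"
      by (intro add_mono sum_mono E_good E_bad)
    also have "\<dots> = real (card ({1..n} - Bad)) * (r / 2) + real (card ({1..n} \<inter> Bad)) * (2 * T)"
      by simp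
    also have "\<dots> \<le> real n * (r / 2) + (2 * real K) * (2 * T)"
    proof (intro add_mono mult_right_mono)
      show "real (card ({1..n} - Bad)) \<le> real n"
        using card_mono[of "{1..n}" "{1..n} - Bad"] by simp
      have "card ({1..n} \<inter> Bad) \<le> card Bad"
        by (intro card_mono) (auto simp: Bad_def)
      then show "real (card ({1..n} \<inter> Bad)) \<le> 2 * real K"
        using card_Bad by linarith
    qed (use T \<open>0 < r\<close> in auto)
    also have "\<dots> < real n * r"
      using n \<open>0 < r\<close> by (simp add: field_simps)
    finally have "\<bar>\<Sum>i\<in>{1..n}. E i\<bar> < real n * r" .
    moreover have "(\<Sum>i\<in>{1..n}. E i) = (\<Sum>i\<in>{1..n}. \<Sum>j\<in>{1..n}. \<gamma> (int j - int i)) - real n * S"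
      by (simp add: E_def sum_subtractf)
    ultimately have "\<bar>((\<Sum>i\<in>{1..n}. \<Sum>j\<in>{1..n}. \<gamma> (int j - int i)) - real n * S) / real n\<bar> < r"
      using n by (simp add: abs_divide divide_less_eq mult.commute)
    then show "norm ((\<Sum>i\<in>{1..n}. \<Sum>j\<in>{1..n}. \<gamma> (int j - int i)) / real n - (\<Sum>\<^sub>\<infinity>k. \<gamma> k)) < r"
      using n by (simp add: S_def diff_divide_distrib)
  qed
qed

lemma l2norm_sum_squared_covariance:
  fixes Z :: "int \<Rightarrow> 'a \<Rightarrow> real"
  assumes Z: "\<And>i. Z i \<in> L2 M" and \<gamma>: "\<And>i j. (\<integral>x. Z i x * Z j x \<partial>M) = \<gamma> (j - i)"
  shows "(l2norm M (\<lambda>x. \<Sum>i\<in>{1..n::nat}. Z (int i) x))\<^sup>2 = (\<Sum>i\<in>{1..n}. \<Sum>j\<in>{1..n}. \<gamma> (int j - int i))"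
proof -
  have "(l2norm M (\<lambda>x. \<Sum>i\<in>{1..n}. Z (int i) x))\<^sup>2
      = (\<integral>x. (\<Sum>i\<in>{1..n}. \<Sum>j\<in>{1..n}. Z (int i) x * Z (int j) x) \<partial>M)"
    unfolding l2norm_squared unfolding power2_eq_square sum_product ..
  also have "\<dots> = (\<Sum>i\<in>{1..n}. \<integral>x. (\<Sum>j\<in>{1..n}. Z (int i) x * Z (int j) x) \<partial>M)"
    by (intro Bochner_Integration.integral_sum Bochner_Integration.integrable_sum
        L2_mult_integrable Z)
  also have "\<dots> = (\<Sum>i\<in>{1..n}. \<Sum>j\<in>{1..n}. \<gamma> (int j - int i))"
    unfolding \<gamma>[symmetric] by (intro sum.cong refl Bochner_Integration.integral_sum L2_mult_integrable Z)
  finally show ?thesis .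
qed

text \<open>A limit of squared norms is nonnegative, which makes the sum of covariances a legitimate
  variance. No finite-window structure is assumed, so this serves the Y_k as well as their
  approximations.\<close>

lemma l2norm_mean_sum_tendsto:
  fixes Z :: "int \<Rightarrow> 'a \<Rightarrow> real"
  assumes Z: "\<And>i. Z i \<in> L2 M" and \<gamma>: "\<And>i j. (\<integral>x. Z i x * Z j x \<partial>M) = \<gamma> (j - i)"
    and abs: "(\<lambda>k. \<bar>\<gamma> k\<bar>) summable_on UNIV"
  shows "(\<lambda>n. l2norm M (\<lambda>x. (\<Sum>i\<in>{1..n}. Z (int i) x) / sqrt (real n))) \<longlonglongrightarrow> sqrt (\<Sum>\<^sub>\<infinity>k. \<gamma> k)"
    and "0 \<le> (\<Sum>\<^sub>\<infinity>k. \<gamma> k)"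
proof -
  define v where "v n = l2norm M (\<lambda>x. (\<Sum>i\<in>{1..n}. Z (int i) x) / sqrt (real n))" for n
  have sq: "(v n)\<^sup>2 = (\<Sum>i\<in>{1..n}. \<Sum>j\<in>{1..n}. \<gamma> (int j - int i)) / real n" for n
    using l2norm_cmult[of M "1 / sqrt (real n)" "\<lambda>x. \<Sum>i\<in>{1..n}. Z (int i) x"]
      l2norm_sum_squared_covariance[where Z=Z and \<gamma>=\<gamma>, OF Z \<gamma>, of n]
    by (simp add: v_def power_divide power_mult_distrib)
  have lim: "(\<lambda>n. (v n)\<^sup>2) \<longlonglongrightarrow> (\<Sum>\<^sub>\<infinity>k. \<gamma> k)"
    unfolding sq by (rule cesaro_covariance[OF abs])
  then show "0 \<le> (\<Sum>\<^sub>\<infinity>k. \<gamma> k)"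
    by (rule LIMSEQ_le_const) auto
  have "(\<lambda>n. sqrt ((v n)\<^sup>2)) \<longlonglongrightarrow> sqrt (\<Sum>\<^sub>\<infinity>k. \<gamma> k)"
    using lim by (rule tendsto_real_sqrt)
  then show "(\<lambda>n. l2norm M (\<lambda>x. (\<Sum>i\<in>{1..n}. Z (int i) x) / sqrt (real n))) \<longlonglongrightarrow> sqrt (\<Sum>\<^sub>\<infinity>k. \<gamma> k)"
    unfolding v_def by simp
qed

section \<open>Bernstein blocks for 2l-dependent sequences\<close>

lemma div_over_tendsto:
  assumes "0 < p"
  shows "(\<lambda>n. real (n div p) / real n) \<longlonglongrightarrow> 1 / real p"
proof (rule tendsto_sandwich)
  have *: "real n = real (n div p) * real p + real (n mod p)" for n
    by (metis div_mult_mod_eq of_nat_add of_nat_mult)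
  show "\<forall>\<^sub>F n in sequentially. 1 / real p - 1 / real n \<le> real (n div p) / real n"
  proof (rule eventually_sequentiallyI[of 1])
    fix n :: nat assume "1 \<le> n"
    have "real (n mod p) \<le> real p"
      using assms by (simp add: less_imp_le)
    then have "real n \<le> real (n div p) * real p + real p"
      using *[of n] by linarith
    then have "real n / real p - 1 \<le> real (n div p)"
      using assms by (simp add: field_simps)
    then have "(real n / real p - 1) / real n \<le> real (n div p) / real n"
      by (rule divide_right_mono) simp
    then show "1 / real p - 1 / real n \<le> real (n div p) / real n"
      using \<open>1 \<le> n\<close> by (simp add: diff_divide_distrib)
  qed
  show "\<forall>\<^sub>F n in sequentially. real (n div p) / real n \<le> 1 / real p"
  proof (rule eventually_sequentiallyI[of 1])
    fix n :: nat assume "1 \<le> n"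
    then show "real (n div p) / real n \<le> 1 / real p"
      using *[of n] assms by (simp add: field_simps)
  qed
  show "(\<lambda>n. 1 / real p - 1 / real n) \<longlonglongrightarrow> 1 / real p"
    using tendsto_diff[OF tendsto_const lim_1_over_n] by simp
qed simp

text \<open>A centred, stationary, 2l-dependent sequence \<Phi>(V_{i,l}). It is instantiated with
  the projections of one level and, with radius l + 1, with differences of projections of
  consecutive levels.\<close>

locale window_process = iid_process +
  fixes \<Phi> :: "(int \<Rightarrow> real) \<Rightarrow> real" and l :: nat
  assumes \<Phi> [measurable]: "\<Phi> \<in> borel_measurable (window_space l)"
    and Z0_L2: "(\<lambda>\<omega>. \<Phi> (window e 0 l \<omega>)) \<in> L2 M"
    and Z0_mean: "expectation (\<lambda>\<omega>. \<Phi> (window e 0 l \<omega>)) = 0"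
begin

definition Z :: "int \<Rightarrow> 'a \<Rightarrow> real" where
  "Z i \<omega> = \<Phi> (window e i l \<omega>)"

lemma Z_shift: "Z (i + j) = (\<lambda>\<omega>. \<Phi> (seq_window j l (shift i \<omega>)))"
  by (simp add: Z_def[abs_def] window_shift)

lemma Z_L2: "Z i \<in> L2 M"
  using L2_stationary[of "\<lambda>x. \<Phi> (seq_window 0 l x)" i] Z0_L2 Z_shift[of i 0] Z_shift[of 0 0]
  by (simp add: Z_def[abs_def])

lemma Z_norm: "l2norm M (Z i) = l2norm M (Z 0)"
  using l2norm_stationary[of "\<lambda>x. \<Phi> (seq_window 0 l x)" i] Z_shift[of i 0] Z_shift[of 0 0]
  by simp

lemma Z_mean: "expectation (Z i) = 0"
  using expectation_stationary[of "\<lambda>x. \<Phi> (seq_window 0 l x)" i] Z0_mean Z_shift[of i 0] Z_shift[of 0 0]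
  by (simp add: Z_def[abs_def])

lemma Z_determined: "{i - int l..i + int l} \<subseteq> A \<Longrightarrow> determined A borel (Z i)"
  unfolding Z_def[abs_def] by (rule determined_compose[OF window_determined \<Phi>])

definition \<gamma> :: "int \<Rightarrow> real" where
  "\<gamma> k = expectation (\<lambda>\<omega>. Z 0 \<omega> * Z k \<omega>)"

lemma Z_covariance: "expectation (\<lambda>\<omega>. Z i \<omega> * Z j \<omega>) = \<gamma> (j - i)"
  using expectation_stationary[of "\<lambda>x. \<Phi> (seq_window 0 l x) * \<Phi> (seq_window (j - i) l x)" i]
    Z_shift[of i 0] Z_shift[of 0 0] Z_shift[of i "j - i"] Z_shift[of 0 "j - i"]
  by (simp add: \<gamma>_def)

lemma Z_uncorrelated: "2 * int l < \<bar>i - j\<bar> \<Longrightarrow> expectation (\<lambda>\<omega>. Z i \<omega> * Z j \<omega>) = 0"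
  using determined_expectation_mult[OF Z_determined[OF order_refl] Z_determined[OF order_refl]
      _ L2_integrable[OF Z_L2] L2_integrable[OF Z_L2], of i j]
  by (auto simp: Z_mean)

lemma \<gamma>_summable: "(\<lambda>k. \<bar>\<gamma> k\<bar>) summable_on UNIV"
proof (rule summable_on_cong_neutral[THEN iffD2])
  show "(\<lambda>k. \<bar>\<gamma> k\<bar>) summable_on {- 2 * int l..2 * int l}"
    by (rule summable_on_finite) simp
  show "\<bar>\<gamma> k\<bar> = 0" if "k \<in> UNIV - {- 2 * int l..2 * int l}" for k
    using that Z_uncorrelated[of 0 k] by (auto simp: \<gamma>_def)
qed auto

text \<open>At most 4l + 1 indices j satisfy |i - j| <= 2l, and only these can correlate with i. The
  index set is arbitrary since the bound is also applied to the scattered indices left between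
  blocks.\<close>

lemma l2norm_sum_Z:
  assumes "finite A"
  shows "(l2norm M (\<lambda>\<omega>. \<Sum>i\<in>A. Z (int i) \<omega>))\<^sup>2 \<le> (l2norm M (Z 0))\<^sup>2 * (4 * real l + 1) * real (card A)"
proof -
  have "card {j \<in> A. expectation (\<lambda>\<omega>. Z (int i) \<omega> * Z (int j) \<omega>) \<noteq> 0} \<le> 4 * l + 1" for i
  proof -
    have "{j \<in> A. expectation (\<lambda>\<omega>. Z (int i) \<omega> * Z (int j) \<omega>) \<noteq> 0} \<subseteq> {i - 2 * l..i + 2 * l}"
    proof safe
      fix j assume "expectation (\<lambda>\<omega>. Z (int i) \<omega> * Z (int j) \<omega>) \<noteq> 0"
      then have "\<not> 2 * int l < \<bar>int i - int j\<bar>"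
        using Z_uncorrelated by blast
      then show "j \<in> {i - 2 * l..i + 2 * l}"
        by auto
    qed
    then have "card {j \<in> A. expectation (\<lambda>\<omega>. Z (int i) \<omega> * Z (int j) \<omega>) \<noteq> 0} \<le> card {i - 2 * l..i + 2 * l}"
      by (rule card_mono[rotated]) simp
    then show ?thesis
      by simp
  qed
  then have "(l2norm M (\<lambda>\<omega>. \<Sum>i\<in>A. Z (int i) \<omega>))\<^sup>2
      \<le> (l2norm M (Z 0))\<^sup>2 * real (4 * l + 1) * real (card A)"
    by (intro l2norm_sum_sparse[where Z="\<lambda>i. Z (int i)"] assms Z_L2) (simp_all add: Z_norm[of "int _"])
  then show ?thesis
    by (simp add: add.commute)
qed

text \<open>Gaps of length 2l separate the blocks: with p = K + 2l, the windows of block a end at a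
  p + K + l and those of the next one start at a p + K + l + 1. Block sums are therefore
  independent, and identically distributed by stationarity.\<close>

lemma block_clt:
  defines "block \<equiv> \<lambda>K a. {a * (K + 2 * l) + 1..a * (K + 2 * l) + K}"
  assumes K: "0 < K"
  shows "clt M (\<lambda>n \<omega>. (\<Sum>a<n div (K + 2 * l). \<Sum>i\<in>block K a. Z (int i) \<omega>) / sqrt (real n))
    ((l2norm M (\<lambda>\<omega>. (\<Sum>i\<in>{1..K}. Z (int i) \<omega>) / sqrt (real (K + 2 * l))))\<^sup>2)"
proof -
  define p where "p = K + 2 * l"
  have p: "0 < p"
    using K by (simp add: p_def)
  define W where "W a \<omega> = (\<Sum>i\<in>block K a. Z (int i) \<omega>)" for a \<omega>
  have W_L2: "W a \<in> L2 M" for a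
    unfolding W_def[abs_def] by (intro L2_sum Z_L2)
  have W_mean: "expectation (W a) = 0" for a
    unfolding W_def[abs_def]
    by (subst Bochner_Integration.integral_sum) (auto simp: Z_mean intro: L2_integrable Z_L2)
  have W_shift: "W a = (\<lambda>\<omega>. \<Sum>i\<in>{1..K}. \<Phi> (seq_window (int i) l (shift (int (a * p)) \<omega>)))" for a
  proof
    fix \<omega>
    have "W a \<omega> = (\<Sum>i\<in>{1..K}. Z (int (a * p) + int i) \<omega>)"
      unfolding W_def block_def p_def
      by (rule sum.reindex_bij_witness[of _ "\<lambda>i. a * (K + 2 * l) + i" "\<lambda>i. i - a * (K + 2 * l)"]) auto
    then show "W a \<omega> = (\<Sum>i\<in>{1..K}. \<Phi> (seq_window (int i) l (shift (int (a * p)) \<omega>)))"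
      unfolding Z_shift .
  qed
  have W_distr: "distr M borel (W a) = distr M borel (W 0)" for a
    using distr_stationary[of "\<lambda>x. \<Sum>i\<in>{1..K}. \<Phi> (seq_window (int i) l x)" borel "int (a * p)"]
    unfolding W_shift by simp
  \<comment> \<open>\<open>N a\<close> collects the noise coordinates read by block a.\<close>
  define N where "N a = {int (a * p) + 1 - int l..int (a * p) + int K + int l}" for a
  have "disjoint_family_on N UNIV"
  proof -
    have "N a \<inter> N b = {}" if "a < b" for a b
    proof -
      have "(a + 1) * p \<le> b * p"
        using that by (intro mult_right_mono) auto
      then have "int (a * p) + int K + 2 * int l \<le> int (b * p)"
        by (simp add: p_def algebra_simps flip: of_nat_add of_nat_mult)
      then show ?thesis
        by (auto simp: N_def)
    qed
    then show ?thesis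
      unfolding disjoint_family_on_def by (metis Int_commute linorder_neqE_nat)
  qed
  moreover have "determined (N a) borel (W a)" for a
  proof -
    define b where "b = a * p"
    have "block K a = {b + 1..b + K}"
      by (simp add: b_def block_def p_def)
    then show ?thesis
      unfolding W_def[abs_def] N_def b_def[symmetric]
      by (intro determined_sum Z_determined) auto
  qed
  ultimately have "indep_vars (\<lambda>_. borel) W UNIV"
    by (intro determined_indep_vars) auto
  then have "clt M (\<lambda>n \<omega>. (\<Sum>a<n. W a \<omega>) / sqrt (real n)) ((l2norm M (W 0))\<^sup>2)"
    by (rule clt_iid[where W=W, OF _ W_L2 W_mean W_distr])
  moreover have "filterlim (\<lambda>n. n div p) at_top sequentially"
    using p by (intro filterlim_at_top_div_const_nat)
  ultimately have clt: "clt M (\<lambda>n \<omega>. (\<Sum>a<n div p. W a \<omega>) / sqrt (real (n div p))) ((l2norm M (W 0))\<^sup>2)"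
    by (rule clt_subseq)
  have "clt M (\<lambda>n \<omega>. sqrt (real (n div p) / real n) * ((\<Sum>a<n div p. W a \<omega>) / sqrt (real (n div p))))
      ((sqrt (1 / real p))\<^sup>2 * (l2norm M (W 0))\<^sup>2)"
  proof (rule clt_scale[OF _ _ _ clt])
    define C where "C = sqrt ((l2norm M (Z 0))\<^sup>2 * (4 * real l + 1) * real K)"
    show "(\<lambda>\<omega>. (\<Sum>a<n div p. W a \<omega>) / sqrt (real (n div p))) \<in> L2 M" for n
      using L2_cmult[OF L2_sum[of "{..<n div p}" W M], of "1 / sqrt (real (n div p))"] W_L2 by simp
    show "l2norm M (\<lambda>\<omega>. (\<Sum>a<n div p. W a \<omega>) / sqrt (real (n div p))) \<le> C" for n
    proof -
      define q where "q = n div p"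
      \<comment> \<open>Distinct block sums are independent and centred, so each correlates at most
        with itself: the sparse bound applies with d = 1.\<close>
      have "(l2norm M (\<lambda>\<omega>. \<Sum>a<q. W a \<omega>))\<^sup>2 \<le> (l2norm M (W 0))\<^sup>2 * real (1::nat) * real (card {..<q})"
      proof (rule l2norm_sum_sparse)
        show "l2norm M (W a) \<le> l2norm M (W 0)" for a
          using l2norm_stationary[of "\<lambda>x. \<Sum>i\<in>{1..K}. \<Phi> (seq_window (int i) l x)" "int (a * p)"]
          unfolding W_shift by simp
        show "card {b \<in> {..<q}. expectation (\<lambda>\<omega>. W a \<omega> * W b \<omega>) \<noteq> 0} \<le> 1" for a
        proof -
          have "expectation (\<lambda>\<omega>. W a \<omega> * W b \<omega>) = 0" if "a \<noteq> b" for b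
            using determined_expectation_mult[OF \<open>determined (N a) borel (W a)\<close> \<open>determined (N b) borel (W b)\<close>
                _ L2_integrable[OF W_L2] L2_integrable[OF W_L2]]
              \<open>disjoint_family_on N UNIV\<close> that
            by (simp add: W_mean disjoint_family_on_def)
          then have "{b \<in> {..<q}. expectation (\<lambda>\<omega>. W a \<omega> * W b \<omega>) \<noteq> 0} \<subseteq> {a}"
            by (auto intro: ccontr[of "_ = _"])
          from card_mono[OF _ this] show ?thesis
            by simp
        qed
      qed (use W_L2 in auto)
      also have "\<dots> \<le> C\<^sup>2 * real q"
        using l2norm_sum_Z[of "{1..K}"] by (simp add: C_def W_def[abs_def] block_def mult_right_mono)
      also have "\<dots> = (C * sqrt (real q))\<^sup>2"
        by (simp add: power_mult_distrib)
      finally have "l2norm M (\<lambda>\<omega>. \<Sum>a<q. W a \<omega>) \<le> C * sqrt (real q)"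
        by (rule power2_le_imp_le) (simp add: C_def)
      then show ?thesis
        unfolding q_def[symmetric] l2norm_divide
        by (cases "q = 0") (auto simp: pos_divide_le_eq C_def)
    qed
    show "(\<lambda>n. sqrt (real (n div p) / real n)) \<longlonglongrightarrow> sqrt (1 / real p)"
      by (intro tendsto_real_sqrt div_over_tendsto p)
  qed
  \<comment> \<open>The i.i.d. theorem normalises by the number of blocks, not by n; this factor
    converts one into the other. While there is no block, the sums are empty and both sides
    vanish.\<close>
  moreover have "sqrt (real (n div p) / real n) * (x / sqrt (real (n div p))) = x / sqrt (real n)"
    if "n div p \<noteq> 0" for n x
    using that p by (simp add: real_sqrt_divide)
  then have "sqrt (real (n div p) / real n) * ((\<Sum>a<n div p. W a \<omega>) / sqrt (real (n div p)))
      = (\<Sum>a<n div p. W a \<omega>) / sqrt (real n)" for n \<omega>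
    by (cases "n div p = 0") auto
  moreover have "(sqrt (1 / real p))\<^sup>2 * (l2norm M (W 0))\<^sup>2
      = (l2norm M (\<lambda>\<omega>. (\<Sum>i\<in>{1..K}. Z (int i) \<omega>) / sqrt (real p)))\<^sup>2"
    using l2norm_cmult[of M "1 / sqrt (real p)" "W 0"]
    by (simp add: W_def[abs_def] block_def power_mult_distrib power_divide)
  ultimately show ?thesis
    by (simp add: W_def p_def)
qed

text \<open>With n growing first and K afterwards, the indices outside the blocks contribute to the
  normalised variance at most a constant times (2l + 1)/(K + 2l), which vanishes as K grows, while
  the block variances tend to the sum of the covariances.\<close>

lemma Z_clt:
  "clt M (\<lambda>n \<omega>. (\<Sum>i\<in>{1..n}. Z (int i) \<omega>) / sqrt (real n)) (\<Sum>\<^sub>\<infinity>k. \<gamma> k)"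
proof (rule clt_approx)
  define c where "c = l2norm M (Z 0) * sqrt (4 * real l + 1)"
  define block where "block K a = {a * (K + 2 * l) + 1..a * (K + 2 * l) + K}" for K a :: nat
  define B where "B K n \<omega> = (\<Sum>a<n div (K + 2 * l). \<Sum>i\<in>block K a. Z (int i) \<omega>) / sqrt (real n)" for K n \<omega>
  define \<delta> where "\<delta> K = c * sqrt ((2 * real l + 1) / real (K + 2 * l))" for K
  define s where "s K = (l2norm M (\<lambda>\<omega>. (\<Sum>i\<in>{1..K}. Z (int i) \<omega>) / sqrt (real (K + 2 * l))))\<^sup>2" for K
  have c: "0 \<le> c"
    by (simp add: c_def)
  show "(\<lambda>\<omega>. (\<Sum>i\<in>{1..n}. Z (int i) \<omega>) / sqrt (real n)) \<in> L2 M" for n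
    using L2_cmult[OF L2_sum[of "{1..n}" "\<lambda>i. Z (int i)" M], of "1 / sqrt (real n)"] Z_L2 by simp
  show "B (Suc K) n \<in> L2 M" for K n
    unfolding B_def[abs_def] divide_inverse mult.commute[of _ "inverse _"]
    by (intro L2_cmult L2_sum Z_L2)
  show "clt M (B (Suc K)) (s (Suc K))" for K
    unfolding B_def[abs_def] s_def block_def by (rule block_clt) simp
  show "\<forall>\<^sub>F n in sequentially.
      l2norm M (\<lambda>\<omega>. (\<Sum>i\<in>{1..n}. Z (int i) \<omega>) / sqrt (real n) - B (Suc K) n \<omega>) \<le> \<delta> (Suc K)" for K
  proof (rule eventually_sequentiallyI)
    define p where "p = Suc K + 2 * l"
    \<comment> \<open>This threshold gives p <= n / p: the incomplete last period, of fewer than p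
      indices, then counts like one more index per period, whence 2l + 1 in
      \<open>\<delta>\<close>.\<close>
    fix n assume n: "p * p \<le> n"
    have p: "0 < p"
      by (simp add: p_def)
    then have "0 < n"
      using n by (metis mult_pos_pos order_less_le_trans)
    define q where "q = n div p"
    define U where "U = (\<Union>a<q. block (Suc K) a)"
    define G where "G = {1..n} - U"
    have ap: "a * p + p \<le> n" if "a < q" for a
    proof -
      have "(a + 1) * p \<le> q * p"
        using that by (intro mult_right_mono) auto
      also have "\<dots> \<le> n"
        unfolding q_def by simp
      finally show ?thesis
        by simp
    qed
    have U: "U \<subseteq> {1..n}"
      unfolding U_def block_def using ap by (force simp: p_def)
    have disj: "block (Suc K) a \<inter> block (Suc K) b = {}" if "a < b" for a b
    proof -
      have "(a + 1) * (Suc K + 2 * l) \<le> b * (Suc K + 2 * l)"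
        using that by (intro mult_right_mono) auto
      then show ?thesis
        by (auto simp: block_def)
    qed
    then have disj': "\<forall>a\<in>{..<q}. \<forall>b\<in>{..<q}. a \<noteq> b \<longrightarrow> block (Suc K) a \<inter> block (Suc K) b = {}"
      by (metis Int_commute linorder_neqE_nat)
    have "card U = (\<Sum>a<q. card (block (Suc K) a))"
      unfolding U_def using disj' by (intro card_UN_disjoint) (auto simp: block_def)
    then have "card U = q * Suc K"
      by (simp add: block_def)
    moreover have "card G = n - card U"
      unfolding G_def using U by (subst card_Diff_subset) (auto intro: finite_subset)
    moreover have "n = q * p + n mod p" "n mod p < p"
      using p by (auto simp: q_def)
    moreover have "q * p = q * Suc K + q * (2 * l)"
      by (simp add: p_def algebra_simps)
    ultimately have "card G \<le> q * (2 * l) + p"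
      by linarith
    then have "real (card G) \<le> real (q * (2 * l) + p)"
      by (rule of_nat_mono)
    then have "real (card G) \<le> real q * (2 * real l) + real p"
      by simp
    moreover have "real q * (2 * real l) \<le> real n / real p * (2 * real l)"
      unfolding q_def by (intro mult_right_mono of_nat_div_le_of_nat) simp
    moreover have "real p \<le> real n / real p"
      using n p by (simp add: field_simps flip: of_nat_mult)
    ultimately have card_G: "real (card G) \<le> real n / real p * (2 * real l) + real n / real p"
      by linarith
    have split: "(\<Sum>i\<in>{1..n}. Z (int i) \<omega>) = (\<Sum>a<q. \<Sum>i\<in>block (Suc K) a. Z (int i) \<omega>) + (\<Sum>i\<in>G. Z (int i) \<omega>)" for \<omega>
    proof -
      have "(\<Sum>i\<in>U. Z (int i) \<omega>) = (\<Sum>a<q. \<Sum>i\<in>block (Suc K) a. Z (int i) \<omega>)"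
        unfolding U_def using disj' by (intro sum.UNION_disjoint) (auto simp: block_def)
      moreover have "(\<Sum>i\<in>{1..n}. Z (int i) \<omega>) = (\<Sum>i\<in>G. Z (int i) \<omega>) + (\<Sum>i\<in>U. Z (int i) \<omega>)"
        unfolding G_def using U by (intro sum.subset_diff) auto
      ultimately show ?thesis
        by simp
    qed
    have "(l2norm M (\<lambda>\<omega>. \<Sum>i\<in>G. Z (int i) \<omega>))\<^sup>2 \<le> c\<^sup>2 * real (card G)"
      using l2norm_sum_Z[of G] by (simp add: c_def power_mult_distrib G_def)
    also have "\<dots> \<le> c\<^sup>2 * (real n * ((2 * real l + 1) / real p))"
      using card_G by (intro mult_left_mono) (auto simp: algebra_simps add_divide_distrib)
    also have "\<dots> = (\<delta> (Suc K) * sqrt (real n))\<^sup>2"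
      by (simp add: \<delta>_def p_def power_mult_distrib)
    finally have "l2norm M (\<lambda>\<omega>. \<Sum>i\<in>G. Z (int i) \<omega>) \<le> \<delta> (Suc K) * sqrt (real n)"
      by (rule power2_le_imp_le) (simp add: \<delta>_def c)
    moreover have "(\<lambda>\<omega>. (\<Sum>i\<in>{1..n}. Z (int i) \<omega>) / sqrt (real n) - B (Suc K) n \<omega>)
        = (\<lambda>\<omega>. (\<Sum>i\<in>G. Z (int i) \<omega>) / sqrt (real n))"
      unfolding split B_def q_def p_def by (simp add: add_divide_distrib)
    ultimately show "l2norm M (\<lambda>\<omega>. (\<Sum>i\<in>{1..n}. Z (int i) \<omega>) / sqrt (real n) - B (Suc K) n \<omega>) \<le> \<delta> (Suc K)"
      using \<open>0 < n\<close> by (simp add: l2norm_divide pos_divide_le_eq)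
  qed
  have lim0: "(\<lambda>K. x / real (K + 2 * l)) \<longlonglongrightarrow> 0" for x
    by (intro tendsto_divide_0[OF tendsto_const] filterlim_at_top_imp_at_infinity
        filterlim_compose[OF filterlim_real_sequentially] filterlim_add_const_nat_at_top)
  have "(\<lambda>K. c * sqrt ((2 * real l + 1) / real (K + 2 * l))) \<longlonglongrightarrow> c * sqrt 0"
    by (intro tendsto_intros lim0)
  then have "\<delta> \<longlonglongrightarrow> 0"
    by (simp add: \<delta>_def[abs_def])
  then show "(\<lambda>K. \<delta> (Suc K)) \<longlonglongrightarrow> 0"
    by (rule LIMSEQ_Suc)
  \<comment> \<open>\<open>s K\<close> is the normalised variance of K consecutive terms times this
    ratio, the fraction of each period that lies in its block.\<close>
  have "(\<lambda>K. real K / real (K + 2 * l)) \<longlonglongrightarrow> 1"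
  proof (rule Lim_transform_eventually)
    show "(\<lambda>K. 1 - 2 * real l / real (K + 2 * l)) \<longlonglongrightarrow> 1"
      using tendsto_diff[OF tendsto_const lim0[of "2 * real l"], of 1] by simp
    show "\<forall>\<^sub>F K in sequentially. 1 - 2 * real l / real (K + 2 * l) = real K / real (K + 2 * l)"
      by (rule eventually_sequentiallyI[of 1]) (simp add: field_simps)
  qed
  moreover have "(\<lambda>K. (l2norm M (\<lambda>\<omega>. (\<Sum>i\<in>{1..K}. Z (int i) \<omega>) / sqrt (real K)))\<^sup>2)
      \<longlonglongrightarrow> (sqrt (\<Sum>\<^sub>\<infinity>k. \<gamma> k))\<^sup>2"
    by (intro tendsto_power l2norm_mean_sum_tendsto(1) Z_L2 Z_covariance \<gamma>_summable)
  ultimately have "(\<lambda>K. real K / real (K + 2 * l) * (l2norm M (\<lambda>\<omega>. (\<Sum>i\<in>{1..K}. Z (int i) \<omega>) / sqrt (real K)))\<^sup>2)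
      \<longlonglongrightarrow> 1 * (sqrt (\<Sum>\<^sub>\<infinity>k. \<gamma> k))\<^sup>2"
    by (rule tendsto_mult)
  moreover have "real K / real (K + 2 * l) * (l2norm M (\<lambda>\<omega>. (\<Sum>i\<in>{1..K}. Z (int i) \<omega>) / sqrt (real K)))\<^sup>2 = s K" for K
    using l2norm_cmult[of M "1 / sqrt (real K)" "\<lambda>\<omega>. \<Sum>i\<in>{1..K}. Z (int i) \<omega>"]
      l2norm_cmult[of M "1 / sqrt (real (K + 2 * l))" "\<lambda>\<omega>. \<Sum>i\<in>{1..K}. Z (int i) \<omega>"]
    by (cases "K = 0") (auto simp: s_def power_mult_distrib power_divide)
  moreover have "0 \<le> (\<Sum>\<^sub>\<infinity>k. \<gamma> k)"
    by (rule l2norm_mean_sum_tendsto(2)[OF Z_L2 Z_covariance \<gamma>_summable])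
  ultimately have "s \<longlonglongrightarrow> (\<Sum>\<^sub>\<infinity>k. \<gamma> k)"
    by simp
  then show "(\<lambda>K. s (Suc K)) \<longlonglongrightarrow> (\<Sum>\<^sub>\<infinity>k. \<gamma> k)"
    by (rule LIMSEQ_Suc)
qed

end

section \<open>Approximation of the U-statistic by finite windows\<close>

definition pairs :: "nat \<Rightarrow> (nat \<times> nat) set" where
  "pairs n = {(i, j). 1 \<le> i \<and> i < j \<and> j \<le> n}"

lemma pairs_subset: "pairs n \<subseteq> {1..n} \<times> {1..n}"
  by (auto simp: pairs_def)

lemma finite_pairs [simp]: "finite (pairs n)"
  by (rule finite_subset[OF pairs_subset]) simp

lemma card_pairs: "card (pairs n) \<le> n * n"
  using card_mono[OF _ pairs_subset, of n] by simp

text \<open>\<open>t l\<close> is a real upper bound standing for \<theta>_{l,2}. As in the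
  coefficients, the hypotheses concern pairs (0, j) with j >= 0; symmetry of h and stationarity
  extend them to all pairs. X itself enters later, through limits of the windowed kernels.\<close>

locale ustat = iid_process +
  fixes h :: "real \<Rightarrow> real \<Rightarrow> real" and F :: "nat \<Rightarrow> (int \<Rightarrow> real) \<Rightarrow> real" and t :: "nat \<Rightarrow> real"
  assumes h_meas [measurable]: "case_prod h \<in> borel_measurable (borel \<Otimes>\<^sub>M borel)"
    and h_sym: "h x y = h y x"
    and F_meas [measurable]: "F l \<in> borel_measurable (window_space l)"
    and kernel_0: "kernel_approx e h F (int j) 0 \<in> L2 M"
    and kernel_step_L2: "(\<lambda>\<omega>. kernel_approx e h F (int j) (Suc l) \<omega> - kernel_approx e h F (int j) l \<omega>) \<in> L2 M"
    and kernel_step: "l2norm M (\<lambda>\<omega>. kernel_approx e h F (int j) (Suc l) \<omega>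
      - kernel_approx e h F (int j) l \<omega>) \<le> t (Suc l)"
    and kernel_0_norm: "l2norm M (kernel_approx e h F (int j) 0) \<le> t 0"
    and t_summable: "summable (\<lambda>l. sqrt (real l) * t l)"
begin

lemma t_nonneg: "0 \<le> t l"
  using order_trans[OF l2norm_nonneg kernel_0_norm] order_trans[OF l2norm_nonneg kernel_step]
  by (cases l) auto

definition ker :: "nat \<Rightarrow> int \<Rightarrow> int \<Rightarrow> 'a \<Rightarrow> real" where
  "ker l i j \<omega> = h (F l (window e i l \<omega>)) (F l (window e j l \<omega>))"

lemma ker_sym: "ker l i j = ker l j i"
  unfolding ker_def by (subst h_sym) (rule refl)

lemma ker_measurable [measurable]: "ker l i j \<in> borel_measurable M"
  unfolding ker_def by measurable

definition seq_ker :: "nat \<Rightarrow> int \<Rightarrow> (int \<Rightarrow> real) \<Rightarrow> real" where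
  "seq_ker l k x = h (F l (seq_window 0 l x)) (F l (seq_window k l x))"

lemma seq_ker_measurable [measurable]: "seq_ker l k \<in> borel_measurable seq_space"
  unfolding seq_ker_def by measurable

lemma ker_shift: "ker l i j = (\<lambda>\<omega>. seq_ker l (j - i) (shift i \<omega>))"
  using window_shift[of i 0] window_shift[of i "j - i"] by (simp add: ker_def[abs_def] seq_ker_def)

lemma kernel_approx_eq: "kernel_approx e h F j l = (\<lambda>\<omega>. seq_ker l j (shift 0 \<omega>))"
  using ker_shift[of l 0 j] by (simp add: kernel_approx_def[abs_def] ker_def[abs_def])

text \<open>By symmetry of the kernel i <= j may be assumed, and a shift by i turns the pair into
  (0, j - i).\<close>

lemma ker_0:
  "ker 0 i j \<in> L2 M" "l2norm M (ker 0 i j) \<le> t 0"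
proof -
  have "ker 0 i j \<in> L2 M \<and> l2norm M (ker 0 i j) \<le> t 0"
  proof (rule linorder_wlog[of "\<lambda>i j. ker 0 i j \<in> L2 M \<and> l2norm M (ker 0 i j) \<le> t 0"])
    fix i j :: int assume "i \<le> j"
    then obtain k where k: "j - i = int k"
      by (intro that[of "nat (j - i)"]) simp
    show "ker 0 i j \<in> L2 M \<and> l2norm M (ker 0 i j) \<le> t 0"
      unfolding ker_shift k using kernel_0[of k] kernel_0_norm[of k]
        l2norm_stationary[OF seq_ker_measurable, of 0 "int k" i]
      by (auto simp: kernel_approx_eq intro: L2_stationary)
  qed (simp add: ker_sym[of 0])
  then show "ker 0 i j \<in> L2 M" "l2norm M (ker 0 i j) \<le> t 0"
    by auto
qed

lemma ker_step:
  "(\<lambda>\<omega>. ker (Suc l) i j \<omega> - ker l i j \<omega>) \<in> L2 M"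
  "l2norm M (\<lambda>\<omega>. ker (Suc l) i j \<omega> - ker l i j \<omega>) \<le> t (Suc l)"
proof -
  let ?P = "\<lambda>i j. (\<lambda>\<omega>. ker (Suc l) i j \<omega> - ker l i j \<omega>) \<in> L2 M
    \<and> l2norm M (\<lambda>\<omega>. ker (Suc l) i j \<omega> - ker l i j \<omega>) \<le> t (Suc l)"
  have "?P i j"
  proof (rule linorder_wlog[of ?P])
    fix i j :: int assume "i \<le> j"
    then obtain k where k: "j - i = int k"
      by (intro that[of "nat (j - i)"]) simp
    have [measurable]: "(\<lambda>x. seq_ker (Suc l) (int k) x - seq_ker l (int k) x) \<in> borel_measurable seq_space"
      by measurable
    show "?P i j"
      unfolding ker_shift k
      using L2_stationary[of "\<lambda>x. seq_ker (Suc l) (int k) x - seq_ker l (int k) x" i]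
        kernel_step_L2[of k l] kernel_step[of k l]
        l2norm_stationary[of "\<lambda>x. seq_ker (Suc l) (int k) x - seq_ker l (int k) x" i]
      by (auto simp: kernel_approx_eq)
  next
    fix i j assume "?P i j"
    then show "?P j i"
      unfolding ker_sym[of _ j i] .
  qed
  then show "(\<lambda>\<omega>. ker (Suc l) i j \<omega> - ker l i j \<omega>) \<in> L2 M"
    "l2norm M (\<lambda>\<omega>. ker (Suc l) i j \<omega> - ker l i j \<omega>) \<le> t (Suc l)"
    by auto
qed

lemma ker_L2: "ker l i j \<in> L2 M" and ker_norm: "l2norm M (ker l i j) \<le> (\<Sum>k\<le>l. t k)"
proof -
  have "ker l i j \<in> L2 M \<and> l2norm M (ker l i j) \<le> (\<Sum>k\<le>l. t k)"
  proof (induction l)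
    case 0
    then show ?case
      using ker_0 by simp
  next
    case (Suc l)
    then have L2: "ker l i j \<in> L2 M" and norm: "l2norm M (ker l i j) \<le> (\<Sum>k\<le>l. t k)"
      by auto
    have "ker (Suc l) i j \<in> L2 M"
      using L2_add[OF ker_step(1)[of l i j] L2] by simp
    moreover have "l2norm M (ker (Suc l) i j) \<le> t (Suc l) + (\<Sum>k\<le>l. t k)"
      using l2norm_add[OF ker_step(1)[of l i j] L2] ker_step(2)[of l i j] norm by simp
    ultimately show ?case
      by simp
  qed
  then show "ker l i j \<in> L2 M" "l2norm M (ker l i j) \<le> (\<Sum>k\<le>l. t k)"
    by auto
qed

text \<open>Bounds the step from level l to l + 1 after division by n^{3/2}. The 5 is the root of
  25: for m = l + 1 a pair has at most 4 (4m + 1) n <= 25 m n correlated partners, there being four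
  ways for an index of one pair to be near an index of the other, each with at most 4m + 1
  positions.\<close>

definition dstep :: "nat \<Rightarrow> real" where
  "dstep l = 5 * (sqrt (real (Suc l)) * t (Suc l))"

lemma dstep_nonneg: "0 \<le> dstep l"
  by (simp add: dstep_def t_nonneg)

lemma dstep_summable: "summable dstep"
  unfolding dstep_def using t_summable by (intro summable_mult) (subst summable_Suc_iff)

lemma t_le_dstep: "t (Suc l) \<le> dstep l"
proof -
  have "1 * t (Suc l) \<le> (5 * sqrt (real (Suc l))) * t (Suc l)"
    by (intro mult_right_mono t_nonneg) (simp add: real_le_rsqrt order_trans[of 1 "sqrt (real (Suc l))"])
  then show ?thesis
    by (simp add: dstep_def)
qed

lemma t_Suc_summable: "summable (\<lambda>l. t (Suc l))"
  by (rule summable_comparison_test'[OF dstep_summable, of 0]) (use t_nonneg t_le_dstep in auto)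

text \<open>The distance left from level l to the limit, uniform in n, for the statistic and for the
  projection sums alike.\<close>

definition tail :: "nat \<Rightarrow> real" where
  "tail l = (\<Sum>i. dstep (i + l))"

lemma tail_tendsto: "tail \<longlonglongrightarrow> 0"
  unfolding tail_def by (rule suminf_exist_split2[OF dstep_summable])

section \<open>Cost of one level of window approximation\<close>

definition cker :: "nat \<Rightarrow> int \<Rightarrow> int \<Rightarrow> 'a \<Rightarrow> real" where
  "cker l i j \<omega> = ker l i j \<omega> - expectation (ker l i j)"

lemma cker_L2: "cker l i j \<in> L2 M"
  unfolding cker_def[abs_def] by (rule L2_center[OF ker_L2])

definition U :: "nat \<Rightarrow> nat \<Rightarrow> 'a \<Rightarrow> real" where
  "U l n \<omega> = (\<Sum>(i, j)\<in>pairs n. cker l (int i) (int j) \<omega>)"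

lemma U_L2: "U l n \<in> L2 M"
  unfolding U_def[abs_def] by (intro L2_sum) (auto intro: cker_L2)

lemma cker_step_eq:
  "cker (Suc l) i j \<omega> - cker l i j \<omega>
    = (ker (Suc l) i j \<omega> - ker l i j \<omega>) - expectation (\<lambda>\<omega>. ker (Suc l) i j \<omega> - ker l i j \<omega>)"
  by (simp add: cker_def L2_integrable[OF ker_L2])

lemma cker_step:
  "l2norm M (\<lambda>\<omega>. cker (Suc l) i j \<omega> - cker l i j \<omega>) \<le> t (Suc l)"
  unfolding cker_step_eq by (rule order_trans[OF l2norm_center[OF ker_step(1)] ker_step(2)])

lemma ker_determined:
  assumes "{i - int l..i + int l} \<subseteq> A" "{j - int l..j + int l} \<subseteq> A"
  shows "determined A borel (ker l i j)"
proof -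
  have "determined A borel (\<lambda>\<omega>. F l (window e i l \<omega>))"
    by (rule determined_compose[OF window_determined[OF assms(1)] F_meas])
  moreover have "determined A borel (\<lambda>\<omega>. F l (window e j l \<omega>))"
    by (rule determined_compose[OF window_determined[OF assms(2)] F_meas])
  ultimately have "determined A (borel \<Otimes>\<^sub>M borel) (\<lambda>\<omega>. (F l (window e i l \<omega>), F l (window e j l \<omega>)))"
    by (rule determined_Pair)
  from determined_compose[OF this h_meas] show ?thesis
    by (simp add: ker_def[abs_def])
qed

text \<open>Each difference reads only the noise around its two centres. No degeneracy is available
  here, so both centres of one pair are taken far from both centres of the other; the distance
  within a pair is free.\<close>

lemma cker_step_uncorrelated:
  assumes "2 * int (Suc l) < \<bar>i - i'\<bar>" "2 * int (Suc l) < \<bar>i - j'\<bar>"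
    "2 * int (Suc l) < \<bar>j - i'\<bar>" "2 * int (Suc l) < \<bar>j - j'\<bar>"
  shows "expectation (\<lambda>\<omega>. (cker (Suc l) i j \<omega> - cker l i j \<omega>)
    * (cker (Suc l) i' j' \<omega> - cker l i' j' \<omega>)) = 0"
proof -
  define N where "N i = {i - int (Suc l)..i + int (Suc l)}" for i
  have det: "determined (N i \<union> N j) borel (\<lambda>\<omega>. cker (Suc l) i j \<omega> - cker l i j \<omega>)" for i j
  proof -
    have *: "determined (N i \<union> N j) borel (ker (Suc l) i j)" "determined (N i \<union> N j) borel (ker l i j)"
      by (intro ker_determined; auto simp: N_def)+
    have "(\<lambda>(a, b). a - b - expectation (\<lambda>\<omega>. ker (Suc l) i j \<omega> - ker l i j \<omega>))
        \<in> borel_measurable (borel \<Otimes>\<^sub>M borel)"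
      by measurable
    from determined_compose[OF determined_Pair[OF *] this] show ?thesis
      by (simp add: cker_step_eq)
  qed
  have mean: "expectation (\<lambda>\<omega>. cker (Suc l) i j \<omega> - cker l i j \<omega>) = 0" for i j
    unfolding cker_step_eq using L2_integrable[OF ker_step(1)[of l i j]] by (simp add: prob_space)
  have "(N i \<union> N j) \<inter> (N i' \<union> N j') = {}"
    using assms by (auto simp: N_def)
  moreover have "integrable M (\<lambda>\<omega>. cker (Suc l) i j \<omega> - cker l i j \<omega>)" for i j
    by (intro L2_integrable L2_diff cker_L2)
  ultimately show ?thesis
    by (subst determined_expectation_mult[OF det[of i j] det[of i' j']]) (simp_all add: mean)
qed

lemma near_card: "card {k. \<not> 2 * int m < \<bar>int i - int k\<bar>} \<le> 4 * m + 1"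
  and near_finite: "finite {k. \<not> 2 * int m < \<bar>int i - int k\<bar>}"
proof -
  have sub: "{k. \<not> 2 * int m < \<bar>int i - int k\<bar>} \<subseteq> {i - 2 * m..i + 2 * m}"
    by auto
  then show "finite {k. \<not> 2 * int m < \<bar>int i - int k\<bar>}"
    by (rule finite_subset) simp
  show "card {k. \<not> 2 * int m < \<bar>int i - int k\<bar>} \<le> 4 * m + 1"
    using card_mono[OF _ sub] by simp
qed

text \<open>A summand is correlated only with those pairs that share a nearby index, and there are
  at most of order \<open>l * n\<close> of them; this produces the weight \<open>sqrt l\<close> in front of
  the dependence coefficient.\<close>
lemma U_step: "l2norm M (\<lambda>\<omega>. U (Suc l) n \<omega> - U l n \<omega>) \<le> dstep l * (real n * sqrt (real n))"
proof -
  define m where "m = Suc l"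
  define D where "D = (\<lambda>(i, j) \<omega>. cker (Suc l) (int i) (int j) \<omega> - cker l (int i) (int j) \<omega>)"
  define near where "near i = {k. \<not> 2 * int m < \<bar>int i - int k\<bar>}" for i :: nat
  have near: "finite (near i)" "card (near i) \<le> 4 * m + 1" for i
    unfolding near_def by (rule near_finite near_card)+
  have card: "card {b \<in> pairs n. expectation (\<lambda>\<omega>. D a \<omega> * D b \<omega>) \<noteq> 0} \<le> 4 * ((4 * m + 1) * n)"
    if "a \<in> pairs n" for a
  proof -
    obtain i j where a: "a = (i, j)"
      by (cases a)
    \<comment> \<open>Once one index of b is near one of a, the other index of b is free in
      {1..n}.\<close>
    have "{b \<in> pairs n. expectation (\<lambda>\<omega>. D a \<omega> * D b \<omega>) \<noteq> 0}
        \<subseteq> (near i \<times> {1..n} \<union> near j \<times> {1..n}) \<union> ({1..n} \<times> near i \<union> {1..n} \<times> near j)"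
    proof
      fix b assume b: "b \<in> {b \<in> pairs n. expectation (\<lambda>\<omega>. D a \<omega> * D b \<omega>) \<noteq> 0}"
      obtain i' j' where b': "b = (i', j')"
        by (cases b)
      have "i' \<in> {1..n}" "j' \<in> {1..n}"
        using b b' by (auto simp: pairs_def)
      moreover have "i' \<in> near i \<or> j' \<in> near i \<or> i' \<in> near j \<or> j' \<in> near j"
      proof (rule ccontr)
        assume "\<not> (i' \<in> near i \<or> j' \<in> near i \<or> i' \<in> near j \<or> j' \<in> near j)"
        then have "expectation (\<lambda>\<omega>. D a \<omega> * D b \<omega>) = 0"
          using cker_step_uncorrelated[of l "int i" "int i'" "int j'" "int j"]
          by (simp add: D_def a b' near_def m_def)
        with b show False
          by simp
      qed
      ultimately show "b \<in> (near i \<times> {1..n} \<union> near j \<times> {1..n}) \<union> ({1..n} \<times> near i \<union> {1..n} \<times> near j)"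
        using b' by auto
    qed
    then have "card {b \<in> pairs n. expectation (\<lambda>\<omega>. D a \<omega> * D b \<omega>) \<noteq> 0}
        \<le> card ((near i \<times> {1..n} \<union> near j \<times> {1..n}) \<union> ({1..n} \<times> near i \<union> {1..n} \<times> near j))"
      by (rule card_mono[rotated]) (simp add: near)
    also have "\<dots> \<le> (card (near i \<times> {1..n}) + card (near j \<times> {1..n}))
        + (card ({1..n} \<times> near i) + card ({1..n} \<times> near j))"
      by (intro order_trans[OF card_Un_le] add_mono card_Un_le)
    also have "\<dots> = card (near i) * n + card (near j) * n + (card (near i) * n + card (near j) * n)"
      by (simp add: card_cartesian_product mult.commute)
    also have "\<dots> \<le> (4 * m + 1) * n + (4 * m + 1) * n + ((4 * m + 1) * n + (4 * m + 1) * n)"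
      by (intro add_mono mult_right_mono near) auto
    finally show ?thesis
      by simp
  qed
  have "(l2norm M (\<lambda>\<omega>. \<Sum>a\<in>pairs n. D a \<omega>))\<^sup>2
      \<le> (t m)\<^sup>2 * real (4 * ((4 * m + 1) * n)) * real (card (pairs n))"
  proof (rule l2norm_sum_sparse)
    show "D a \<in> L2 M" for a
      by (auto simp: D_def split: prod.split intro: L2_diff cker_L2)
    show "l2norm M (D a) \<le> t m" for a
      by (auto simp: D_def m_def cker_step split: prod.split)
  qed (use card in auto)
  also have "\<dots> \<le> (t m)\<^sup>2 * real (25 * m * n) * real (n * n)"
  proof -
    have "4 * (4 * m + 1) \<le> 25 * m"
      by (simp add: m_def)
    then have "4 * (4 * m + 1) * n \<le> 25 * m * n"
      by (rule mult_right_mono) simp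
    then have "real (4 * ((4 * m + 1) * n)) \<le> real (25 * m * n)"
      by (intro of_nat_mono) (simp add: mult.assoc)
    moreover have "real (card (pairs n)) \<le> real (n * n)"
      by (intro of_nat_mono card_pairs)
    ultimately show ?thesis
      by (intro mult_mono) auto
  qed
  also have "\<dots> = (dstep l * (real n * sqrt (real n)))\<^sup>2"
    by (simp add: dstep_def m_def[symmetric] power_mult_distrib) (simp add: power2_eq_square)
  finally have "l2norm M (\<lambda>\<omega>. \<Sum>a\<in>pairs n. D a \<omega>) \<le> dstep l * (real n * sqrt (real n))"
    by (rule power2_le_imp_le) (simp add: dstep_nonneg)
  moreover have "(\<lambda>\<omega>. U (Suc l) n \<omega> - U l n \<omega>) = (\<lambda>\<omega>. \<Sum>a\<in>pairs n. D a \<omega>)"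
    by (simp add: U_def D_def sum_subtractf split_beta)
  ultimately show ?thesis
    by simp
qed

end

section \<open>Hoeffding decomposition\<close>

lemma sum_pairs_Suc:
  fixes a :: "nat \<Rightarrow> nat \<Rightarrow> real"
  shows "(\<Sum>(i, j)\<in>pairs (Suc n). a i j) = (\<Sum>(i, j)\<in>pairs n. a i j) + (\<Sum>i\<in>{1..n}. a i (Suc n))"
proof -
  have "pairs (Suc n) = pairs n \<union> (\<lambda>i. (i, Suc n)) ` {1..n}"
    by (auto simp: pairs_def)
  moreover have "pairs n \<inter> (\<lambda>i. (i, Suc n)) ` {1..n} = {}"
    by (auto simp: pairs_def)
  ultimately have "(\<Sum>(i, j)\<in>pairs (Suc n). a i j)
      = (\<Sum>(i, j)\<in>pairs n. a i j) + (\<Sum>(i, j)\<in>(\<lambda>i. (i, Suc n)) ` {1..n}. a i j)"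
    by (simp add: sum.union_disjoint)
  also have "(\<Sum>(i, j)\<in>(\<lambda>i. (i, Suc n)) ` {1..n}. a i j) = (\<Sum>i\<in>{1..n}. a i (Suc n))"
    by (subst sum.reindex) (auto simp: inj_on_def)
  finally show ?thesis .
qed

text \<open>Each index lies in n - 1 pairs.\<close>

lemma sum_pairs_add:
  fixes y :: "nat \<Rightarrow> real"
  shows "(\<Sum>(i, j)\<in>pairs n. y i + y j) = (real n - 1) * (\<Sum>i\<in>{1..n}. y i)"
proof (induction n)
  case 0
  have "pairs 0 = {}"
    by (auto simp: pairs_def)
  then show ?case
    by simp
next
  case (Suc n)
  show ?case
    unfolding sum_pairs_Suc Suc by (simp add: sum.distrib algebra_simps)
qed

context ustat
begin

text \<open>First projection of the kernel, as a function of a real argument. For r with h(r,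
  f_l(V_0)) not integrable it has the default value 0, which \<open>R_degenerate\<close> has to
  accommodate.\<close>

definition G :: "nat \<Rightarrow> real \<Rightarrow> real" where
  "G l r = expectation (\<lambda>\<omega>. h r (F l (window e 0 l \<omega>)))"

lemma G_measurable [measurable]: "G l \<in> borel_measurable borel"
  unfolding G_def by (rule borel_measurable_lebesgue_integral) measurable

lemma expectation_h_window: "expectation (\<lambda>\<omega>. h r (F l (window e j l \<omega>))) = G l r"
  using expectation_stationary[of "\<lambda>x. h r (F l (seq_window 0 l x))" j]
    window_shift[of j 0 l] window_shift[of 0 0 l]
  by (simp add: G_def)

definition g :: "nat \<Rightarrow> int \<Rightarrow> 'a \<Rightarrow> real" where
  "g l i \<omega> = G l (F l (window e i l \<omega>))"

lemma g_measurable [measurable]: "g l i \<in> borel_measurable M"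
  unfolding g_def by measurable

text \<open>The index j = i + 2l + 1 is the first to the right whose window misses that of i. The
  window at j thus plays the part of an independent copy, and the moment bound for the pair (i, j)
  passes to the projection by contraction.\<close>

lemma g_L2: "g l i \<in> L2 M" and g_norm: "l2norm M (g l i) \<le> (\<Sum>k\<le>l. t k)"
proof -
  define j where "j = i + 2 * int l + 1"
  have ind: "indep_pair (window_space l) (window e i l) (window_space l) (window e j l)"
    by (rule windows_indep) (simp add: j_def)
  have \<phi>: "case_prod (\<lambda>x y. h (F l x) (F l y)) \<in> borel_measurable (window_space l \<Otimes>\<^sub>M window_space l)"
    by measurable
  have "(\<lambda>\<omega>. h (F l (window e i l \<omega>)) (F l (window e j l \<omega>))) \<in> L2 M"
    using ker_L2[of l i j] by (simp add: ker_def[abs_def])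
  note part = L2_partial_expectation[where \<phi>="\<lambda>x y. h (F l x) (F l y)", OF ind \<phi> this]
  have eq: "(\<lambda>x. \<integral>y. h (F l (window e i l x)) (F l (window e j l y)) \<partial>M) = g l i"
    unfolding expectation_h_window g_def[abs_def] ..
  show "g l i \<in> L2 M"
    using part(1) unfolding eq .
  show "l2norm M (g l i) \<le> (\<Sum>k\<le>l. t k)"
    using part(2) ker_norm[of l i j] unfolding eq by (simp add: ker_def[abs_def])
qed

definition cc :: "nat \<Rightarrow> real" where
  "cc l = expectation (g l 0)"

lemma g_mean: "expectation (g l i) = cc l"
  using expectation_stationary[of "\<lambda>x. G l (F l (seq_window 0 l x))" i]
    window_shift[of i 0 l] window_shift[of 0 0 l]
  by (simp add: cc_def g_def[abs_def])

definition Yl :: "nat \<Rightarrow> int \<Rightarrow> 'a \<Rightarrow> real" where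
  "Yl l i \<omega> = g l i \<omega> - cc l"

lemma Yl_L2: "Yl l i \<in> L2 M"
  unfolding Yl_def[abs_def] by (intro L2_diff g_L2 L2_const)

lemma Yl_mean: "expectation (Yl l i) = 0"
  unfolding Yl_def[abs_def] using L2_integrable[OF g_L2[of l i]] by (simp add: g_mean prob_space)

lemma Yl_process: "window_process M e (\<lambda>x. G l (F l x) - cc l) l"
proof
  show "(\<lambda>x. G l (F l x) - cc l) \<in> borel_measurable (window_space l)"
    by measurable
  show "(\<lambda>\<omega>. G l (F l (window e 0 l \<omega>)) - cc l) \<in> L2 M"
    using Yl_L2[of l 0] by (simp add: Yl_def[abs_def] g_def)
  show "expectation (\<lambda>\<omega>. G l (F l (window e 0 l \<omega>)) - cc l) = 0"
    using Yl_mean[of l 0] by (simp add: Yl_def[abs_def] g_def)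
qed

definition cov :: "nat \<Rightarrow> int \<Rightarrow> real" where
  "cov l k = expectation (\<lambda>\<omega>. Yl l 0 \<omega> * Yl l k \<omega>)"

lemma Yl_covariance: "expectation (\<lambda>\<omega>. Yl l i \<omega> * Yl l j \<omega>) = cov l (j - i)"
  and cov_summable: "(\<lambda>k. \<bar>cov l k\<bar>) summable_on UNIV"
  and Yl_clt: "clt M (\<lambda>n \<omega>. (\<Sum>i\<in>{1..n}. Yl l (int i) \<omega>) / sqrt (real n)) (\<Sum>\<^sub>\<infinity>k. cov l k)"
proof -
  interpret W: window_process M e "\<lambda>x. G l (F l x) - cc l" l
    by (rule Yl_process)
  have Z: "W.Z = Yl l"
    by (simp add: fun_eq_iff W.Z_def Yl_def g_def)
  then have \<gamma>: "W.\<gamma> = cov l"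
    by (simp add: fun_eq_iff W.\<gamma>_def cov_def)
  show "expectation (\<lambda>\<omega>. Yl l i \<omega> * Yl l j \<omega>) = cov l (j - i)"
    using W.Z_covariance[of i j] unfolding Z \<gamma> .
  show "(\<lambda>k. \<bar>cov l k\<bar>) summable_on UNIV"
    using W.\<gamma>_summable unfolding \<gamma> .
  show "clt M (\<lambda>n \<omega>. (\<Sum>i\<in>{1..n}. Yl l (int i) \<omega>) / sqrt (real n)) (\<Sum>\<^sub>\<infinity>k. cov l k)"
    using W.Z_clt unfolding Z \<gamma> .
qed

text \<open>The difference of two projections is almost everywhere the projection of the kernel
  difference, so contraction yields the bound on the kernels. Both kernels are read from disjoint
  windows of radius l + 1.\<close>

lemma Yl_step: "l2norm M (\<lambda>\<omega>. Yl (Suc l) i \<omega> - Yl l i \<omega>) \<le> t (Suc l)"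
proof -
  define r where "r x = restrict x {- int l..int l}" for x :: "int \<Rightarrow> real"
  have [measurable]: "r \<in> measurable (window_space (Suc l)) (window_space l)"
    unfolding r_def[abs_def] by (rule restrict_window_measurable)
  define j where "j = i + 2 * int (Suc l) + 1"
  have ind: "indep_pair (window_space (Suc l)) (window e i (Suc l)) (window_space (Suc l)) (window e j (Suc l))"
    by (rule windows_indep) (simp add: j_def)
  define \<phi>1 \<phi>2 where "\<phi>1 x y = h (F (Suc l) x) (F (Suc l) y)" and "\<phi>2 x y = h (F l (r x)) (F l (r y))" for x y
  have [measurable]: "case_prod \<phi>1 \<in> borel_measurable (window_space (Suc l) \<Otimes>\<^sub>M window_space (Suc l))"
    "case_prod \<phi>2 \<in> borel_measurable (window_space (Suc l) \<Otimes>\<^sub>M window_space (Suc l))"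
    unfolding \<phi>1_def \<phi>2_def by measurable
  have \<phi>: "case_prod (\<lambda>x y. \<phi>1 x y - \<phi>2 x y) \<in> borel_measurable (window_space (Suc l) \<Otimes>\<^sub>M window_space (Suc l))"
    by measurable
  have rw: "r (window e k (Suc l) \<omega>) = window e k l \<omega>" for k \<omega>
    unfolding r_def window_Suc[symmetric] ..
  have eq1: "\<phi>1 (window e i (Suc l) x) (window e j (Suc l) x) = ker (Suc l) i j x"
    and eq2: "\<phi>2 (window e i (Suc l) x) (window e j (Suc l) x) = ker l i j x" for x
    by (simp_all add: \<phi>1_def \<phi>2_def rw ker_def)
  have "(\<lambda>x. \<phi>1 (window e i (Suc l) x) (window e j (Suc l) x)
      - \<phi>2 (window e i (Suc l) x) (window e j (Suc l) x)) \<in> L2 M"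
    unfolding eq1 eq2 by (rule ker_step)
  note part = L2_partial_expectation[where \<phi>="\<lambda>x y. \<phi>1 x y - \<phi>2 x y", OF ind \<phi> this]
  have "AE x in M. integrable M (\<lambda>y. \<phi>1 (window e i (Suc l) x) (window e j (Suc l) y))"
    by (rule indep_pair_Fubini(1)[OF ind]) (simp_all add: eq1 L2_integrable ker_L2)
  moreover have "AE x in M. integrable M (\<lambda>y. \<phi>2 (window e i (Suc l) x) (window e j (Suc l) y))"
    by (rule indep_pair_Fubini(1)[OF ind]) (simp_all add: eq2 L2_integrable ker_L2)
  \<comment> \<open>The integral of the difference splits where both sections are integrable, which
    is almost everywhere.\<close>
  ultimately have AE: "AE x in M. (\<integral>y. \<phi>1 (window e i (Suc l) x) (window e j (Suc l) y)
      - \<phi>2 (window e i (Suc l) x) (window e j (Suc l) y) \<partial>M) = g (Suc l) i x - g l i x"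
  proof eventually_elim
    case (elim x)
    then show ?case
      by (simp add: Bochner_Integration.integral_diff) (simp add: \<phi>1_def \<phi>2_def rw expectation_h_window g_def)
  qed
  have "l2norm M (\<lambda>x. g (Suc l) i x - g l i x) \<le> t (Suc l)"
    using part(2) ker_step(2)[of l i j] l2norm_AE_cong[OF AE L2_measurable[OF part(1)]]
    unfolding eq1 eq2 by simp
  moreover have "Yl (Suc l) i \<omega> - Yl l i \<omega> = (g (Suc l) i \<omega> - g l i \<omega>)
      - expectation (\<lambda>\<omega>. g (Suc l) i \<omega> - g l i \<omega>)" for \<omega>
    by (simp add: Yl_def L2_integrable[OF g_L2] g_mean)
  ultimately show ?thesis
    using l2norm_center[OF L2_diff[OF g_L2 g_L2], of "Suc l" i l i] by simp
qed

text \<open>Differences of projections have dependence range 2(l + 1), hence at most 4(l + 1) + 1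
  correlated partners each. The generous bound 25(l + 1) lets the same \<open>dstep\<close> serve
  here and for the statistic.\<close>

lemma Yl_sum_step:
  "l2norm M (\<lambda>\<omega>. (\<Sum>i\<in>{1..n}. Yl (Suc l) (int i) \<omega>) - (\<Sum>i\<in>{1..n}. Yl l (int i) \<omega>))
    \<le> dstep l * sqrt (real n)"
proof -
  define \<Phi> where "\<Phi> x = (G (Suc l) (F (Suc l) x) - cc (Suc l))
    - (G l (F l (restrict x {- int l..int l})) - cc l)" for x
  have eq: "\<Phi> (window e i (Suc l) \<omega>) = Yl (Suc l) i \<omega> - Yl l i \<omega>" for i \<omega>
    by (simp add: \<Phi>_def Yl_def g_def flip: window_Suc)
  interpret W: window_process M e \<Phi> "Suc l"
  proof
    show "\<Phi> \<in> borel_measurable (window_space (Suc l))"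
      unfolding \<Phi>_def[abs_def] by measurable
    show "(\<lambda>\<omega>. \<Phi> (window e 0 (Suc l) \<omega>)) \<in> L2 M"
      unfolding eq by (intro L2_diff Yl_L2)
    show "expectation (\<lambda>\<omega>. \<Phi> (window e 0 (Suc l) \<omega>)) = 0"
      unfolding eq using L2_integrable[OF Yl_L2] by (simp add: Yl_mean)
  qed
  have Z: "W.Z i \<omega> = Yl (Suc l) i \<omega> - Yl l i \<omega>" for i \<omega>
    by (simp add: W.Z_def eq)
  have "l2norm M (W.Z 0) \<le> t (Suc l)"
    using Yl_step[of l 0] by (simp add: Z[abs_def])
  have "(l2norm M (\<lambda>\<omega>. \<Sum>i\<in>{1..n}. W.Z (int i) \<omega>))\<^sup>2
      \<le> (l2norm M (W.Z 0))\<^sup>2 * (4 * real (Suc l) + 1) * real (card {1..n})"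
    by (rule W.l2norm_sum_Z) simp
  also have "\<dots> \<le> (t (Suc l))\<^sup>2 * (25 * real (Suc l)) * real n"
    using \<open>l2norm M (W.Z 0) \<le> t (Suc l)\<close> by (intro mult_mono power_mono) auto
  also have "\<dots> = (dstep l * sqrt (real n))\<^sup>2"
    by (simp add: dstep_def power_mult_distrib)
  finally have "l2norm M (\<lambda>\<omega>. \<Sum>i\<in>{1..n}. W.Z (int i) \<omega>) \<le> dstep l * sqrt (real n)"
    by (rule power2_le_imp_le) (simp add: dstep_nonneg)
  then show ?thesis
    by (simp add: Z sum_subtractf)
qed

text \<open>The Hoeffding remainder. For disjoint windows it is degenerate and centred; for
  overlapping windows its mean need not vanish, whence the centred \<open>cR\<close> below.\<close>

definition R :: "nat \<Rightarrow> int \<Rightarrow> int \<Rightarrow> 'a \<Rightarrow> real" where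
  "R l i j \<omega> = ker l i j \<omega> - g l i \<omega> - g l j \<omega> + cc l"

lemma R_sym: "R l i j = R l j i"
  by (simp add: fun_eq_iff R_def ker_sym[of l i j])

lemma R_L2: "R l i j \<in> L2 M"
  unfolding R_def[abs_def] by (intro L2_add L2_diff ker_L2 g_L2 L2_const)

text \<open>Triangle inequality over the kernel, two projections and a constant. What matters is
  that it is free of i, j and n.\<close>

definition \<rho> :: "nat \<Rightarrow> real" where
  "\<rho> l = 3 * (\<Sum>k\<le>l. t k) + \<bar>cc l\<bar>"

lemma \<rho>_nonneg: "0 \<le> \<rho> l"
  by (simp add: \<rho>_def sum_nonneg t_nonneg)

lemma R_norm: "l2norm M (R l i j) \<le> \<rho> l"
proof -
  have "l2norm M (\<lambda>\<omega>. cc l) = \<bar>cc l\<bar>"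
    by (simp add: l2norm_def prob_space)
  moreover have "l2norm M (R l i j) \<le> l2norm M (\<lambda>\<omega>. ker l i j \<omega> - g l i \<omega> - g l j \<omega>) + l2norm M (\<lambda>\<omega>. cc l)"
    unfolding R_def[abs_def] by (intro l2norm_add L2_diff ker_L2 g_L2 L2_const)
  moreover have "l2norm M (\<lambda>\<omega>. ker l i j \<omega> - g l i \<omega> - g l j \<omega>)
      \<le> l2norm M (\<lambda>\<omega>. ker l i j \<omega> - g l i \<omega>) + l2norm M (g l j)"
    by (intro l2norm_diff L2_diff ker_L2 g_L2)
  moreover have "l2norm M (\<lambda>\<omega>. ker l i j \<omega> - g l i \<omega>) \<le> l2norm M (ker l i j) + l2norm M (g l i)"
    by (intro l2norm_diff ker_L2 g_L2)
  ultimately show ?thesis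
    using ker_norm[of l i j] g_norm[of l i] g_norm[of l j] by (simp add: \<rho>_def)
qed

text \<open>Holds for every r, not just almost every one, so that it can be inserted pointwise under
  the outer integral in \<open>R_orthogonal\<close>.\<close>

lemma R_degenerate:
  "expectation (\<lambda>\<omega>. h r (F l (window e j l \<omega>)) - G l r - g l j \<omega> + cc l) = 0"
proof (cases "integrable M (\<lambda>\<omega>. h r (F l (window e j l \<omega>)))")
  case True
  then show ?thesis
    using L2_integrable[OF g_L2[of l j]] by (simp add: expectation_h_window g_mean prob_space)
next
  case False \<comment> \<open>the integral then takes the junk value 0\<close>
  have "\<not> integrable M (\<lambda>\<omega>. h r (F l (window e j l \<omega>)) - G l r - g l j \<omega> + cc l)"
  proof
    assume "integrable M (\<lambda>\<omega>. h r (F l (window e j l \<omega>)) - G l r - g l j \<omega> + cc l)"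
    then have "integrable M (\<lambda>\<omega>. (h r (F l (window e j l \<omega>)) - G l r - g l j \<omega> + cc l)
        + (G l r + g l j \<omega> - cc l))"
      by (rule Bochner_Integration.integrable_add) (intro Bochner_Integration.integrable_add
          Bochner_Integration.integrable_diff L2_integrable[OF g_L2] integrable_const)
    moreover have "(\<lambda>\<omega>. (h r (F l (window e j l \<omega>)) - G l r - g l j \<omega> + cc l)
        + (G l r + g l j \<omega> - cc l)) = (\<lambda>\<omega>. h r (F l (window e j l \<omega>)))"
      by (simp add: fun_eq_iff)
    ultimately show False
      using False by (simp only:)
  qed
  then show ?thesis
    by (rule not_integrable_integral_eq)
qed

text \<open>Q may depend on any coordinates outside the window of j. Averaging over that window with
  all the rest frozen annihilates the remainder by degeneracy.\<close>

lemma R_orthogonal: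
  assumes Q: "determined A borel Q" "Q \<in> L2 M"
    and i: "{i - int l..i + int l} \<subseteq> A" and j: "A \<inter> {j - int l..j + int l} = {}"
  shows "expectation (\<lambda>\<omega>. Q \<omega> * R l i j \<omega>) = 0"
proof -
  define \<phi> where "\<phi> = (\<lambda>p y. fst p * (h (snd p) (F l y) - G l (snd p) - G l (F l y) + cc l))"
  have "determined A borel (\<lambda>\<omega>. F l (window e i l \<omega>))"
    by (rule determined_compose[OF window_determined[OF i] F_meas])
  from determined_indep[OF determined_Pair[OF Q(1) this] window_determined[OF order_refl] j]
  have ind: "indep_pair (borel \<Otimes>\<^sub>M borel) (\<lambda>\<omega>. (Q \<omega>, F l (window e i l \<omega>))) (window_space l) (window e j l)" .
  have \<phi>: "case_prod \<phi> \<in> borel_measurable ((borel \<Otimes>\<^sub>M borel) \<Otimes>\<^sub>M window_space l)"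
    unfolding \<phi>_def by measurable
  have eq: "\<phi> (Q \<omega>, F l (window e i l \<omega>)) (window e j l \<omega>) = Q \<omega> * R l i j \<omega>" for \<omega>
    by (simp add: \<phi>_def R_def ker_def g_def)
  have "expectation (\<lambda>\<omega>. \<phi> (Q \<omega>, F l (window e i l \<omega>)) (window e j l \<omega>))
      = (\<integral>x. (\<integral>y. \<phi> (Q x, F l (window e i l x)) (window e j l y) \<partial>M) \<partial>M)"
    by (rule indep_pair_Fubini(3)[OF ind \<phi>]) (simp add: eq L2_mult_integrable Q R_L2)
  also have "\<dots> = 0"
    using R_degenerate[of _ l j] by (simp add: \<phi>_def g_def)
  finally show ?thesis
    by (simp add: eq)
qed

lemma determined_const: "c \<in> space N \<Longrightarrow> determined A N (\<lambda>_. c)"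
  unfolding determined_def by (intro bexI[of _ "\<lambda>_. c"]) auto

lemma R_mean:
  assumes "2 * int l < \<bar>i - j\<bar>"
  shows "expectation (R l i j) = 0"
  using R_orthogonal[OF determined_const[of 1] L2_const order_refl, of i l j] assms
  by (force simp: prob_space)

lemma R_determined:
  assumes "{i - int l..i + int l} \<subseteq> A" "{j - int l..j + int l} \<subseteq> A"
  shows "determined A borel (R l i j)"
proof -
  have g: "determined A borel (g l i)" if "{i - int l..i + int l} \<subseteq> A" for i
    unfolding g_def[abs_def]
    by (rule determined_compose[OF determined_compose[OF window_determined[OF that] F_meas] G_measurable])
  have "determined A (borel \<Otimes>\<^sub>M (borel \<Otimes>\<^sub>M borel)) (\<lambda>\<omega>. (ker l i j \<omega>, g l i \<omega>, g l j \<omega>))"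
    by (intro determined_Pair ker_determined g assms)
  moreover have "(\<lambda>(a, b, c). a - b - c + cc l) \<in> borel_measurable (borel \<Otimes>\<^sub>M (borel \<Otimes>\<^sub>M borel))"
    by measurable
  ultimately have "determined A borel (\<lambda>\<omega>. (\<lambda>(a, b, c). a - b - c + cc l) (ker l i j \<omega>, g l i \<omega>, g l j \<omega>))"
    by (rule determined_compose)
  then show ?thesis
    by (simp add: R_def[abs_def])
qed

lemma R_uncorrelated:
  assumes "2 * int l < \<bar>i - j\<bar>" "2 * int l < \<bar>j - i'\<bar>" "2 * int l < \<bar>j - j'\<bar>"
  shows "expectation (\<lambda>\<omega>. R l i' j' \<omega> * R l i j \<omega>) = 0"
proof (rule R_orthogonal[OF R_determined R_L2])
  let ?N = "\<lambda>i. {i - int l..i + int l}"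
  show "?N i' \<subseteq> ?N i \<union> ?N i' \<union> ?N j'" "?N j' \<subseteq> ?N i \<union> ?N i' \<union> ?N j'" "?N i \<subseteq> ?N i \<union> ?N i' \<union> ?N j'"
    by auto
  show "(?N i \<union> ?N i' \<union> ?N j') \<inter> ?N j = {}"
    using assms by auto
qed

text \<open>An extreme index is isolated: if j and j' differ by more than 2l, the larger of them
  exceeds the other three indices by more than 2l; if i and i' do, the smaller of them lies below
  the other three by more than 2l.\<close>

lemma R_far_uncorrelated:
  assumes "i + 2 * int l < j" "i' + 2 * int l < j'"
    and "2 * int l < \<bar>i - i'\<bar> \<or> 2 * int l < \<bar>j - j'\<bar>"
  shows "expectation (\<lambda>\<omega>. R l i j \<omega> * R l i' j' \<omega>) = 0"
proof -
  consider "j' + 2 * int l < j" | "j + 2 * int l < j'" | "i + 2 * int l < i'" | "i' + 2 * int l < i"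
    using assms(3) by linarith
  then show ?thesis
  proof cases
    case 1
    then have "expectation (\<lambda>\<omega>. R l i' j' \<omega> * R l i j \<omega>) = 0"
      using assms by (intro R_uncorrelated) auto
    then show ?thesis
      by (simp add: mult.commute)
  next
    case 2
    then show ?thesis
      using assms by (intro R_uncorrelated) auto
  next
    case 3
    \<comment> \<open>The isolated index is a first argument here; symmetry moves it to the place
      that is averaged out.\<close>
    then have "expectation (\<lambda>\<omega>. R l i' j' \<omega> * R l j i \<omega>) = 0"
      using assms by (intro R_uncorrelated) auto
    then show ?thesis
      by (simp add: mult.commute R_sym[of l i j])
  next
    case 4
    then have "expectation (\<lambda>\<omega>. R l i j \<omega> * R l j' i' \<omega>) = 0"
      using assms by (intro R_uncorrelated) auto
    then show ?thesis
      by (simp add: R_sym[of l i' j'])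
  qed
qed

definition cR :: "nat \<Rightarrow> int \<Rightarrow> int \<Rightarrow> 'a \<Rightarrow> real" where
  "cR l i j \<omega> = R l i j \<omega> - expectation (R l i j)"

lemma cR_L2: "cR l i j \<in> L2 M"
  unfolding cR_def[abs_def] by (rule L2_center[OF R_L2])

lemma cR_norm: "l2norm M (cR l i j) \<le> \<rho> l"
  unfolding cR_def[abs_def] by (rule order_trans[OF l2norm_center[OF R_L2] R_norm])

lemma cker_Hoeffding: "cker l i j \<omega> = cR l i j \<omega> + (Yl l i \<omega> + Yl l j \<omega>)"
proof -
  have "expectation (R l i j) = expectation (ker l i j) - cc l"
    unfolding R_def[abs_def] using L2_integrable[OF ker_L2] L2_integrable[OF g_L2]
    by (simp add: g_mean prob_space)
  then show ?thesis
    by (simp add: cker_def cR_def R_def Yl_def)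
qed

text \<open>There are at most (2l + 1) n pairs with j - i <= 2l, so the triangle inequality suffices
  for them. A far pair correlates with at most (4l + 1)^2 far pairs, out of at most n^2, and the
  root gives (4l + 1) n. The two factors add up to 6l + 2.\<close>

lemma degenerate_norm:
  "l2norm M (\<lambda>\<omega>. \<Sum>(i, j)\<in>pairs n. cR l (int i) (int j) \<omega>) \<le> \<rho> l * (6 * real l + 2) * real n"
proof -
  define near where "near = {(i, j) \<in> pairs n. j \<le> i + 2 * l}"
  define far where "far = {(i, j) \<in> pairs n. i + 2 * l < j}"
  have fin: "finite near" "finite far"
    unfolding near_def far_def by (auto intro: finite_subset[OF _ finite_pairs])
  define D where "D = (\<lambda>(i, j) \<omega>. cR l (int i) (int j) \<omega>)"
  have D: "D a \<in> L2 M" "l2norm M (D a) \<le> \<rho> l" for a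
    by (auto simp: D_def cR_L2 cR_norm split: prod.split)
  have "pairs n = near \<union> far" "near \<inter> far = {}"
    by (auto simp: near_def far_def)
  then have split: "(\<Sum>(i, j)\<in>pairs n. cR l (int i) (int j) \<omega>) = (\<Sum>a\<in>near. D a \<omega>) + (\<Sum>a\<in>far. D a \<omega>)" for \<omega>
    using fin by (simp add: D_def sum.union_disjoint split_beta)
  have "near \<subseteq> (\<lambda>(i, k). (i, i + k)) ` ({1..n} \<times> {..2 * l})"
  proof
    fix a assume "a \<in> near"
    then obtain i j where a: "a = (i, j)" "i \<in> {1..n}" "i \<le> j" "j - i \<in> {..2 * l}"
      by (auto simp: near_def pairs_def)
    then show "a \<in> (\<lambda>(i, k). (i, i + k)) ` ({1..n} \<times> {..2 * l})"
      by (intro image_eqI[of _ _ "(i, j - i)"]) auto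
  qed
  then have "card near \<le> card ({1..n} \<times> {..2 * l})"
    by (rule surj_card_le[rotated]) simp
  then have "real (card near) \<le> real (n * (2 * l + 1))"
    by (intro of_nat_mono) (simp add: card_cartesian_product)
  then have card_near: "real (card near) \<le> (2 * real l + 1) * real n"
    by (simp add: algebra_simps)
  have "l2norm M (\<lambda>\<omega>. \<Sum>a\<in>near. D a \<omega>) \<le> (\<Sum>a\<in>near. l2norm M (D a))"
    by (intro l2norm_sum D)
  also have "\<dots> \<le> (\<Sum>a\<in>near. \<rho> l)"
    by (intro sum_mono D)
  also have "\<dots> = \<rho> l * real (card near)"
    by (simp add: mult.commute)
  also have "\<dots> \<le> \<rho> l * ((2 * real l + 1) * real n)"
    by (intro mult_left_mono card_near \<rho>_nonneg)
  finally have near_bound: "l2norm M (\<lambda>\<omega>. \<Sum>a\<in>near. D a \<omega>) \<le> \<rho> l * ((2 * real l + 1) * real n)" .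
  define N where "N i = {k. \<not> 2 * int l < \<bar>int i - int k\<bar>}" for i :: nat
  have N: "finite (N i)" "card (N i) \<le> 4 * l + 1" for i
    unfolding N_def by (rule near_finite near_card)+
  \<comment> \<open>Far pairs have disjoint windows, so \<open>R\<close> is already centred and
    equals \<open>cR\<close>.\<close>
  have D_far: "D (i, j) = R l (int i) (int j)" if "(i, j) \<in> far" for i j
    using that R_mean[of l "int i" "int j"] by (auto simp: D_def cR_def far_def)
  have card_far: "card {b \<in> far. expectation (\<lambda>\<omega>. D a \<omega> * D b \<omega>) \<noteq> 0} \<le> (4 * l + 1) * (4 * l + 1)"
    if "a \<in> far" for a
  proof -
    obtain i j where a: "a = (i, j)"
      by (cases a)
    have "{b \<in> far. expectation (\<lambda>\<omega>. D a \<omega> * D b \<omega>) \<noteq> 0} \<subseteq> N i \<times> N j"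
    proof
      fix b assume b: "b \<in> {b \<in> far. expectation (\<lambda>\<omega>. D a \<omega> * D b \<omega>) \<noteq> 0}"
      obtain i' j' where b': "b = (i', j')"
        by (cases b)
      have far: "(i, j) \<in> far" "(i', j') \<in> far"
        using that a b b' by auto
      then have "int i + 2 * int l < int j" "int i' + 2 * int l < int j'"
        by (auto simp: far_def)
      moreover have "expectation (\<lambda>\<omega>. R l (int i) (int j) \<omega> * R l (int i') (int j') \<omega>) \<noteq> 0"
        using b D_far far by (simp add: a b')
      ultimately have "\<not> (2 * int l < \<bar>int i - int i'\<bar> \<or> 2 * int l < \<bar>int j - int j'\<bar>)"
        using R_far_uncorrelated by blast
      then show "b \<in> N i \<times> N j"
        by (simp add: b' N_def)
    qed
    then have "card {b \<in> far. expectation (\<lambda>\<omega>. D a \<omega> * D b \<omega>) \<noteq> 0} \<le> card (N i \<times> N j)"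
      by (rule card_mono[rotated]) (simp add: N)
    also have "\<dots> \<le> (4 * l + 1) * (4 * l + 1)"
      unfolding card_cartesian_product by (intro mult_mono N) auto
    finally show ?thesis .
  qed
  have "(l2norm M (\<lambda>\<omega>. \<Sum>a\<in>far. D a \<omega>))\<^sup>2
      \<le> (\<rho> l)\<^sup>2 * real ((4 * l + 1) * (4 * l + 1)) * real (card far)"
    by (rule l2norm_sum_sparse[OF fin(2) D card_far])
  also have "\<dots> \<le> (\<rho> l)\<^sup>2 * real ((4 * l + 1) * (4 * l + 1)) * real (n * n)"
  proof (intro mult_left_mono of_nat_mono)
    have "card far \<le> card (pairs n)"
      by (intro card_mono) (auto simp: far_def)
    then show "card far \<le> n * n"
      using card_pairs by (rule order_trans)
  qed simp
  also have "\<dots> = (\<rho> l * ((4 * real l + 1) * real n))\<^sup>2"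
    by (simp add: power_mult_distrib power2_eq_square algebra_simps)
  finally have far_bound: "l2norm M (\<lambda>\<omega>. \<Sum>a\<in>far. D a \<omega>) \<le> \<rho> l * ((4 * real l + 1) * real n)"
    by (rule power2_le_imp_le) (simp add: \<rho>_nonneg)
  have "l2norm M (\<lambda>\<omega>. (\<Sum>a\<in>near. D a \<omega>) + (\<Sum>a\<in>far. D a \<omega>))
      \<le> l2norm M (\<lambda>\<omega>. \<Sum>a\<in>near. D a \<omega>) + l2norm M (\<lambda>\<omega>. \<Sum>a\<in>far. D a \<omega>)"
    by (intro l2norm_add L2_sum D)
  also have "\<dots> \<le> \<rho> l * ((2 * real l + 1) * real n) + \<rho> l * ((4 * real l + 1) * real n)"
    by (intro add_mono near_bound far_bound)
  also have "\<dots> = \<rho> l * (6 * real l + 2) * real n"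
    by (simp add: algebra_simps)
  finally show ?thesis
    unfolding split .
qed

section \<open>Normalised statistic against normalised projection sum\<close>

definition A :: "nat \<Rightarrow> nat \<Rightarrow> 'a \<Rightarrow> real" where
  "A l n \<omega> = U l n \<omega> / (real n * sqrt (real n))"

definition B :: "nat \<Rightarrow> nat \<Rightarrow> 'a \<Rightarrow> real" where
  "B l n \<omega> = (\<Sum>i\<in>{1..n}. Yl l (int i) \<omega>) / sqrt (real n)"

lemma A_L2: "A l n \<in> L2 M"
  unfolding A_def[abs_def] by (intro L2_divide U_L2)

lemma B_L2: "B l n \<in> L2 M"
  unfolding B_def[abs_def] by (intro L2_divide L2_sum Yl_L2)

lemma A_step: "l2norm M (\<lambda>\<omega>. A (Suc l) n \<omega> - A l n \<omega>) \<le> dstep l"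
proof (cases "n = 0")
  case False
  then show ?thesis
    using U_step[of l n] unfolding A_def diff_divide_distrib[symmetric] l2norm_divide
    by (simp add: pos_divide_le_eq)
qed (simp add: A_def dstep_nonneg)

lemma B_step: "l2norm M (\<lambda>\<omega>. B (Suc l) n \<omega> - B l n \<omega>) \<le> dstep l"
proof (cases "n = 0")
  case False
  then show ?thesis
    using Yl_sum_step[of l n] unfolding B_def diff_divide_distrib[symmetric] l2norm_divide
    by (simp add: pos_divide_le_eq)
qed (simp add: B_def dstep_nonneg)

text \<open>With D the degenerate part and S the sum of projections, the statistic is D + (n - 1) S,
  so the difference is (D - S) / n^{3/2}; the S comes from n - 1 in place of n. Both norms are O(n),
  for S by the triangle inequality alone.\<close>

lemma A_B_close: "(\<lambda>n. l2norm M (\<lambda>\<omega>. A l n \<omega> - B l n \<omega>)) \<longlonglongrightarrow> 0"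
proof -
  define C where "C = \<rho> l * (6 * real l + 2) + (\<Sum>k\<le>l. t k) + \<bar>cc l\<bar>"
  have Y_norm: "l2norm M (Yl l i) \<le> (\<Sum>k\<le>l. t k) + \<bar>cc l\<bar>" for i
    using l2norm_diff[OF g_L2[of l i] L2_const[of "cc l"]] g_norm[of l i]
    by (simp add: Yl_def[abs_def] l2norm_def prob_space)
  have bound: "l2norm M (\<lambda>\<omega>. A l n \<omega> - B l n \<omega>) \<le> C / sqrt (real n)" if "1 \<le> n" for n
  proof -
    define S where "S \<omega> = (\<Sum>i\<in>{1..n}. Yl l (int i) \<omega>)" for \<omega>
    define D where "D \<omega> = (\<Sum>(i, j)\<in>pairs n. cR l (int i) (int j) \<omega>)" for \<omega>
    have L2: "S \<in> L2 M" "D \<in> L2 M"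
      unfolding S_def[abs_def] D_def[abs_def] by (intro L2_sum; auto intro: Yl_L2 cR_L2)+
    have "U l n \<omega> = D \<omega> + (real n - 1) * S \<omega>" for \<omega>
      using sum_pairs_add[of "\<lambda>i. Yl l (int i) \<omega>" n]
      by (simp add: U_def D_def S_def cker_Hoeffding sum.distrib split_beta)
    then have eq: "(\<lambda>\<omega>. A l n \<omega> - B l n \<omega>) = (\<lambda>\<omega>. (D \<omega> - S \<omega>) / (real n * sqrt (real n)))"
      using that by (simp add: fun_eq_iff A_def B_def S_def field_simps)
    have "l2norm M S \<le> (\<Sum>i\<in>{1..n}. l2norm M (Yl l (int i)))"
      unfolding S_def[abs_def] by (intro l2norm_sum Yl_L2)
    also have "\<dots> \<le> (\<Sum>i\<in>{1..n}. (\<Sum>k\<le>l. t k) + \<bar>cc l\<bar>)"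
      by (intro sum_mono Y_norm)
    finally have "l2norm M S \<le> ((\<Sum>k\<le>l. t k) + \<bar>cc l\<bar>) * real n"
      by (simp add: mult.commute)
    moreover have "l2norm M D \<le> \<rho> l * (6 * real l + 2) * real n"
      unfolding D_def[abs_def] by (rule degenerate_norm)
    ultimately have "l2norm M (\<lambda>\<omega>. D \<omega> - S \<omega>) \<le> C * real n"
      using l2norm_diff[OF L2(2,1)] by (simp add: C_def algebra_simps)
    then have "l2norm M (\<lambda>\<omega>. D \<omega> - S \<omega>) / (real n * sqrt (real n)) \<le> C * real n / (real n * sqrt (real n))"
      by (intro divide_right_mono) auto
    then show ?thesis
      unfolding eq l2norm_divide using that by simp
  qed
  have "(\<lambda>n. C * inverse (sqrt (real n))) \<longlonglongrightarrow> C * 0"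
    by (intro tendsto_mult tendsto_const tendsto_inverse_0_at_top
        filterlim_compose[OF sqrt_at_top filterlim_real_sequentially])
  then have lim: "(\<lambda>n. C / sqrt (real n)) \<longlonglongrightarrow> 0"
    by (simp add: divide_inverse)
  show ?thesis
    by (rule Lim_null_comparison[OF _ lim])
      (auto intro!: eventually_sequentiallyI[of 1] bound)
qed

end

section \<open>Passage to the limit\<close>

lemma Lp_norm_2:
  "Lp_norm M 2 Y = (let I = \<integral>\<^sup>+\<omega>. ennreal ((Y \<omega>)\<^sup>2) \<partial>M in if I = \<top> then \<top> else ennreal (sqrt (enn2real I)))"
  by (simp add: Lp_norm_def Let_def powr_half_sqrt)

lemma Lp_norm_2_L2: "Y \<in> L2 M \<Longrightarrow> Lp_norm M 2 Y = ennreal (l2norm M Y)"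
  by (simp add: Lp_norm_2 nn_integral_l2norm)

lemma Lp_norm_2_finite_imp_L2:
  assumes "Y \<in> borel_measurable M" "Lp_norm M 2 Y < \<top>"
  shows "Y \<in> L2 M"
proof (rule L2I)
  have "(\<integral>\<^sup>+\<omega>. ennreal ((Y \<omega>)\<^sup>2) \<partial>M) \<noteq> \<top>"
    using assms(2) by (auto simp: Lp_norm_2)
  then show "integrable M (\<lambda>\<omega>. (Y \<omega>)\<^sup>2)"
    using assms(1) by (intro integrableI_nonneg) (auto simp: less_top)
qed fact

lemma Lp_norm_2_le_imp:
  assumes "Y \<in> borel_measurable M" "Lp_norm M 2 Y \<le> c" "c < \<top>"
  shows "Y \<in> L2 M" "l2norm M Y \<le> enn2real c"
proof -
  show *: "Y \<in> L2 M"
    using assms by (intro Lp_norm_2_finite_imp_L2) auto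
  have "enn2real (ennreal (l2norm M Y)) \<le> enn2real c"
    using assms(2,3) unfolding Lp_norm_2_L2[OF *] by (rule enn2real_mono)
  then show "l2norm M Y \<le> enn2real c"
    by simp
qed

lemma Lp_norm_2_AE_cong:
  assumes "AE \<omega> in M. Y \<omega> = Z \<omega>"
  shows "Lp_norm M 2 Y = Lp_norm M 2 Z"
proof -
  have "(\<integral>\<^sup>+\<omega>. ennreal ((Y \<omega>)\<^sup>2) \<partial>M) = (\<integral>\<^sup>+\<omega>. ennreal ((Z \<omega>)\<^sup>2) \<partial>M)"
    using assms by (intro nn_integral_cong_AE) auto
  then show ?thesis
    by (simp add: Lp_norm_2)
qed

context ustat
begin

lemma Yl_limit_exists:
  obtains Y where "Y \<in> L2 M" "(\<lambda>l. l2norm M (\<lambda>\<omega>. Yl l k \<omega> - Y \<omega>)) \<longlonglongrightarrow> 0"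
proof -
  obtain Y where Y: "Y \<in> L2 M" "\<And>l. l2norm M (\<lambda>\<omega>. Yl l k \<omega> - Y \<omega>) \<le> (\<Sum>i. t (Suc (i + l)))"
    using L2_complete[of "\<lambda>l. Yl l k" "\<lambda>l. t (Suc l)", OF Yl_L2 Yl_step t_Suc_summable] by blast
  have "(\<lambda>l. \<Sum>i. t (Suc (i + l))) \<longlonglongrightarrow> 0"
    using suminf_exist_split2[OF t_Suc_summable] .
  then have "(\<lambda>l. l2norm M (\<lambda>\<omega>. Yl l k \<omega> - Y \<omega>)) \<longlonglongrightarrow> 0"
    by (rule Lim_null_comparison[OF always_eventually[OF allI], rotated]) (simp add: Y(2))
  with Y(1) show thesis
    by (rule that)
qed

text \<open>Summable increments turn almost sure convergence of the kernels into L2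
  convergence.\<close>

lemma ker_limit:
  assumes V: "V \<in> borel_measurable M" "AE \<omega> in M. (\<lambda>l. ker l i j \<omega>) \<longlonglongrightarrow> V \<omega>"
  shows "V \<in> L2 M" "(\<lambda>l. l2norm M (\<lambda>\<omega>. ker l i j \<omega> - V \<omega>)) \<longlonglongrightarrow> 0"
proof -
  note lim = L2_limit_steps[of "\<lambda>l. ker l i j" M "\<lambda>l. t (Suc l)", OF ker_L2 ker_step(2) t_Suc_summable V]
  show "V \<in> L2 M"
    by (rule lim)
  have "(\<lambda>l. \<Sum>i. t (Suc (i + l))) \<longlonglongrightarrow> 0"
    using suminf_exist_split2[OF t_Suc_summable] .
  then show "(\<lambda>l. l2norm M (\<lambda>\<omega>. ker l i j \<omega> - V \<omega>)) \<longlonglongrightarrow> 0"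
    by (rule Lim_null_comparison[OF always_eventually[OF allI], rotated]) (simp add: lim(2))
qed

section \<open>Arbitrary versions of the limits Y_k and their covariances\<close>

context
  fixes Y :: "int \<Rightarrow> 'a \<Rightarrow> real"
  assumes Y_L2: "\<And>k. Y k \<in> L2 M"
    and Y_lim: "\<And>k. (\<lambda>l. l2norm M (\<lambda>\<omega>. Yl l k \<omega> - Y k \<omega>)) \<longlonglongrightarrow> 0"
begin

definition \<Gamma> :: "int \<Rightarrow> real" where
  "\<Gamma> k = expectation (\<lambda>\<omega>. Y 0 \<omega> * Y k \<omega>)"

lemma Y_mean: "expectation (Y k) = 0"
proof -
  have one: "(\<lambda>l. l2norm M (\<lambda>\<omega>. (1 :: real) - 1)) \<longlonglongrightarrow> 0"
    by simp
  have "(\<lambda>l. expectation (\<lambda>\<omega>. Yl l k \<omega> * 1)) \<longlonglongrightarrow> expectation (\<lambda>\<omega>. Y k \<omega> * 1)"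
    using tendsto_expectation_mult_L2[of "\<lambda>l. Yl l k" M "Y k" "\<lambda>_ _. 1" "\<lambda>_. 1",
      OF Yl_L2 Y_L2 Y_lim L2_const L2_const one] .
  then show ?thesis
    by (simp add: Yl_mean LIMSEQ_const_iff)
qed

text \<open>The Y_k are given only as L2 limits, not as functions of a shifted path; stationarity of
  their covariances is inherited from the approximations by continuity of the inner product.\<close>

lemma Y_covariance: "expectation (\<lambda>\<omega>. Y i \<omega> * Y j \<omega>) = \<Gamma> (j - i)"
proof -
  have lim: "(\<lambda>l. cov l (j - i)) \<longlonglongrightarrow> expectation (\<lambda>\<omega>. Y i \<omega> * Y j \<omega>)" for i j
    using tendsto_expectation_mult_L2[of "\<lambda>l. Yl l i" M "Y i" "\<lambda>l. Yl l j" "Y j",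
      OF Yl_L2 Y_L2 Y_lim Yl_L2 Y_L2 Y_lim]
    by (simp add: Yl_covariance)
  have "(\<lambda>l. cov l (j - i)) \<longlonglongrightarrow> \<Gamma> (j - i)"
    using lim[of "j - i" 0] unfolding \<Gamma>_def by simp
  with lim show ?thesis
    by (rule LIMSEQ_unique)
qed

lemma covar_eq: "covar M (Y 0) (Y k) = \<Gamma> k"
  by (simp add: covar_def Y_mean \<Gamma>_def)

context
  assumes \<Gamma>_summable: "(\<lambda>k. \<bar>\<Gamma> k\<bar>) summable_on UNIV"
begin

lemma \<Gamma>_nonneg: "0 \<le> (\<Sum>\<^sub>\<infinity>k. \<Gamma> k)"
  by (rule l2norm_mean_sum_tendsto(2)[where Z=Y, OF Y_L2 Y_covariance \<Gamma>_summable])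

text \<open>For fixed n the sum converges term by term as the level grows, with a bound that
  deteriorates with n; the increments \<open>dstep\<close>, free of n, replace that bound by
  \<open>tail l\<close>.\<close>

lemma B_limit_close:
  "l2norm M (\<lambda>\<omega>. B l n \<omega> - (\<Sum>i\<in>{1..n}. Y (int i) \<omega>) / sqrt (real n)) \<le> tail l"
proof -
  define B' where "B' \<omega> = (\<Sum>i\<in>{1..n}. Y (int i) \<omega>) / sqrt (real n)" for \<omega>
  have B': "B' \<in> L2 M"
    unfolding B'_def[abs_def] by (intro L2_divide L2_sum Y_L2)
  have "l2norm M (\<lambda>\<omega>. B l n \<omega> - B' \<omega>)
      \<le> (\<Sum>i\<in>{1..n}. l2norm M (\<lambda>\<omega>. Yl l (int i) \<omega> - Y (int i) \<omega>)) / sqrt (real n)" for l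
    unfolding B_def B'_def diff_divide_distrib[symmetric] l2norm_divide sum_subtractf[symmetric]
    by (simp add: divide_right_mono l2norm_sum L2_diff Yl_L2 Y_L2)
  then have le: "norm (l2norm M (\<lambda>\<omega>. B l n \<omega> - B' \<omega>))
      \<le> (\<Sum>i\<in>{1..n}. l2norm M (\<lambda>\<omega>. Yl l (int i) \<omega> - Y (int i) \<omega>)) / sqrt (real n)" for l
    by simp
  have "(\<lambda>l. (\<Sum>i\<in>{1..n}. l2norm M (\<lambda>\<omega>. Yl l (int i) \<omega> - Y (int i) \<omega>)) * inverse (sqrt (real n)))
      \<longlonglongrightarrow> (\<Sum>i\<in>{1..n}. 0) * inverse (sqrt (real n))"
    by (intro tendsto_intros Y_lim)
  then have "(\<lambda>l. (\<Sum>i\<in>{1..n}. l2norm M (\<lambda>\<omega>. Yl l (int i) \<omega> - Y (int i) \<omega>)) / sqrt (real n)) \<longlonglongrightarrow> 0"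
    by (simp add: divide_inverse)
  from Lim_null_comparison[OF always_eventually[OF allI[OF le]] this]
  have "(\<lambda>l. l2norm M (\<lambda>\<omega>. B l n \<omega> - B' \<omega>)) \<longlonglongrightarrow> 0" .
  from L2_norm_limit_steps[of "\<lambda>l. B l n" M B' dstep, OF B_L2 B' B_step dstep_summable this]
  show ?thesis
    unfolding tail_def B'_def .
qed

text \<open>Exchanging the limit in l with the sum over k directly would ask for a domination
  uniform in l. Instead, the norms of the normalised sums differ by at most \<open>tail l\<close>
  for every n; they tend to the two standard deviations as n grows, and the bound survives.\<close>

lemma variance_limit: "(\<lambda>l. \<Sum>\<^sub>\<infinity>k. cov l k) \<longlonglongrightarrow> (\<Sum>\<^sub>\<infinity>k. \<Gamma> k)"
proof -
  define v where "v l = sqrt (\<Sum>\<^sub>\<infinity>k. cov l k)" for l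
  define w where "w = sqrt (\<Sum>\<^sub>\<infinity>k. \<Gamma> k)"
  have "\<bar>v l - w\<bar> \<le> tail l" for l
  proof (rule LIMSEQ_le_const2)
    define B' where "B' n \<omega> = (\<Sum>i\<in>{1..n}. Y (int i) \<omega>) / sqrt (real n)" for n \<omega>
    have B': "B' n \<in> L2 M" for n
      unfolding B'_def[abs_def] by (intro L2_divide L2_sum Y_L2)
    have "(\<lambda>n. l2norm M (B l n)) \<longlonglongrightarrow> v l"
      unfolding B_def[abs_def] v_def
      by (rule l2norm_mean_sum_tendsto(1)[where Z="Yl l", OF Yl_L2 Yl_covariance cov_summable])
    moreover have "(\<lambda>n. l2norm M (B' n)) \<longlonglongrightarrow> w"
      unfolding B'_def[abs_def] w_def
      by (rule l2norm_mean_sum_tendsto(1)[where Z=Y, OF Y_L2 Y_covariance \<Gamma>_summable])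
    ultimately show "(\<lambda>n. \<bar>l2norm M (B l n) - l2norm M (B' n)\<bar>) \<longlonglongrightarrow> \<bar>v l - w\<bar>"
      by (intro tendsto_intros)
    have "\<bar>l2norm M (B l n) - l2norm M (B' n)\<bar> \<le> tail l" for n
      using l2norm_triangle_sub[OF B_L2[of l n] B'[of n]] B_limit_close[of l n]
      unfolding B'_def by (rule order_trans)
    then show "\<exists>N. \<forall>n\<ge>N. \<bar>l2norm M (B l n) - l2norm M (B' n)\<bar> \<le> tail l"
      by blast
  qed
  then have "(\<lambda>l. v l - w) \<longlonglongrightarrow> 0"
    by (intro Lim_null_comparison[OF always_eventually[OF allI] tail_tendsto]) simp
  then have "(\<lambda>l. (v l)\<^sup>2) \<longlonglongrightarrow> w\<^sup>2"
    by (intro tendsto_power) (rule LIM_zero_cancel)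
  moreover have "0 \<le> (\<Sum>\<^sub>\<infinity>k. cov l k)" for l
    by (rule l2norm_mean_sum_tendsto(2)[where Z="Yl l", OF Yl_L2 Yl_covariance cov_summable])
  ultimately show ?thesis
    using \<Gamma>_nonneg by (simp add: v_def w_def)
qed

lemma U_statistic_clt:
  assumes V: "\<And>i j. i < j \<Longrightarrow> V i j \<in> L2 M"
      "\<And>i j. i < j \<Longrightarrow> (\<lambda>l. l2norm M (\<lambda>\<omega>. ker l (int i) (int j) \<omega> - V i j \<omega>)) \<longlonglongrightarrow> 0"
  defines "W \<equiv> \<lambda>n \<omega>. \<Sum>(i, j)\<in>pairs n. V i j \<omega>"
  shows "clt M (\<lambda>n \<omega>. (W n \<omega> - expectation (W n)) / (real n * sqrt (real n))) (\<Sum>\<^sub>\<infinity>k. \<Gamma> k)"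
proof (rule clt_approx)
  define A' where "A' n \<omega> = (W n \<omega> - expectation (W n)) / (real n * sqrt (real n))" for n \<omega>
  have W_L2: "W n \<in> L2 M" for n
    unfolding W_def by (intro L2_sum) (auto simp: pairs_def intro: V)
  have A'_L2: "A' n \<in> L2 M" for n
    unfolding A'_def[abs_def] by (intro L2_divide L2_center W_L2)
  then show "(\<lambda>\<omega>. (W n \<omega> - expectation (W n)) / (real n * sqrt (real n))) \<in> L2 M" for n
    unfolding A'_def[abs_def] .
  \<comment> \<open>For fixed n there are finitely many pairs, so termwise convergence identifies
    the limit in l; the rate free of n again comes from \<open>dstep\<close>.\<close>
  have close: "l2norm M (\<lambda>\<omega>. A l n \<omega> - A' n \<omega>) \<le> tail l" for l n
  proof -
    define D where "D l \<omega> = (\<Sum>(i, j)\<in>pairs n. ker l (int i) (int j) \<omega> - V i j \<omega>)" for l \<omega>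
    have D: "D l \<in> L2 M" for l
      unfolding D_def[abs_def] by (intro L2_sum) (auto simp: pairs_def intro: L2_diff ker_L2 V)
    define S where "S l \<omega> = (\<Sum>(i, j)\<in>pairs n. ker l (int i) (int j) \<omega>)" for l \<omega>
    have S: "S l \<in> L2 M" for l
      unfolding S_def[abs_def] by (intro L2_sum) (auto intro: ker_L2)
    have "expectation (S l) = (\<Sum>(i, j)\<in>pairs n. expectation (ker l (int i) (int j)))" for l
      unfolding S_def[abs_def] split_beta
      by (rule Bochner_Integration.integral_sum) (rule L2_integrable[OF ker_L2])
    then have U: "U l n \<omega> = S l \<omega> - expectation (S l)" for l \<omega>
      by (simp add: U_def S_def cker_def sum_subtractf split_beta)
    have DS: "D l \<omega> = S l \<omega> - W n \<omega>" for l \<omega>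
      by (simp add: D_def S_def W_def sum_subtractf split_beta)
    then have "expectation (D l) = expectation (S l) - expectation (W n)" for l
      using L2_integrable[OF S] L2_integrable[OF W_L2] by (simp add: DS[abs_def])
    then have eq: "A l n \<omega> - A' n \<omega> = (D l \<omega> - expectation (D l)) / (real n * sqrt (real n))" for l \<omega>
      by (simp add: A_def A'_def U DS diff_divide_distrib)
    have bound: "norm (l2norm M (\<lambda>\<omega>. A l n \<omega> - A' n \<omega>))
        \<le> (\<Sum>(i, j)\<in>pairs n. l2norm M (\<lambda>\<omega>. ker l (int i) (int j) \<omega> - V i j \<omega>)) / (real n * sqrt (real n))" for l
    proof -
      have "l2norm M (\<lambda>\<omega>. D l \<omega> - expectation (D l)) \<le> l2norm M (D l)"
        by (rule l2norm_center[OF D])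
      also have "\<dots> \<le> (\<Sum>a\<in>pairs n. l2norm M (\<lambda>\<omega>. case a of (i, j) \<Rightarrow> ker l (int i) (int j) \<omega> - V i j \<omega>))"
        unfolding D_def[abs_def] by (intro l2norm_sum) (auto simp: pairs_def intro: L2_diff ker_L2 V)
      finally show ?thesis
        unfolding eq l2norm_divide by (simp add: divide_right_mono split_beta)
    qed
    have "(\<lambda>l. (\<Sum>(i, j)\<in>pairs n. l2norm M (\<lambda>\<omega>. ker l (int i) (int j) \<omega> - V i j \<omega>))
        * inverse (real n * sqrt (real n))) \<longlonglongrightarrow> (\<Sum>a\<in>pairs n. 0) * inverse (real n * sqrt (real n))"
      by (intro tendsto_mult tendsto_const tendsto_sum) (auto simp: pairs_def intro: V)
    then have "(\<lambda>l. (\<Sum>(i, j)\<in>pairs n. l2norm M (\<lambda>\<omega>. ker l (int i) (int j) \<omega> - V i j \<omega>))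
        / (real n * sqrt (real n))) \<longlonglongrightarrow> 0"
      by (simp add: divide_inverse)
    from Lim_null_comparison[OF always_eventually[OF allI[OF bound]] this]
    have "(\<lambda>l. l2norm M (\<lambda>\<omega>. A l n \<omega> - A' n \<omega>)) \<longlonglongrightarrow> 0" .
    from L2_norm_limit_steps[of "\<lambda>l. A l n" M "A' n" dstep, OF A_L2 A'_L2 A_step dstep_summable this]
    show ?thesis
      unfolding tail_def .
  qed
  show "B l n \<in> L2 M" for l n
    by (rule B_L2)
  show "clt M (B l) (\<Sum>\<^sub>\<infinity>k. cov l k)" for l
    unfolding B_def[abs_def] by (rule Yl_clt)
  show "(\<lambda>l. \<Sum>\<^sub>\<infinity>k. cov l k) \<longlonglongrightarrow> (\<Sum>\<^sub>\<infinity>k. \<Gamma> k)"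
    by (rule variance_limit)
  \<comment> \<open>The second summand absorbs the distance from \<open>A l n\<close> to
    \<open>B l n\<close>, which tends to 0 in n for each l but with no rate uniform in l. Any
    positive null sequence would do.\<close>
  show "(\<lambda>l. tail l + inverse (real (Suc l))) \<longlonglongrightarrow> 0"
    using tendsto_add[OF tail_tendsto LIMSEQ_inverse_real_of_nat] by simp
  show "\<forall>\<^sub>F n in sequentially. l2norm M (\<lambda>\<omega>. (W n \<omega> - expectation (W n)) / (real n * sqrt (real n)) - B l n \<omega>)
      \<le> tail l + inverse (real (Suc l))" for l
  proof -
    have "\<forall>\<^sub>F n in sequentially. l2norm M (\<lambda>\<omega>. A l n \<omega> - B l n \<omega>) < inverse (real (Suc l))"
      using A_B_close by (rule order_tendstoD(2)) simp
    then show ?thesis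
    proof eventually_elim
      case (elim n)
      have "l2norm M (\<lambda>\<omega>. A' n \<omega> - B l n \<omega>)
          \<le> l2norm M (\<lambda>\<omega>. A' n \<omega> - A l n \<omega>) + l2norm M (\<lambda>\<omega>. A l n \<omega> - B l n \<omega>)"
        using l2norm_add[OF L2_diff[OF A'_L2 A_L2] L2_diff[OF A_L2 B_L2], of n l n l n l n] by simp
      also have "\<dots> \<le> tail l + inverse (real (Suc l))"
        using close[of l n] elim unfolding l2norm_minus_commute[of M "A' n"] by (intro add_mono) auto
      finally show ?case
        by (simp add: A'_def)
    qed
  qed
qed

end

end

section \<open>Identification of the conditional expectations\<close>

lemma distr_window: "distr M (window_space l) (window e j l) = distr M (window_space l) (window e 0 l)"
proof -
  have "window e k l = (\<lambda>\<omega>. seq_window 0 l (shift k \<omega>))" for k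
    using window_shift[of k 0 l] by (simp add: fun_eq_iff)
  then show ?thesis
    using distr_stationary[OF seq_window_measurable, of l 0 j] by simp
qed

text \<open>Freezing: given V_k the independent argument is averaged out, which leaves G_l at
  f_l(V_k). The copy enters through its independence and its law, so averages over its window equal
  averages over a window of the original noise.\<close>

lemma projection_approx_AE_eq:
  assumes copy: "independent_copy M e e'"
  shows "AE \<omega> in M. projection_approx M e e' h F k l \<omega> = Yl l k \<omega>"
proof -
  have ind0: "indep_var seq_space (\<lambda>\<omega> u. e u \<omega>) seq_space (\<lambda>\<omega> u. e' u \<omega>)"
    and distr_e': "distr M seq_space (\<lambda>\<omega> u. e' u \<omega>) = distr M seq_space (\<lambda>\<omega> u. e u \<omega>)"
    using copy by (auto simp: independent_copy_def Let_def)
  note [measurable] = indep_var_rv2[OF ind0] indep_var_rv1[OF ind0]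
  define W where "W = window e k l"
  define W' where "W' = window e' 0 l"
  have W: "W = (\<lambda>\<omega>. seq_window k l (\<lambda>u. e u \<omega>))" and W': "W' = (\<lambda>\<omega>. seq_window 0 l (\<lambda>u. e' u \<omega>))"
    by (simp_all add: fun_eq_iff W_def W'_def window_def seq_window_def)
  have [measurable]: "W \<in> measurable M (window_space l)" "W' \<in> measurable M (window_space l)"
    unfolding W W' by measurable
  have ind: "indep_pair (window_space l) W (window_space l) W'"
    unfolding W W'
    by (rule indep_pair_compose[OF indep_var_imp_indep_pair[OF ind0] seq_window_measurable seq_window_measurable])
  have "distr M (window_space l) W' = distr (distr M seq_space (\<lambda>\<omega> u. e' u \<omega>)) (window_space l) (seq_window 0 l)"
    unfolding W' by (subst distr_distr) (auto simp: comp_def)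
  also have "\<dots> = distr M (window_space l) (window e 0 l)"
    unfolding distr_e' by (subst distr_distr) (auto simp: comp_def window_def[abs_def] seq_window_def)
  finally have distr_W': "distr M (window_space l) W' = distr M (window_space l) (window e 0 l)" .
  have inner: "expectation (\<lambda>\<omega>. h r (F l (W' \<omega>))) = G l r" for r
  proof -
    have "expectation (\<lambda>\<omega>. h r (F l (W' \<omega>))) = (\<integral>x. h r (F l x) \<partial>distr M (window_space l) W')"
      by (simp add: integral_distr)
    also have "\<dots> = G l r"
      unfolding distr_W' by (simp add: integral_distr G_def)
    finally show ?thesis .
  qed
  define H where "H \<omega> = h (F l (W \<omega>)) (F l (W' \<omega>))" for \<omega>
  have H_int: "integrable M H"
  proof -
    \<comment> \<open>Integrability with the copy is borrowed from the original sequence: (V_k,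
      V'_0) has the law of (V_k, V_j) once the windows at k and j are disjoint.\<close>
    define j where "j = k + 2 * int l + 1"
    have "indep_pair (window_space l) W (window_space l) (window e j l)"
      unfolding W_def by (rule windows_indep) (simp add: j_def)
    then have eq: "distr M (window_space l \<Otimes>\<^sub>M window_space l) (\<lambda>\<omega>. (W \<omega>, W' \<omega>))
        = distr M (window_space l \<Otimes>\<^sub>M window_space l) (\<lambda>\<omega>. (W \<omega>, window e j l \<omega>))"
      using ind distr_W' distr_window[of l j] unfolding indep_pair_def by metis
    define \<phi> where "\<phi> p = h (F l (fst p)) (F l (snd p))" for p
    have [measurable]: "\<phi> \<in> borel_measurable (window_space l \<Otimes>\<^sub>M window_space l)"
      unfolding \<phi>_def by measurable
    have "integrable M (\<lambda>\<omega>. \<phi> (W \<omega>, window e j l \<omega>))"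
      using L2_integrable[OF ker_L2[of l k j]] by (simp add: \<phi>_def ker_def[abs_def] W_def)
    then have "integrable (distr M (window_space l \<Otimes>\<^sub>M window_space l) (\<lambda>\<omega>. (W \<omega>, window e j l \<omega>))) \<phi>"
      by (subst integrable_distr_eq) auto
    then have "integrable M (\<lambda>\<omega>. \<phi> (W \<omega>, W' \<omega>))"
      unfolding eq[symmetric] by (subst (asm) integrable_distr_eq) auto
    then show ?thesis
      by (simp add: \<phi>_def H_def[abs_def])
  qed
  \<comment> \<open>The defining property of conditional expectation, tested on the events that V_k
    lies in B; the indicator is frozen together with V_k.\<close>
  have part: "(\<integral>\<omega>. indicator B (W \<omega>) * H \<omega> \<partial>M) = (\<integral>\<omega>. indicator B (W \<omega>) * g l k \<omega> \<partial>M)"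
    if B[measurable]: "B \<in> sets (window_space l)" for B
  proof -
    define \<phi> where "\<phi> x y = indicator B x * h (F l x) (F l y)" for x y
    have \<phi>: "case_prod \<phi> \<in> borel_measurable (window_space l \<Otimes>\<^sub>M window_space l)"
      unfolding \<phi>_def by measurable
    have "integrable M (\<lambda>\<omega>. indicator (W -` B \<inter> space M) \<omega> *\<^sub>R H \<omega>)"
      by (rule integrable_mult_indicator[OF _ H_int]) simp
    then have "integrable M (\<lambda>\<omega>. \<phi> (W \<omega>) (W' \<omega>))"
      by (rule Bochner_Integration.integrable_cong[THEN iffD1, rotated -1])
        (auto simp: \<phi>_def H_def indicator_def)
    from indep_pair_Fubini(3)[where \<phi>=\<phi>, OF ind \<phi> this] show ?thesis
      by (simp add: \<phi>_def H_def inner g_def W_def)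
  qed
  define S where "S = vimage_algebra (space M) W (window_space l)"
  have W_space: "W \<in> space M \<rightarrow> space (window_space l)"
    using measurable_space[of W M "window_space l"] by auto
  have sets_S: "sets S = {W -` B \<inter> space M |B. B \<in> sets (window_space l)}"
    unfolding S_def by (rule sets_vimage_algebra2[OF W_space])
  have "subalgebra M S"
    unfolding subalgebra_def sets_S by (auto simp: S_def)
  then interpret S: finite_measure_subalgebra M S
    by unfold_locales
  have set_int: "(\<integral>\<omega>\<in>W -` B \<inter> space M. f \<omega> \<partial>M) = (\<integral>\<omega>. indicator B (W \<omega>) * f \<omega> \<partial>M)" for B and f :: "'a \<Rightarrow> real"
    unfolding set_lebesgue_integral_def
    by (intro Bochner_Integration.integral_cong) (auto simp: indicator_def)
  have "AE \<omega> in M. real_cond_exp M S H \<omega> = g l k \<omega>"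
  proof (rule S.real_cond_exp_charact[OF _ H_int L2_integrable[OF g_L2]])
    show "(\<integral>\<omega>\<in>A. H \<omega> \<partial>M) = (\<integral>\<omega>\<in>A. g l k \<omega> \<partial>M)" if "A \<in> sets S" for A
      using that part unfolding sets_S by (auto simp: set_int)
    have "W \<in> measurable S (window_space l)"
      unfolding S_def by (rule measurable_vimage_algebra1[OF W_space])
    then show "g l k \<in> borel_measurable S"
      unfolding g_def[abs_def] W_def by measurable
  qed
  moreover have "expectation H = cc l"
  proof -
    \<comment> \<open>The whole space is one of the test sets, so the two means agree.\<close>
    have "expectation H = (\<integral>\<omega>. indicator (space (window_space l)) (W \<omega>) * H \<omega> \<partial>M)"
      using W_space by (intro Bochner_Integration.integral_cong) (auto simp: Pi_iff)
    also have "\<dots> = (\<integral>\<omega>. indicator (space (window_space l)) (W \<omega>) * g l k \<omega> \<partial>M)"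
      by (rule part) simp
    also have "\<dots> = expectation (g l k)"
      using W_space by (intro Bochner_Integration.integral_cong) (auto simp: Pi_iff)
    finally show ?thesis
      by (simp add: g_mean)
  qed
  ultimately show ?thesis
    by (simp add: projection_approx_def cond_exp_window_def H_def[abs_def] S_def W_def W'_def Yl_def)
qed

text \<open>\<open>L2_limit\<close> uses extended norms and conditional expectations; finiteness and
  almost everywhere equality reduce it to real norms of \<open>Yl\<close>.\<close>

lemma L2_limit_projection:
  assumes "independent_copy M e e'"
  shows "L2_limit M (projection_approx M e e' h F k) Y
    \<longleftrightarrow> Y \<in> L2 M \<and> (\<lambda>l. l2norm M (\<lambda>\<omega>. Yl l k \<omega> - Y \<omega>)) \<longlonglongrightarrow> 0"
proof -
  have "Lp_norm M 2 (\<lambda>\<omega>. projection_approx M e e' h F k l \<omega> - Y \<omega>) = ennreal (l2norm M (\<lambda>\<omega>. Yl l k \<omega> - Y \<omega>))"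
    if "Y \<in> L2 M" for l
  proof -
    have "Lp_norm M 2 (\<lambda>\<omega>. projection_approx M e e' h F k l \<omega> - Y \<omega>) = Lp_norm M 2 (\<lambda>\<omega>. Yl l k \<omega> - Y \<omega>)"
      using projection_approx_AE_eq[OF assms, of k l]
      by (intro Lp_norm_2_AE_cong) (auto elim: AE_mp)
    then show ?thesis
      using Lp_norm_2_L2[OF L2_diff[OF Yl_L2 that]] by simp
  qed
  moreover have "Y \<in> L2 M \<longleftrightarrow> Y \<in> borel_measurable M \<and> Lp_norm M 2 Y < \<top>"
  proof
    assume "Y \<in> L2 M"
    then show "Y \<in> borel_measurable M \<and> Lp_norm M 2 Y < \<top>"
      by (simp add: Lp_norm_2_L2 L2_measurable)
  qed (auto intro: Lp_norm_2_finite_imp_L2)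
  moreover have "((\<lambda>l. ennreal (l2norm M (\<lambda>\<omega>. Yl l k \<omega> - Y \<omega>))) \<longlonglongrightarrow> 0)
      \<longleftrightarrow> (\<lambda>l. l2norm M (\<lambda>\<omega>. Yl l k \<omega> - Y \<omega>)) \<longlonglongrightarrow> 0"
    using tendsto_ennreal_iff[of "\<lambda>l. l2norm M (\<lambda>\<omega>. Yl l k \<omega> - Y \<omega>)" sequentially 0] by simp
  ultimately show ?thesis
    unfolding L2_limit_def by auto
qed

end

section \<open>From the dependence coefficients to the limit law\<close>

theorem theorem1p7:
  fixes M :: "'a measure"
    and \<epsilon> \<epsilon>' :: "int \<Rightarrow> 'a \<Rightarrow> real"
    and f :: "(int \<Rightarrow> real) \<Rightarrow> real"
    and h :: "real \<Rightarrow> real \<Rightarrow> real"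
    and X :: "int \<Rightarrow> 'a \<Rightarrow> real"
    and F :: "nat \<Rightarrow> (int \<Rightarrow> real) \<Rightarrow> real"
  assumes prob: "prob_space M"
    and iid: "iid_sequence M \<epsilon>"
    and copy: "independent_copy M \<epsilon> \<epsilon>'"
    and f_meas: "f \<in> borel_measurable (Pi\<^sub>M UNIV (\<lambda>_. borel))"
    and h_meas: "case_prod h \<in> borel_measurable (borel \<Otimes>\<^sub>M borel)"
    and h_sym: "\<And>x y. h x y = h y x"
    and X_eq: "X = shift_process f \<epsilon>"
    and X_int: "integrable M (X 0)"
    and F_reg: "window_regression M \<epsilon> X F"
    and kernel_conv: "\<And>j::nat. j \<ge> 1 \<Longrightarrow>
          AE \<omega> in M. (\<lambda>l. kernel_approx \<epsilon> h F (int j) l \<omega>) \<longlonglongrightarrow> h (X 0 \<omega>) (X (int j) \<omega>)"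
    and theta0: "dep_coeff M \<epsilon> h F 0 2 < \<top>"
    and theta2: "(\<Sum>l. ennreal (real l powr (1 / 2)) * dep_coeff M \<epsilon> h F l 2) < \<top>"
    and theta1: "(\<Sum>l. ennreal (real l ^ 2) * dep_coeff M \<epsilon> h F l 1) < \<top>"
  shows "(\<exists>Y. \<forall>k. L2_limit M (projection_approx M \<epsilon> \<epsilon>' h F k) (Y k)) \<and>
    (\<forall>Y. (\<forall>k. L2_limit M (projection_approx M \<epsilon> \<epsilon>' h F k) (Y k)) \<longrightarrow>
         (\<lambda>k. \<bar>covar M (Y 0) (Y k)\<bar>) summable_on UNIV \<longrightarrow>
         weak_conv_m
           (\<lambda>n. distr M borel
              (\<lambda>\<omega>. (U_stat h X n \<omega> - (\<integral>x. U_stat h X n x \<partial>M)) / real n powr (3 / 2)))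
           (centered_normal (\<Sum>\<^sub>\<infinity>k::int. covar M (Y 0) (Y k))))"
proof -
  interpret iid_process M \<epsilon>
    using prob iid by (intro iid_process.intro iid_process_axioms.intro)
  note [measurable] = h_meas f_meas
  have F_meas [measurable]: "F l \<in> borel_measurable (window_space l)" for l
    using F_reg by (simp add: window_regression_def)
  define \<theta> where "\<theta> l = dep_coeff M \<epsilon> h F l 2" for l
  have kernel_meas [measurable]: "kernel_approx \<epsilon> h F j l \<in> borel_measurable M" for j l
    unfolding kernel_approx_def by measurable
  have term_finite: "ennreal (real l powr (1 / 2)) * \<theta> l < \<top>" for l
  proof -
    have "ennreal (real l powr (1 / 2)) * \<theta> l \<le> (\<Sum>l. ennreal (real l powr (1 / 2)) * \<theta> l)"
      using sum_le_suminf[of "\<lambda>l. ennreal (real l powr (1 / 2)) * \<theta> l" "{l}"] by simp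
    then show ?thesis
      using theta2 unfolding \<theta>_def by (rule order.strict_trans1)
  qed
  \<comment> \<open>At l = 0 the weight vanishes and the series says nothing about the coefficient,
    so \<open>theta0\<close> decides; for l >= 1 the weight is positive and an infinite coefficient
    would make the series infinite.\<close>
  have \<theta>_finite: "\<theta> l < \<top>" for l
  proof (cases "l = 0")
    case True
    then show ?thesis
      using theta0 by (simp add: \<theta>_def)
  next
    case False
    show ?thesis
    proof (rule ccontr)
      assume "\<not> \<theta> l < \<top>"
      then have "\<theta> l = \<top>"
        by (simp flip: less_top)
      then show False
        using term_finite[of l] False by (simp add: ennreal_mult_top)
    qed
  qed
  interpret ustat M \<epsilon> h F "\<lambda>l. enn2real (\<theta> l)"
  proof
    fix j l :: nat
    have le0: "Lp_norm M 2 (kernel_approx \<epsilon> h F (int j) 0) \<le> \<theta> 0"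
      unfolding \<theta>_def dep_coeff_def by (auto intro: SUP_upper)
    show "kernel_approx \<epsilon> h F (int j) 0 \<in> L2 M"
      "l2norm M (kernel_approx \<epsilon> h F (int j) 0) \<le> enn2real (\<theta> 0)"
      by (rule Lp_norm_2_le_imp[OF kernel_meas le0 \<theta>_finite])+
    have le: "Lp_norm M 2 (\<lambda>\<omega>. kernel_approx \<epsilon> h F (int j) (Suc l) \<omega> - kernel_approx \<epsilon> h F (int j) l \<omega>) \<le> \<theta> (Suc l)"
      unfolding \<theta>_def dep_coeff_def by (auto intro: SUP_upper)
    show "(\<lambda>\<omega>. kernel_approx \<epsilon> h F (int j) (Suc l) \<omega> - kernel_approx \<epsilon> h F (int j) l \<omega>) \<in> L2 M"
      "l2norm M (\<lambda>\<omega>. kernel_approx \<epsilon> h F (int j) (Suc l) \<omega> - kernel_approx \<epsilon> h F (int j) l \<omega>)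
        \<le> enn2real (\<theta> (Suc l))"
      by (rule Lp_norm_2_le_imp[OF _ le \<theta>_finite], measurable)+
    have "ennreal (real l powr (1 / 2)) * \<theta> l = ennreal (sqrt (real l) * enn2real (\<theta> l))" for l
      using \<theta>_finite[of l] by (simp add: powr_half_sqrt ennreal_mult)
    then have "(\<Sum>l. ennreal (sqrt (real l) * enn2real (\<theta> l))) \<noteq> \<top>"
      using theta2 unfolding \<theta>_def by (simp add: less_top)
    then show "summable (\<lambda>l. sqrt (real l) * enn2real (\<theta> l))"
      by (intro summable_suminf_not_top) auto
  qed (use h_meas h_sym in auto)
  note L2_limit_iff = L2_limit_projection[OF copy]
  have "\<forall>k. \<exists>Y. L2_limit M (projection_approx M \<epsilon> \<epsilon>' h F k) Y"
    using Yl_limit_exists unfolding L2_limit_iff by metis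
  then have exists: "\<exists>Y. \<forall>k. L2_limit M (projection_approx M \<epsilon> \<epsilon>' h F k) (Y k)"
    by metis
  have X_shift: "X (i + j) \<omega> = f (\<lambda>u. shift i \<omega> (j - u))" for i j \<omega>
    by (simp add: X_eq shift_process_def shift_def algebra_simps)
  have [measurable]: "(\<lambda>x. f (\<lambda>u. x (j - u))) \<in> borel_measurable seq_space" for j :: int
    by (rule measurable_compose[OF _ f_meas]) (auto intro!: measurable_PiM_single')
  have X_meas [measurable]: "X i \<in> borel_measurable M" for i
    using measurable_compose[OF shift_measurable[of 0], of "\<lambda>x. f (\<lambda>u. x (i - u))" borel]
    by (simp add: X_shift[of 0 i, simplified, symmetric])
  define V where "V i j \<omega> = h (X (int i) \<omega>) (X (int j) \<omega>)" for i j :: nat and \<omega>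
  have V_meas [measurable]: "V i j \<in> borel_measurable M" for i j
    unfolding V_def by measurable
  have V_lim: "AE \<omega> in M. (\<lambda>l. ker l (int i) (int j) \<omega>) \<longlonglongrightarrow> V i j \<omega>" if "i < j" for i j
  proof -
    define k where "k = int j - int i"
    \<comment> \<open>The convergence hypothesis concerns pairs (0, j). Written as a measurable
      property of the path, it passes to every pair (i, j) with i < j by stationarity.\<close>
    define P where "P x \<longleftrightarrow> (\<lambda>l. seq_ker l k x) \<longlonglongrightarrow> h (f (\<lambda>u. x (0 - u))) (f (\<lambda>u. x (k - u)))"
      for x :: "int \<Rightarrow> real"
    have P: "Measurable.pred seq_space P"
      unfolding P_def by measurable
    have "AE \<omega> in M. P (shift 0 \<omega>)"
      using kernel_conv[of "j - i"] that X_shift[of 0 0] X_shift[of 0 k]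
      by (simp add: P_def k_def of_nat_diff kernel_approx_eq)
    from AE_stationary[OF P this, of "int i"] show ?thesis
      using X_shift[of "int i" 0] X_shift[of "int i" k] by (simp add: P_def V_def ker_shift k_def)
  qed
  have "weak_conv_m
      (\<lambda>n. distr M borel
        (\<lambda>\<omega>. (U_stat h X n \<omega> - (\<integral>x. U_stat h X n x \<partial>M)) / real n powr (3 / 2)))
      (centered_normal (\<Sum>\<^sub>\<infinity>k. covar M (Y 0) (Y k)))"
    if Y: "\<forall>k. L2_limit M (projection_approx M \<epsilon> \<epsilon>' h F k) (Y k)"
      and summable: "(\<lambda>k. \<bar>covar M (Y 0) (Y k)\<bar>) summable_on UNIV" for Y
  proof -
    have Y_L2: "Y k \<in> L2 M" and Y_lim: "(\<lambda>l. l2norm M (\<lambda>\<omega>. Yl l k \<omega> - Y k \<omega>)) \<longlonglongrightarrow> 0" for k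
      using Y unfolding L2_limit_iff by auto
    have covar: "covar M (Y 0) (Y k) = \<Gamma> Y k" for k
      by (rule covar_eq[where Y=Y, OF Y_L2 Y_lim])
    have \<Gamma>_summable: "(\<lambda>k. \<bar>\<Gamma> Y k\<bar>) summable_on UNIV"
      using summable unfolding covar .
    have U_eq: "U_stat h X n = (\<lambda>\<omega>. \<Sum>(i, j)\<in>pairs n. V i j \<omega>)" for n
      by (simp add: fun_eq_iff U_stat_def pairs_def V_def)
    have U_meas [measurable]: "U_stat h X n \<in> borel_measurable M" for n
      unfolding U_eq split_beta by measurable
    have n_powr: "real n powr (3 / 2) = real n * sqrt (real n)" for n
    proof -
      have "real n powr (1 + 1 / 2) = real n * sqrt (real n)"
        unfolding powr_add by (simp add: powr_half_sqrt)
      then show ?thesis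
        by simp
    qed
    have "clt M (\<lambda>n \<omega>. (U_stat h X n \<omega> - expectation (U_stat h X n)) / (real n * sqrt (real n))) (\<Sum>\<^sub>\<infinity>k. \<Gamma> Y k)"
      unfolding U_eq
      by (rule U_statistic_clt[where Y=Y and V=V, OF Y_L2 Y_lim \<Gamma>_summable])
        (rule ker_limit[OF V_meas V_lim]; assumption)+
    then show ?thesis
      \<comment> \<open>Nonnegativity of the limiting variance makes \<open>centered_normal\<close>
        a probability law with the expected characteristic function, as Levy's theorem
        demands.\<close>
      unfolding covar n_powr
      by (rule clt_weak_conv) (use \<Gamma>_nonneg[where Y=Y, OF Y_L2 Y_lim \<Gamma>_summable] in simp, measurable)
  qed
  with exists show ?thesis
    by blast
qed

end
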